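(* Let $u,u_\varepsilon\in H^m_0(\Omega)$ be the weak solutions of $$u+\alpha(-1)^m(\nabla\cdot)^m(v\nabla^m u)=f,\qquad u_\varepsilon+\alpha(-1)^m(\nabla\cdot)^m(v_\varepsilon\nabla^m u_\varepsilon)=f\quad\text{in }\Omega,$$ with homogeneous boundary conditions (vanishing trace and normal derivatives up to order $m-1$ on $\partial\Omega$). Then, for $\varepsilon\to0$, $$\mathcal J(u_\varepsilon;v_\varepsilon)=\mathcal J(u;v)+2\varepsilon^3\alpha(\kappa-1)\,\mathbb M\nabla^m u(y)\cdot\nabla^m u(y)+o(\varepsilon^3).$$
   Context: Setting. Fix an integer $m\ge 2$, $\alpha>0$, $0<\kappa<\tfrac12$. $\Omega\subset\mathbb R^2$ is open, connected, bounded with Lipschitz boundary; $f\in L^\infty(\Omega)$; $K\subset\Omega$ is closed with positive 2-dimensional Hausdorff measure; $\delta_0>0$ and $L_0\subseteq\Omega\setminus K$ is an open domain with smooth boundary and $\mathrm{dist}(\overline{L_0},\partial\Omega\cup K)\ge\delta_0$. Fix $y\in L_0$, $\tau\in\mathbb S^1$. For $0<\varepsilon<1$ let $\Sigma_\varepsilon=\{y+\rho\tau:-\varepsilon\le\rho\le\varepsilon\}$ and $\Omega_\varepsilon=\Omega_\varepsilon(y,\tau)=\{x\in\mathbb R^2:\mathrm{dist}(x,\Sigma_\varepsilon)<\varepsilon^2\}$; $\varepsilon$ is always such that $\Omega_\varepsilon\subset L_0$. $|\Omega_\varepsilon|$ is its Lebesgue measure. Tensors. $\bm i=(i_1,\dots,i_m)$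 with $i_k\in\{1,2\}$; $A\cdot B=\sum_{\bm i}A_{\bm i}B_{\bm i}$ for tensors of order $m$, $|A|^2=A\cdot A$; $(\nabla^m u)_{\bm i}=\partial^m u/\partial x_{i_1}\cdots\partial x_{i_m}$; $(\nabla\cdot)^m$ is the divergence applied $m$ times. For a tensor $\mathbb M$ of order $2m$ and $E$ of order $m$, $\mathbb ME\cdot E=\sum_{\bm i,\bm j}E_{\bm i}\mathbb M_{\bm i\bm j}E_{\bm j}$. Coefficients and functional. $v=\kappa$ on $K$, $v=1$ on $\Omega\setminus K$; $v_\varepsilon=\kappa$ on $K\cup\overline{\Omega_\varepsilon}$, $v_\varepsilon=1$ elsewhere in $\Omega$. For $w\in H^m_0(\Omega)$ and $\zeta\in L^\infty(\Omega)$, $\zeta>0$ a.e., $\mathcal J(w;\zeta)=\frac12\int_\Omega(w-f)^2dx+\frac\alpha2\int_\Omega\zeta|\nabla^m w|^2dx$. A weak solution $w\in H^m_0(\Omega)$ of $w+\alpha(-1)^m(\nabla\cdot)^m(\zeta\nabla^m w)=f$ satisfies $\int_\Omega w\varphi+\alpha\int_\Omega\zeta\nabla^m w\cdot\nabla^m\varphi=\int_\Omega f\varphi$ for all $\varphi\in H^m_0(\Omega)$. The solution $u$ is of class $C^m$ near $y$, so $\nabla^m u(y)$ is defined pointwise. The tensor $\mathbb M$. Let $V^{\bm i}(x)=\frac1{m!}x_{i_1}\cdots x_{i_m}$, let $\gamma_\varepsilon=\kappa$ in $\Omega_\varepsilon$ and $1$ elsewhere, and let $V^{\bm i}_\varepsilon\in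 H^m(\Omega)$ be the weak solution of $(\nabla\cdot)^m(\gamma_\varepsilon\nabla^m V^{\bm i}_\varepsilon)=0$ in $\Omega$ with $V^{\bm i}_\varepsilon-V^{\bm i}\in H^m_0(\Omega)$ (i.e. same trace and normal derivatives up to order $m-1$). $\mathbb M=(\mathbb M_{\bm i\bm j})$ is the tensor of order $2m$ defined, possibly up to extraction of a subsequence $\varepsilon\to0$, by $$\frac1{|\Omega_\varepsilon|}\int_{\Omega_\varepsilon}\frac{\partial^m V^{\bm i}_\varepsilon}{\partial x_{j_1}\cdots\partial x_{j_m}}\phi\,dx\to\mathbb M_{\bm i\bm j}\,\phi(y)\quad\text{for all }\phi\in C^0(\overline\Omega).$$ *)

theory Defs
  imports "HOL-Analysis.Analysis" "HOL-Library.Landau_Symbols"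
begin

type_synonym plane = "real^2"

subsection \<open>Index words and tensors\<close>

text \<open>A tensor of order \<open>m\<close> over the plane is a function on words \<open>(i\<^sub>1, \<dots>, i\<^sub>m)\<close> over the
  two-element type \<open>2\<close>; a tensor of order \<open>2 * m\<close> takes two such words. Values at words of another
  length are irrelevant.\<close>

type_synonym word2 = "2 list"
type_synonym tensor = "word2 \<Rightarrow> real"
type_synonym tensor2 = "word2 \<Rightarrow> word2 \<Rightarrow> real"

definition words :: "nat \<Rightarrow> word2 set" where
  "words m = {i. length i = m}"

definition tdot :: "nat \<Rightarrow> tensor \<Rightarrow> tensor \<Rightarrow> real" where
  "tdot m A B = (\<Sum>i\<in>words m. A i * B i)"

definition tquad :: "nat \<Rightarrow> tensor2 \<Rightarrow> tensor \<Rightarrow> real" where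
  "tquad m M E = (\<Sum>i\<in>words m. \<Sum>j\<in>words m. E i * M i j * E j)"

subsection \<open>Classical derivatives\<close>

definition partial :: "2 \<Rightarrow> (plane \<Rightarrow> real) \<Rightarrow> plane \<Rightarrow> real" where
  "partial k f x = frechet_derivative f (at x) (axis k 1)"

primrec partials :: "word2 \<Rightarrow> (plane \<Rightarrow> real) \<Rightarrow> plane \<Rightarrow> real" where
  "partials [] f = f"
| "partials (k # i) f = partial k (partials i f)"

text \<open>\<open>U\<close> is meant to be open.\<close>

definition C_k_on :: "nat \<Rightarrow> (plane \<Rightarrow> real) \<Rightarrow> plane set \<Rightarrow> bool" where
  "C_k_on k f U \<longleftrightarrow>
     (\<forall>i. length i < k \<longrightarrow> (\<forall>x\<in>U. partials i f differentiable (at x))) \<and>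
     (\<forall>i. length i \<le> k \<longrightarrow> continuous_on U (partials i f))"

definition test_function :: "plane set \<Rightarrow> (plane \<Rightarrow> real) \<Rightarrow> bool" where
  "test_function \<Omega> \<phi> \<longleftrightarrow>
     (\<forall>k. C_k_on k \<phi> UNIV) \<and> compact (closure {x. \<phi> x \<noteq> 0}) \<and> closure {x. \<phi> x \<noteq> 0} \<subseteq> \<Omega>"

subsection \<open>Lebesgue and Sobolev spaces\<close>

text \<open>Elements of these spaces are represented by functions; two functions that agree almost
  everywhere on \<open>\<Omega>\<close> represent the same element.\<close>

definition L2 :: "plane set \<Rightarrow> (plane \<Rightarrow> real) set" where
  "L2 \<Omega> = {u. u \<in> borel_measurable (lebesgue_on \<Omega>) \<and> integrable (lebesgue_on \<Omega>) (\<lambda>x. (u x)\<^sup>2)}"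

definition Linf :: "plane set \<Rightarrow> (plane \<Rightarrow> real) set" where
  "Linf \<Omega> = {u. u \<in> borel_measurable (lebesgue_on \<Omega>) \<and>
     (\<exists>C. AE x in lebesgue_on \<Omega>. \<bar>u x\<bar> \<le> C)}"

definition is_weak_partial :: "plane set \<Rightarrow> word2 \<Rightarrow> (plane \<Rightarrow> real) \<Rightarrow> (plane \<Rightarrow> real) \<Rightarrow> bool" where
  "is_weak_partial \<Omega> i u g \<longleftrightarrow> g \<in> L2 \<Omega> \<and>
     (\<forall>\<phi>. test_function \<Omega> \<phi> \<longrightarrow>
        (LINT x|lebesgue_on \<Omega>. u x * partials i \<phi> x) =
        (-1) ^ length i * (LINT x|lebesgue_on \<Omega>. g x * \<phi> x))"

text \<open>The weak derivative is unique up to a null set, so the choice of representative does not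
  affect any integral below.\<close>

definition weak_partial :: "plane set \<Rightarrow> word2 \<Rightarrow> (plane \<Rightarrow> real) \<Rightarrow> plane \<Rightarrow> real" where
  "weak_partial \<Omega> i u = (SOME g. is_weak_partial \<Omega> i u g)"

definition Hm :: "nat \<Rightarrow> plane set \<Rightarrow> (plane \<Rightarrow> real) set" where
  "Hm m \<Omega> = {u \<in> L2 \<Omega>. \<forall>i. length i \<le> m \<longrightarrow> (\<exists>g. is_weak_partial \<Omega> i u g)}"

definition Hm_norm :: "nat \<Rightarrow> plane set \<Rightarrow> (plane \<Rightarrow> real) \<Rightarrow> real" where
  "Hm_norm m \<Omega> u =
     sqrt (\<Sum>k\<le>m. \<Sum>i\<in>words k. LINT x|lebesgue_on \<Omega>. (weak_partial \<Omega> i u x)\<^sup>2)"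

definition Hm0 :: "nat \<Rightarrow> plane set \<Rightarrow> (plane \<Rightarrow> real) set" where
  "Hm0 m \<Omega> = {u \<in> Hm m \<Omega>. \<exists>\<phi> :: nat \<Rightarrow> plane \<Rightarrow> real.
     (\<forall>n. test_function \<Omega> (\<phi> n)) \<and> (\<lambda>n. Hm_norm m \<Omega> (\<lambda>x. u x - \<phi> n x)) \<longlonglongrightarrow> 0}"

definition wgrad :: "plane set \<Rightarrow> (plane \<Rightarrow> real) \<Rightarrow> plane \<Rightarrow> tensor" where
  "wgrad \<Omega> u x = (\<lambda>i. weak_partial \<Omega> i u x)"

subsection \<open>Geometry\<close>

text \<open>Near each boundary point, in suitable orthonormal coordinates, \<open>\<Omega>\<close> is the region strictly
  above the graph of a function of class \<open>P\<close>.\<close>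

definition graph_boundary :: "((real \<Rightarrow> real) \<Rightarrow> bool) \<Rightarrow> plane set \<Rightarrow> bool" where
  "graph_boundary P \<Omega> \<longleftrightarrow> (\<forall>p\<in>frontier \<Omega>. \<exists>a b r h g.
     norm a = 1 \<and> norm b = 1 \<and> a \<bullet> b = 0 \<and> r > 0 \<and> h > 0 \<and> P g \<and>
     (\<forall>s t. \<bar>s\<bar> < r \<longrightarrow> \<bar>t\<bar> < h \<longrightarrow> (p + s *\<^sub>R a + t *\<^sub>R b \<in> \<Omega> \<longleftrightarrow> g s < t)))"

definition lipschitz_boundary :: "plane set \<Rightarrow> bool" where
  "lipschitz_boundary = graph_boundary (\<lambda>g. \<exists>C. C-lipschitz_on UNIV g)"

definition smooth_boundary :: "plane set \<Rightarrow> bool" where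
  "smooth_boundary = graph_boundary (\<lambda>g. \<forall>n x. (deriv ^^ n) g differentiable (at x))"

text \<open>For \<open>s > 0\<close> (so that sets of diameter \<open>0\<close> contribute nothing), normalised so that the
  \<open>n\<close>-dimensional measure is Lebesgue measure on \<open>n\<close>-space.\<close>

definition hausdorff_measure :: "real \<Rightarrow> plane set \<Rightarrow> ennreal" where
  "hausdorff_measure s A = (SUP d\<in>{0<..}.
     INF U\<in>{U :: nat \<Rightarrow> plane set. (\<forall>n. bounded (U n) \<and> diameter (U n) \<le> d) \<and> A \<subseteq> (\<Union>n. U n)}.
       \<Sum>n. ennreal (unit_ball_vol s / 2 powr s * diameter (U n) powr s))"

definition Sigma_seg :: "plane \<Rightarrow> plane \<Rightarrow> real \<Rightarrow> plane set" where
  "Sigma_seg y \<tau> \<epsilon> = {y + \<rho> *\<^sub>R \<tau> | \<rho>. -\<epsilon> \<le> \<rho> \<and> \<rho> \<le> \<epsilon>}"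

definition Omega_eps :: "plane \<Rightarrow> plane \<Rightarrow> real \<Rightarrow> plane set" where
  "Omega_eps y \<tau> \<epsilon> = {x. infdist x (Sigma_seg y \<tau> \<epsilon>) < \<epsilon>\<^sup>2}"

definition admissible_eps :: "plane set \<Rightarrow> plane \<Rightarrow> plane \<Rightarrow> real set" where
  "admissible_eps L0 y \<tau> = {\<epsilon>. 0 < \<epsilon> \<and> \<epsilon> < 1 \<and> Omega_eps y \<tau> \<epsilon> \<subseteq> L0}"

text \<open>The coefficient that equals \<open>\<kappa>\<close> on \<open>A\<close> and \<open>1\<close> elsewhere.\<close>

definition two_phase :: "real \<Rightarrow> plane set \<Rightarrow> plane \<Rightarrow> real" where
  "two_phase \<kappa> A x = (if x \<in> A then \<kappa> else 1)"

subsection \<open>The functional and the boundary value problems\<close>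

definition J_fun :: "nat \<Rightarrow> real \<Rightarrow> plane set \<Rightarrow> (plane \<Rightarrow> real) \<Rightarrow> (plane \<Rightarrow> real) \<Rightarrow> (plane \<Rightarrow> real) \<Rightarrow> real"
  where
  "J_fun m \<alpha> \<Omega> f w \<zeta> =
     1 / 2 * (LINT x|lebesgue_on \<Omega>. (w x - f x)\<^sup>2) +
     \<alpha> / 2 * (LINT x|lebesgue_on \<Omega>. \<zeta> x * tdot m (wgrad \<Omega> w x) (wgrad \<Omega> w x))"

text \<open>\<open>w + \<alpha> (-1)\<^sup>m (\<nabla>\<cdot>)\<^sup>m (\<zeta> \<nabla>\<^sup>m w) = f\<close> with homogeneous Dirichlet conditions.\<close>

definition weak_solution ::
  "nat \<Rightarrow> real \<Rightarrow> plane set \<Rightarrow> (plane \<Rightarrow> real) \<Rightarrow> (plane \<Rightarrow> real) \<Rightarrow> (plane \<Rightarrow> real) \<Rightarrow> bool" where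
  "weak_solution m \<alpha> \<Omega> \<zeta> f w \<longleftrightarrow> w \<in> Hm0 m \<Omega> \<and>
     (\<forall>\<phi>\<in>Hm0 m \<Omega>.
        (LINT x|lebesgue_on \<Omega>. w x * \<phi> x) +
        \<alpha> * (LINT x|lebesgue_on \<Omega>. \<zeta> x * tdot m (wgrad \<Omega> w x) (wgrad \<Omega> \<phi> x)) =
        (LINT x|lebesgue_on \<Omega>. f x * \<phi> x))"

definition V_poly :: "word2 \<Rightarrow> plane \<Rightarrow> real" where
  "V_poly i x = 1 / fact (length i) * prod_list (map (\<lambda>k. x $ k) i)"

text \<open>\<open>(\<nabla>\<cdot>)\<^sup>m (\<gamma> \<nabla>\<^sup>m W) = 0\<close> with the Dirichlet data of \<open>V\<close>.\<close>

definition weak_solution_V ::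
  "nat \<Rightarrow> plane set \<Rightarrow> (plane \<Rightarrow> real) \<Rightarrow> (plane \<Rightarrow> real) \<Rightarrow> (plane \<Rightarrow> real) \<Rightarrow> bool" where
  "weak_solution_V m \<Omega> \<gamma> V W \<longleftrightarrow> W \<in> Hm m \<Omega> \<and> (\<lambda>x. W x - V x) \<in> Hm0 m \<Omega> \<and>
     (\<forall>\<phi>\<in>Hm0 m \<Omega>.
        (LINT x|lebesgue_on \<Omega>. \<gamma> x * tdot m (wgrad \<Omega> W x) (wgrad \<Omega> \<phi> x)) = 0)"

text \<open>\<open>M\<close> is the tensor obtained as \<open>\<epsilon>\<close> tends to \<open>0\<close> within \<open>E\<close>. Passing to a subsequence amounts
  to shrinking \<open>E\<close>; the limit of the whole family is the case in which \<open>E\<close> contains all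
  admissible \<open>\<epsilon>\<close>.\<close>

definition polarization_tensor ::
  "nat \<Rightarrow> real \<Rightarrow> plane set \<Rightarrow> plane \<Rightarrow> plane \<Rightarrow> real set \<Rightarrow> tensor2 \<Rightarrow> bool" where
  "polarization_tensor m \<kappa> \<Omega> y \<tau> E M \<longleftrightarrow> (\<exists>V :: real \<Rightarrow> word2 \<Rightarrow> plane \<Rightarrow> real.
     (\<forall>\<epsilon>\<in>E. \<forall>i\<in>words m.
        weak_solution_V m \<Omega> (two_phase \<kappa> (Omega_eps y \<tau> \<epsilon>)) (V_poly i) (V \<epsilon> i)) \<and>
     (\<forall>i\<in>words m. \<forall>j\<in>words m. \<forall>\<phi>. continuous_on (closure \<Omega>) \<phi> \<longrightarrow>
        ((\<lambda>\<epsilon>. 1 / measure lebesgue (Omega_eps y \<tau> \<epsilon>) *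
              (LINT x|lebesgue_on (Omega_eps y \<tau> \<epsilon>). weak_partial \<Omega> j (V \<epsilon> i) x * \<phi> x))
          \<longlongrightarrow> M i j * \<phi> y) (at 0 within E)))"

end

theory Submission imports Defs begin

text \<open>
  Write \<open>A\<close> for the thin set \<open>\<Omega>\<^sub>\<epsilon>\<close>, \<open>D\<close> for \<open>\<nabla>\<^sup>m\<close> and
  \<open>\<mu> = |A|\<close>. Testing each state equation with the solution of the other turns the difference of the
  two energies into an integral over \<open>A\<close> alone,
  \<open>J(u\<^sub>\<epsilon>) - J(u) = \<alpha> (\<kappa> - 1) / 2 * \<integral>\<^sub>A D u\<^sub>\<epsilon> \<cdot> D u\<close>
  (lemma \<open>J_fun_difference\<close>). Since \<open>\<mu> / \<epsilon>\<^sup>3\<close> tends to \<open>4\<close> (lemma \<open>measure_Omega_eps\<close>), the theorem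
  says that the mean of \<open>D u\<^sub>\<epsilon> \<cdot> D u\<close> over \<open>A\<close> tends to \<open>M E \<cdot> E\<close>, where \<open>E = D u(y)\<close>; this is
  lemma \<open>polarization_limit\<close>, stated along a sequence of parameters.

  Let \<open>r = u\<^sub>\<epsilon> - u\<close> and, for a word \<open>i\<close>, let \<open>s = V\<^sup>i\<^sub>\<epsilon> - V\<^sup>i\<close> be the corrector and \<open>T = D V\<^sup>i\<close>, a constant
  tensor. Both \<open>r\<close> and \<open>s\<close> solve equations whose right-hand sides live on \<open>A\<close>, so their energy norms
  are \<open>O(\<mu>\<^sup>1\<^sup>/\<^sup>2)\<close>. Testing the equation of \<open>r\<close> with \<open>s\<close> and that of \<open>s\<close> with \<open>r\<close> gives the reciprocity
  relation (lemma \<open>corrector_reciprocity\<close>)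
  \<open>\<integral>\<^sub>A (D u \<cdot> D s - T \<cdot> D r) = (\<integral> r s) / (\<alpha> (1 - \<kappa>)) - \<integral>\<^sub>K D r \<cdot> D s\<close>.
  The definition of \<open>M\<close> gives the limit of the mean of \<open>E \<cdot> D s\<close> over \<open>A\<close>, and \<open>D u\<close> is close to \<open>E\<close> there;
  so, once the right-hand side is known to be \<open>o(\<mu>)\<close>, the mean of \<open>T \<cdot> D r\<close> is known as well. Finally
  \<open>E\<close> is symmetric, hence \<open>\<Sum>\<^sub>i E\<^sub>i D V\<^sup>i = E\<close> (lemma \<open>V_grad_symmetric\<close>), and summing over \<open>i\<close> yields the mean
  of \<open>D r \<cdot> E\<close>.

  The right-hand side is \<open>o(\<mu>)\<close> because the normalised corrector \<open>s / \<mu>\<^sup>1\<^sup>/\<^sup>2\<close> is bounded and tends to zero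
  weakly: it is driven by a field concentrated on a set of vanishing measure. Weak convergence to zero
  becomes strong convergence for the derivatives of order less than \<open>m\<close> (lemma \<open>compactness_test\<close>).
  This controls \<open>\<integral> r s\<close>, and a Caccioppoli argument with a cut-off vanishing near \<open>y\<close> then controls
  \<open>D s\<close> on \<open>K\<close> (lemma \<open>corrector_vanishes\<close>).

  The compactness step stays elementary. Since \<open>m \<ge> 2\<close> and the plane is two-dimensional, the value of a test
  function at a point is the integral of a second derivative over a quadrant, hence a bounded functional for the energy norm.
  Every such functional is represented, up to an arbitrarily small error, by a near-minimiser of the associated
  quadratic energy among the test functions (lemma \<open>approximate_Riesz\<close>), so weak convergence gives pointwise
  convergence, dominated convergence gives convergence in the mean square, and interpolation carries it to the
  intermediate derivatives.
\<close>

section \<open>Square-integrable functions and tensor fields\<close>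

definition sqint :: "'a measure \<Rightarrow> ('a \<Rightarrow> real) \<Rightarrow> bool" where
  "sqint M f \<longleftrightarrow> f \<in> borel_measurable M \<and> integrable M (\<lambda>x. (f x)\<^sup>2)"

definition nrm :: "'a measure \<Rightarrow> ('a \<Rightarrow> real) \<Rightarrow> real" where
  "nrm M f = sqrt (LINT x|M. (f x)\<^sup>2)"

lemma sqint_integrable: "sqint M f \<Longrightarrow> integrable M (\<lambda>x. (f x)\<^sup>2)"
  by (simp add: sqint_def)

lemma nrm_nonneg [simp]: "0 \<le> nrm M f"
  by (simp add: nrm_def)

lemma nrm_sq: "(nrm M f)\<^sup>2 = (LINT x|M. (f x)\<^sup>2)"
  by (simp add: nrm_def)

lemma sqint_mult:
  assumes "sqint M f" "sqint M g"
  shows "integrable M (\<lambda>x. f x * g x)"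
proof (rule Bochner_Integration.integrable_bound)
  show "integrable M (\<lambda>x. (f x)\<^sup>2 + (g x)\<^sup>2)"
    using assms by (auto simp: sqint_def)
  show "(\<lambda>x. f x * g x) \<in> borel_measurable M"
    using assms by (auto simp: sqint_def)
  have "\<bar>a * b\<bar> \<le> a\<^sup>2 + b\<^sup>2" for a b :: real
  proof -
    have "2 * (\<bar>a\<bar> * \<bar>b\<bar>) \<le> a\<^sup>2 + b\<^sup>2"
      using sum_squares_bound[of "\<bar>a\<bar>" "\<bar>b\<bar>"] by simp
    moreover have "0 \<le> \<bar>a\<bar> * \<bar>b\<bar>" by simp
    ultimately show ?thesis unfolding abs_mult by linarith
  qed
  then show "AE x in M. norm (f x * g x) \<le> norm ((f x)\<^sup>2 + (g x)\<^sup>2)"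
    by simp
qed

text \<open>The polynomial \<open>t \<mapsto> \<integral> (t f + g)\<^sup>2\<close> has no negative value, so its discriminant is not positive.\<close>

lemma Cauchy_Schwarz_sqint:
  assumes "sqint M f" "sqint M g"
  shows "\<bar>LINT x|M. f x * g x\<bar> \<le> nrm M f * nrm M g"
proof -
  let ?a = "LINT x|M. (f x)\<^sup>2" and ?b = "LINT x|M. f x * g x" and ?c = "LINT x|M. (g x)\<^sup>2"
  have *: "0 \<le> ?a * t\<^sup>2 + 2 * ?b * t + ?c" for t
  proof -
    have i: "integrable M (\<lambda>x. (f x)\<^sup>2)" "integrable M (\<lambda>x. (g x)\<^sup>2)" "integrable M (\<lambda>x. f x * g x)"
      using assms sqint_mult by (auto simp: sqint_def)
    have "0 \<le> (LINT x|M. (t * f x + g x)\<^sup>2)" by simp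
    also have "(\<lambda>x. (t * f x + g x)\<^sup>2) = (\<lambda>x. t\<^sup>2 * (f x)\<^sup>2 + 2 * t * (f x * g x) + (g x)\<^sup>2)"
      by (auto simp: power2_eq_square algebra_simps)
    also have "(LINT x|M. t\<^sup>2 * (f x)\<^sup>2 + 2 * t * (f x * g x) + (g x)\<^sup>2) = t\<^sup>2 * ?a + 2 * t * ?b + ?c"
      using i by simp
    finally show ?thesis by (simp add: mult_ac)
  qed
  have a0: "0 \<le> ?a" "0 \<le> ?c" by auto
  have "?b\<^sup>2 \<le> ?a * ?c"
  proof (cases "?a = 0")
    case True
    have "?b = 0"
    proof (rule ccontr)
      assume "?b \<noteq> 0"
      with *[of "- (?c + 1) / (2 * ?b)"] True a0 show False by (auto simp: field_simps)
    qed
    then show ?thesis using True by simp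
  next
    case False
    then have "?a > 0" using a0(1) by linarith
    have "0 \<le> ?a * (- ?b / ?a)\<^sup>2 + 2 * ?b * (- ?b / ?a) + ?c" by (rule *)
    also have "\<dots> = ?c - ?b\<^sup>2 / ?a"
      using \<open>?a > 0\<close> by (simp add: power2_eq_square field_simps)
    finally show ?thesis using \<open>?a > 0\<close> by (simp add: field_simps)
  qed
  then have "sqrt (?b\<^sup>2) \<le> sqrt (?a * ?c)" by (rule real_sqrt_le_mono)
  then show ?thesis by (simp add: nrm_def real_sqrt_mult)
qed

lemma sqint_add: "sqint M f \<Longrightarrow> sqint M g \<Longrightarrow> sqint M (\<lambda>x. f x + g x)"
  unfolding sqint_def power2_sum
  by (auto intro!: Bochner_Integration.integrable_add
      simp: mult.assoc sqint_mult[unfolded sqint_def])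

lemma sqint_cmult: "sqint M f \<Longrightarrow> sqint M (\<lambda>x. c * f x)"
  by (auto simp: sqint_def power_mult_distrib)

lemma sqint_diff: "sqint M f \<Longrightarrow> sqint M g \<Longrightarrow> sqint M (\<lambda>x. f x - g x)"
  using sqint_add[of M f "\<lambda>x. -1 * g x"] sqint_cmult[of M g "-1"] by simp

lemma sqint_bounded_mult:
  assumes "sqint M f" "w \<in> borel_measurable M" "\<And>x. x \<in> space M \<Longrightarrow> \<bar>w x\<bar> \<le> B"
  shows "sqint M (\<lambda>x. w x * f x)"
proof -
  have "integrable M (\<lambda>x. (w x * f x)\<^sup>2)"
  proof (rule Bochner_Integration.integrable_bound)
    show "integrable M (\<lambda>x. B\<^sup>2 * (f x)\<^sup>2)" using assms by (auto simp: sqint_def)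
    show "AE x in M. norm ((w x * f x)\<^sup>2) \<le> norm (B\<^sup>2 * (f x)\<^sup>2)"
      using assms(3) by (intro AE_I2) (force simp: power_mult_distrib abs_le_square_iff[symmetric]
          intro!: mult_right_mono)
    show "(\<lambda>x. (w x * f x)\<^sup>2) \<in> borel_measurable M" using assms by (auto simp: sqint_def)
  qed
  then show ?thesis using assms by (auto simp: sqint_def)
qed

lemma nrm_bounded_mult:
  assumes "sqint M f" "w \<in> borel_measurable M" "\<And>x. x \<in> space M \<Longrightarrow> \<bar>w x\<bar> \<le> B" "0 \<le> B"
  shows "nrm M (\<lambda>x. w x * f x) \<le> B * nrm M f"
proof -
  have "(LINT x|M. (w x * f x)\<^sup>2) \<le> (LINT x|M. B\<^sup>2 * (f x)\<^sup>2)"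
  proof (rule integral_mono)
    show "integrable M (\<lambda>x. (w x * f x)\<^sup>2)"
      using sqint_bounded_mult[OF assms(1-3)] by (auto simp: sqint_def)
    show "integrable M (\<lambda>x. B\<^sup>2 * (f x)\<^sup>2)" using assms by (auto simp: sqint_def)
    show "(w x * f x)\<^sup>2 \<le> B\<^sup>2 * (f x)\<^sup>2" if "x \<in> space M" for x
      using assms(3)[OF that] by (auto simp: power_mult_distrib abs_le_square_iff[symmetric]
          intro!: mult_right_mono)
  qed
  then have "sqrt (LINT x|M. (w x * f x)\<^sup>2) \<le> sqrt (B\<^sup>2 * (LINT x|M. (f x)\<^sup>2))"
    by (intro real_sqrt_le_mono) simp
  then show ?thesis using assms(4) by (simp add: nrm_def real_sqrt_mult)
qed

lemma nrm_cmult: "nrm M (\<lambda>x. c * f x) = \<bar>c\<bar> * nrm M f"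
  by (simp add: nrm_def power_mult_distrib real_sqrt_mult)

lemma nrm_cong_AE:
  assumes "AE x in M. f x = g x" "f \<in> borel_measurable M" "g \<in> borel_measurable M"
  shows "nrm M f = nrm M g"
proof -
  have "(LINT x|M. (f x)\<^sup>2) = (LINT x|M. (g x)\<^sup>2)"
    using assms by (intro integral_cong_AE) auto
  then show ?thesis by (simp add: nrm_def)
qed

lemma nrm_triangle:
  assumes "sqint M f" "sqint M g"
  shows "nrm M (\<lambda>x. f x + g x) \<le> nrm M f + nrm M g"
proof -
  have i: "integrable M (\<lambda>x. (f x)\<^sup>2)" "integrable M (\<lambda>x. (g x)\<^sup>2)" "integrable M (\<lambda>x. f x * g x)"
    using assms sqint_mult by (auto simp: sqint_def)
  have "(nrm M (\<lambda>x. f x + g x))\<^sup>2 = (LINT x|M. (f x)\<^sup>2 + (g x)\<^sup>2 + 2 * (f x * g x))"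
    by (simp add: nrm_sq power2_sum mult.assoc)
  also have "\<dots> = (nrm M f)\<^sup>2 + (nrm M g)\<^sup>2 + 2 * (LINT x|M. f x * g x)"
    using i by (simp add: nrm_sq)
  also have "\<dots> \<le> (nrm M f + nrm M g)\<^sup>2"
    using Cauchy_Schwarz_sqint[OF assms] by (simp add: power2_sum mult.assoc)
  finally show ?thesis by (rule power2_le_imp_le) simp
qed

lemma nrm_mono:
  assumes "sqint M g" "f \<in> borel_measurable M" "\<And>x. x \<in> space M \<Longrightarrow> \<bar>f x\<bar> \<le> \<bar>g x\<bar>"
  shows "sqint M f" "nrm M f \<le> nrm M g"
proof -
  have le: "(f x)\<^sup>2 \<le> (g x)\<^sup>2" if "x \<in> space M" for x
    using assms(3)[OF that] by (simp add: abs_le_square_iff)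
  have i: "integrable M (\<lambda>x. (f x)\<^sup>2)"
  proof (rule Bochner_Integration.integrable_bound)
    show "integrable M (\<lambda>x. (g x)\<^sup>2)" using assms by (simp add: sqint_def)
    show "AE x in M. norm ((f x)\<^sup>2) \<le> norm ((g x)\<^sup>2)" using le by (intro AE_I2) simp
  qed (use assms in measurable)
  then show "sqint M f" using assms by (simp add: sqint_def)
  have "(LINT x|M. (f x)\<^sup>2) \<le> (LINT x|M. (g x)\<^sup>2)"
    using assms i le by (intro integral_mono) (auto simp: sqint_def)
  then show "nrm M f \<le> nrm M g" by (simp add: nrm_def)
qed

lemma sqint_sum_nrm:
  assumes "finite B" "\<And>b. b \<in> B \<Longrightarrow> sqint M (f b)"
  shows "sqint M (\<lambda>x. \<Sum>b\<in>B. f b x) \<and> nrm M (\<lambda>x. \<Sum>b\<in>B. f b x) \<le> (\<Sum>b\<in>B. nrm M (f b))"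
  using assms
proof (induction B rule: finite_induct)
  case empty
  then show ?case by (simp add: sqint_def nrm_def)
next
  case (insert b B)
  then have s: "sqint M (f b)" "sqint M (\<lambda>x. \<Sum>b\<in>B. f b x)"
    "nrm M (\<lambda>x. \<Sum>b\<in>B. f b x) \<le> (\<Sum>b\<in>B. nrm M (f b))" by auto
  have "nrm M (\<lambda>x. f b x + (\<Sum>b\<in>B. f b x)) \<le> nrm M (f b) + nrm M (\<lambda>x. \<Sum>b\<in>B. f b x)"
    by (rule nrm_triangle[OF s(1,2)])
  with s insert.hyps sqint_add[OF s(1,2)] show ?case by simp
qed

lemma sqint_abs: "sqint M f \<Longrightarrow> sqint M (\<lambda>x. \<bar>f x\<bar>)" "nrm M (\<lambda>x. \<bar>f x\<bar>) = nrm M f"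
  by (auto simp: sqint_def nrm_def intro: borel_measurable_abs)

lemma nrm_le_of_bounded:
  assumes "finite_measure M" "f \<in> borel_measurable M" "\<And>x. x \<in> space M \<Longrightarrow> \<bar>f x\<bar> \<le> B"
  shows "sqint M f" and "0 \<le> B \<Longrightarrow> nrm M f \<le> B * sqrt (measure M (space M))"
proof -
  interpret finite_measure M by fact
  have 1: "sqint M (\<lambda>_. 1)" by (simp add: sqint_def)
  show "sqint M f" using sqint_bounded_mult[OF 1 assms(2,3)] by simp
  show "nrm M f \<le> B * sqrt (measure M (space M))" if "0 \<le> B"
    using nrm_bounded_mult[OF 1 assms(2,3) that] by (simp add: nrm_def)
qed

definition tsqint :: "'i set \<Rightarrow> 'a measure \<Rightarrow> ('i \<Rightarrow> 'a \<Rightarrow> real) \<Rightarrow> bool" where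
  "tsqint I M A \<longleftrightarrow> (\<forall>i\<in>I. sqint M (A i))"

definition tnrm :: "'i set \<Rightarrow> 'a measure \<Rightarrow> ('i \<Rightarrow> 'a \<Rightarrow> real) \<Rightarrow> real" where
  "tnrm I M A = L2_set (\<lambda>i. nrm M (A i)) I"

definition tform :: "'i set \<Rightarrow> 'a measure \<Rightarrow> ('a \<Rightarrow> real) \<Rightarrow> ('i \<Rightarrow> 'a \<Rightarrow> real) \<Rightarrow> ('i \<Rightarrow> 'a \<Rightarrow> real) \<Rightarrow> real"
  where "tform I M w A C = (\<Sum>i\<in>I. LINT x|M. w x * (A i x * C i x))"

definition bdd_coeff :: "'a measure \<Rightarrow> real \<Rightarrow> ('a \<Rightarrow> real) \<Rightarrow> bool" where
  "bdd_coeff M B w \<longleftrightarrow> w \<in> borel_measurable M \<and> 0 \<le> B \<and> (\<forall>x\<in>space M. \<bar>w x\<bar> \<le> B)"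

lemma tnrm_nonneg [simp]: "0 \<le> tnrm I M A"
  by (simp add: tnrm_def L2_set_nonneg)

lemma tnrm_sq: "(tnrm I M A)\<^sup>2 = (\<Sum>i\<in>I. LINT x|M. (A i x)\<^sup>2)"
  by (simp add: tnrm_def L2_set_def nrm_sq sum_nonneg)

lemma nrm_le_tnrm: "finite I \<Longrightarrow> i \<in> I \<Longrightarrow> nrm M (A i) \<le> tnrm I M A"
  unfolding tnrm_def by (rule member_le_L2_set) auto

lemma tnrm_le_sum: "tnrm I M A \<le> (\<Sum>i\<in>I. nrm M (A i))"
  unfolding tnrm_def by (rule L2_set_le_sum) auto

lemma bdd_coeff_integrable:
  assumes "bdd_coeff M B w" "sqint M f" "sqint M g"
  shows "integrable M (\<lambda>x. w x * (f x * g x))"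
  using sqint_mult[OF sqint_bounded_mult[OF assms(2)] assms(3), of w B] assms(1)
  by (auto simp: bdd_coeff_def mult.assoc)

lemma tform_bound:
  assumes "bdd_coeff M B w" "tsqint I M A" "tsqint I M C"
  shows "\<bar>tform I M w A C\<bar> \<le> B * (tnrm I M A * tnrm I M C)"
proof -
  have "\<bar>tform I M w A C\<bar> \<le> (\<Sum>i\<in>I. \<bar>LINT x|M. w x * (A i x * C i x)\<bar>)"
    unfolding tform_def by (rule sum_abs)
  also have "\<dots> \<le> (\<Sum>i\<in>I. B * (nrm M (A i) * nrm M (C i)))"
  proof (rule sum_mono)
    fix i assume i: "i \<in> I"
    then have s: "sqint M (A i)" "sqint M (C i)" using assms by (auto simp: tsqint_def)
    have w: "w \<in> borel_measurable M" "\<And>x. x \<in> space M \<Longrightarrow> \<bar>w x\<bar> \<le> B" "0 \<le> B"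
      using assms by (auto simp: bdd_coeff_def)
    have "\<bar>LINT x|M. w x * A i x * C i x\<bar> \<le> nrm M (\<lambda>x. w x * A i x) * nrm M (C i)"
      by (rule Cauchy_Schwarz_sqint[OF sqint_bounded_mult[OF s(1) w(1,2)] s(2)])
    also have "\<dots> \<le> B * nrm M (A i) * nrm M (C i)"
      by (intro mult_right_mono nrm_bounded_mult[OF s(1) w]) auto
    finally show "\<bar>LINT x|M. w x * (A i x * C i x)\<bar> \<le> B * (nrm M (A i) * nrm M (C i))"
      by (simp add: mult.assoc)
  qed
  also have "\<dots> = B * (\<Sum>i\<in>I. \<bar>nrm M (A i)\<bar> * \<bar>nrm M (C i)\<bar>)"
    by (simp add: sum_distrib_left)
  also have "\<dots> \<le> B * (tnrm I M A * tnrm I M C)"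
    unfolding tnrm_def using assms(1)
    by (intro mult_left_mono L2_set_mult_ineq) (auto simp: bdd_coeff_def)
  finally show ?thesis .
qed

lemma tsqint_add: "tsqint I M A \<Longrightarrow> tsqint I M C \<Longrightarrow> tsqint I M (\<lambda>i x. A i x + C i x)"
  and tsqint_diff: "tsqint I M A \<Longrightarrow> tsqint I M C \<Longrightarrow> tsqint I M (\<lambda>i x. A i x - C i x)"
  and tsqint_cmult: "tsqint I M A \<Longrightarrow> tsqint I M (\<lambda>i x. c * A i x)"
  by (auto simp: tsqint_def sqint_add sqint_diff sqint_cmult)

lemma tnrm_triangle:
  assumes "tsqint I M A" "tsqint I M C"
  shows "tnrm I M (\<lambda>i x. A i x + C i x) \<le> tnrm I M A + tnrm I M C"
proof -
  have "tnrm I M (\<lambda>i x. A i x + C i x) \<le> L2_set (\<lambda>i. nrm M (A i) + nrm M (C i)) I"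
    unfolding tnrm_def using assms by (intro L2_set_mono nrm_triangle) (auto simp: tsqint_def)
  also have "\<dots> \<le> tnrm I M A + tnrm I M C"
    unfolding tnrm_def by (rule L2_set_triangle_ineq)
  finally show ?thesis .
qed

lemma tnrm_cmult: "tnrm I M (\<lambda>i x. c * A i x) = \<bar>c\<bar> * tnrm I M A"
  by (simp add: tnrm_def nrm_cmult L2_set_right_distrib)

lemma tnrm_triangle_diff:
  assumes "tsqint I M A" "tsqint I M C"
  shows "tnrm I M (\<lambda>i x. A i x - C i x) \<le> tnrm I M A + tnrm I M C"
  using tnrm_triangle[OF assms(1) tsqint_cmult[OF assms(2), of "-1"]] tnrm_cmult[of I M "-1" C]
  by simp

lemma tform_add_right:
  assumes "bdd_coeff M B w" "tsqint I M A" "tsqint I M C" "tsqint I M D"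
  shows "tform I M w A (\<lambda>i x. C i x + D i x) = tform I M w A C + tform I M w A D"
  unfolding tform_def sum.distrib[symmetric]
proof (rule sum.cong[OF refl])
  fix i assume "i \<in> I"
  then have "integrable M (\<lambda>x. w x * (A i x * C i x))" "integrable M (\<lambda>x. w x * (A i x * D i x))"
    using assms by (auto intro!: bdd_coeff_integrable[of M B] simp: tsqint_def)
  then show "(LINT x|M. w x * (A i x * (C i x + D i x)))
    = (LINT x|M. w x * (A i x * C i x)) + (LINT x|M. w x * (A i x * D i x))"
    by (simp add: distrib_left)
qed

lemma tform_commute: "tform I M w A C = tform I M w C A"
  by (simp add: tform_def mult_ac)

lemma tform_cmult_right: "tform I M w A (\<lambda>i x. c * C i x) = c * tform I M w A C"
proof -
  have "(LINT x|M. w x * (A i x * (c * C i x))) = c * (LINT x|M. w x * (A i x * C i x))" for i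
    by (subst integral_mult_right_zero[symmetric]) (simp add: mult_ac)
  then show ?thesis by (simp add: tform_def sum_distrib_left)
qed

lemma tform_diff_right:
  assumes "bdd_coeff M B w" "tsqint I M A" "tsqint I M C" "tsqint I M D"
  shows "tform I M w A (\<lambda>i x. C i x - D i x) = tform I M w A C - tform I M w A D"
  using tform_add_right[OF assms(1-3) tsqint_cmult[OF assms(4), of "-1"]] tform_cmult_right[of I M w A "-1" D]
  by simp

lemma tform_add_left:
  assumes "bdd_coeff M B w" "tsqint I M A" "tsqint I M C" "tsqint I M D"
  shows "tform I M w (\<lambda>i x. C i x + D i x) A = tform I M w C A + tform I M w D A"
  using tform_add_right[OF assms] by (simp add: tform_commute)

lemma tform_diff_left:
  assumes "bdd_coeff M B w" "tsqint I M A" "tsqint I M C" "tsqint I M D"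
  shows "tform I M w (\<lambda>i x. C i x - D i x) A = tform I M w C A - tform I M w D A"
  using tform_diff_right[OF assms] by (simp add: tform_commute)

lemma tform_add_coeff:
  assumes "bdd_coeff M B w" "bdd_coeff M B' w'" "tsqint I M A" "tsqint I M C"
  shows "tform I M (\<lambda>x. w x + w' x) A C = tform I M w A C + tform I M w' A C"
  unfolding tform_def sum.distrib[symmetric]
proof (rule sum.cong[OF refl])
  fix i assume "i \<in> I"
  then have "integrable M (\<lambda>x. w x * (A i x * C i x))" "integrable M (\<lambda>x. w' x * (A i x * C i x))"
    using bdd_coeff_integrable[OF assms(1), of "A i" "C i"] bdd_coeff_integrable[OF assms(2), of "A i" "C i"]
      assms(3,4) by (auto simp: tsqint_def)
  then show "(LINT x|M. (w x + w' x) * (A i x * C i x))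
    = (LINT x|M. w x * (A i x * C i x)) + (LINT x|M. w' x * (A i x * C i x))"
    by (simp add: distrib_right)
qed

lemma tform_cmult_coeff: "tform I M (\<lambda>x. c * w x) A C = c * tform I M w A C"
  by (simp add: tform_def sum_distrib_left mult.assoc)

text \<open>This coercivity is the source of all energy estimates below.\<close>

lemma tform_lower:
  assumes "bdd_coeff M B w" "\<And>x. x \<in> space M \<Longrightarrow> b \<le> w x" "tsqint I M A"
  shows "b * (tnrm I M A)\<^sup>2 \<le> tform I M w A A"
  unfolding tnrm_sq tform_def sum_distrib_left
proof (rule sum_mono)
  fix i assume i: "i \<in> I"
  then have s: "sqint M (A i)" using assms by (simp add: tsqint_def)
  have "(LINT x|M. b * (A i x)\<^sup>2) \<le> (LINT x|M. w x * (A i x * A i x))"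
    using assms(2) bdd_coeff_integrable[OF assms(1) s s] s
    by (intro integral_mono) (auto simp: sqint_def power2_eq_square intro!: mult_right_mono)
  then show "b * (LINT x|M. (A i x)\<^sup>2) \<le> (LINT x|M. w x * (A i x * A i x))" by simp
qed

lemma tform_cong_AE:
  assumes "AE x in M. w x = w' x" "\<And>i. i \<in> I \<Longrightarrow> AE x in M. A i x = A' i x"
    "\<And>i. i \<in> I \<Longrightarrow> AE x in M. C i x = C' i x"
    "w \<in> borel_measurable M" "w' \<in> borel_measurable M"
    "tsqint I M A" "tsqint I M A'" "tsqint I M C" "tsqint I M C'"
  shows "tform I M w A C = tform I M w' A' C'"
  unfolding tform_def
proof (rule sum.cong[OF refl])
  fix i assume i: "i \<in> I"
  show "(LINT x|M. w x * (A i x * C i x)) = (LINT x|M. w' x * (A' i x * C' i x))"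
  proof (rule integral_cong_AE)
    show "AE x in M. w x * (A i x * C i x) = w' x * (A' i x * C' i x)"
      using assms(1) assms(2,3)[OF i] by eventually_elim simp
    have [measurable]: "A i \<in> borel_measurable M" "A' i \<in> borel_measurable M"
        "C i \<in> borel_measurable M" "C' i \<in> borel_measurable M"
      using assms(6-9) i by (auto simp: tsqint_def sqint_def)
    note assms(4,5)[measurable]
    show "(\<lambda>x. w x * (A i x * C i x)) \<in> borel_measurable M"
      and "(\<lambda>x. w' x * (A' i x * C' i x)) \<in> borel_measurable M"
      by measurable
  qed
qed

lemma tform_to_zero:
  assumes "\<And>n. bdd_coeff M B (w n)" "\<And>n. tsqint I M (A n)" "\<And>n. tsqint I M (C n)"
    "\<And>n. tnrm I M (A n) \<le> a" "(\<lambda>n. tnrm I M (C n)) \<longlonglongrightarrow> 0"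
  shows "(\<lambda>n. tform I M (w n) (A n) (C n)) \<longlonglongrightarrow> 0"
proof (rule Lim_null_comparison)
  show "\<forall>\<^sub>F n in sequentially. norm (tform I M (w n) (A n) (C n)) \<le> B * (a * tnrm I M (C n))"
  proof (intro always_eventually allI)
    fix n
    have "\<bar>tform I M (w n) (A n) (C n)\<bar> \<le> B * (tnrm I M (A n) * tnrm I M (C n))"
      by (rule tform_bound[OF assms(1-3)])
    also have "\<dots> \<le> B * (a * tnrm I M (C n))"
      using assms(1)[of n] by (intro mult_left_mono mult_right_mono assms) (auto simp: bdd_coeff_def)
    finally show "norm (tform I M (w n) (A n) (C n)) \<le> B * (a * tnrm I M (C n))" by simp
  qed
  show "(\<lambda>n. B * (a * tnrm I M (C n))) \<longlonglongrightarrow> 0"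
    using tendsto_mult_right_zero[OF tendsto_mult_right_zero[OF assms(5)]] by simp
qed

section \<open>Smooth functions and test functions\<close>

lemma partial_eqI: "(f has_derivative f') (at x) \<Longrightarrow> partial k f x = f' (axis k 1)"
  unfolding partial_def by (simp add: frechet_derivative_at[symmetric])

text \<open>The Frechet derivative is defined by choice, so this also covers points at which neither function
  is differentiable: both have the same, empty, set of derivatives there.\<close>

lemma partial_cong_open:
  assumes "open U" "x \<in> U" "\<And>z. z \<in> U \<Longrightarrow> f z = g z"
  shows "partial k f x = partial k g x"
proof -
  have "(f has_derivative D) (at x) \<longleftrightarrow> (g has_derivative D) (at x)" for D
    using has_derivative_transform_within_open[of f D x UNIV U g]
      has_derivative_transform_within_open[of g D x UNIV U f] assms by auto
  then show ?thesis by (simp add: partial_def frechet_derivative_def)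
qed

lemma partials_cong_open:
  assumes "open U" "\<And>z. z \<in> U \<Longrightarrow> f z = g z"
  shows "x \<in> U \<Longrightarrow> partials i f x = partials i g x"
  by (induction i arbitrary: x) (auto intro: partial_cong_open[OF assms(1)] simp: assms(2))

lemma partials_append: "partials (i @ j) f = partials i (partials j f)"
  by (induction i) auto

lemma partial_const [simp]: "partial k (\<lambda>x. c) = (\<lambda>x. 0)"
  by (intro ext) (simp add: partial_eqI[OF has_derivative_const])

lemma partials_zero [simp]: "partials i (\<lambda>x. 0) = (\<lambda>x. 0)"
  by (induction i) auto

lemma partial_add:
  assumes "f differentiable at x" "g differentiable at x"
  shows "partial k (\<lambda>x. f x + g x) x = partial k f x + partial k g x"
proof -
  obtain f' g' where d: "(f has_derivative f') (at x)" "(g has_derivative g') (at x)"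
    using assms by (auto simp: differentiable_def)
  show ?thesis
    by (simp add: partial_eqI[OF d(1)] partial_eqI[OF d(2)] partial_eqI[OF has_derivative_add[OF d]])
qed

lemma partial_mult:
  assumes "f differentiable at x" "g differentiable at x"
  shows "partial k (\<lambda>x. f x * g x) x = partial k f x * g x + f x * partial k g x"
proof -
  obtain f' g' where d: "(f has_derivative f') (at x)" "(g has_derivative g') (at x)"
    using assms by (auto simp: differentiable_def)
  show ?thesis
    by (simp add: partial_eqI[OF d(1)] partial_eqI[OF d(2)] partial_eqI[OF has_derivative_mult[OF d]])
qed

lemma has_derivative_coord: "((\<lambda>x::plane. x $ l) has_derivative (\<lambda>v. v $ l)) (at x)"
  using bounded_linear.has_derivative[OF bounded_linear_vec_nth has_derivative_ident] .

lemma partial_coord: "partial k (\<lambda>x. x $ l) = (\<lambda>x. if k = l then 1 else 0)"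
  by (intro ext) (simp add: partial_eqI[OF has_derivative_coord] axis_def)

text \<open>\<open>flat 0 c\<close> is the function that is \<open>exp (- c / t)\<close> for \<open>t > 0\<close> and \<open>0\<close>
  for \<open>t \<le> 0\<close>; the exponent \<open>k\<close> makes the family closed under differentiation.\<close>

definition flat :: "nat \<Rightarrow> real \<Rightarrow> real \<Rightarrow> real" where
  "flat k c t = (if 0 < t then (1 / t) ^ k * exp (- (c / t)) else 0)"

text \<open>With \<open>s = 1 / h\<close> this is the decay of \<open>s\<^sup>k\<^sup>+\<^sup>1 exp (- c s)\<close>.\<close>

lemma flat_limit:
  assumes "0 < c"
  shows "((\<lambda>h. flat k c h / h) \<longlongrightarrow> 0) (at 0)"
proof -
  have 1: "((\<lambda>s. (c * s) ^ Suc k / exp (c * s)) \<longlongrightarrow> 0) at_top"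
    by (rule filterlim_compose[OF tendsto_power_div_exp_0])
      (use assms in \<open>auto intro!: filterlim_tendsto_pos_mult_at_top filterlim_ident\<close>)
  have 2: "((\<lambda>h. (c * inverse h) ^ Suc k / exp (c * inverse h)) \<longlongrightarrow> 0) (at_right 0)"
    by (rule filterlim_compose[OF 1 filterlim_inverse_at_top_right])
  have 3: "((\<lambda>h. flat k c h / h) \<longlongrightarrow> 0) (at_right 0)"
  proof (rule Lim_transform_eventually)
    show "((\<lambda>h. (c * inverse h) ^ Suc k / exp (c * inverse h) / c ^ Suc k) \<longlongrightarrow> 0) (at_right 0)"
      by (rule tendsto_divide_zero[OF 2])
    have "(c * inverse h) ^ Suc k / exp (c * inverse h) / c ^ Suc k = flat k c h / h" if "h > 0" for h
    proof -
      have "(c * inverse h) ^ Suc k / exp (c * inverse h) / c ^ Suc k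
        = inverse h ^ Suc k * inverse (exp (c * inverse h))"
        unfolding power_mult_distrib using assms by (simp del: power_Suc add: divide_inverse)
      also have "\<dots> = flat k c h / h"
        using that by (simp add: flat_def divide_inverse exp_minus)
      finally show ?thesis .
    qed
    then show "\<forall>\<^sub>F h in at_right 0. (c * inverse h) ^ Suc k / exp (c * inverse h) / c ^ Suc k = flat k c h / h"
      by (auto intro: eventually_at_right_less eventually_mono)
  qed
  have 4: "((\<lambda>h. flat k c h / h) \<longlongrightarrow> 0) (at_left 0)"
  proof (rule Lim_transform_eventually[OF tendsto_const])
    show "\<forall>\<^sub>F h in at_left 0. 0 = flat k c h / h"
      by (auto simp: flat_def eventually_at_filter)
  qed
  show ?thesis using 3 4 by (simp add: filterlim_split_at)
qed

lemma flat_has_derivative: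
  assumes "0 < c"
  shows "(flat k c has_field_derivative (c * flat (k + 2) c t - real k * flat (k + 1) c t)) (at t)"
proof (cases "t = 0")
  case True
  then show ?thesis
    using flat_limit[OF assms, of k] by (simp add: has_field_derivative_iff) (simp add: flat_def)
next
  case False
  show ?thesis
  proof (cases "t > 0")
    case True
    have "((\<lambda>t. (1 / t) ^ k * exp (- (c / t))) has_field_derivative
       (c * flat (k + 2) c t - real k * flat (k + 1) c t)) (at t)"
    proof -
      have p: "((\<lambda>t. (1 / t) ^ k) has_field_derivative - real k * (1 / t) ^ (k + 1)) (at t)"
      proof -
        have d: "((\<lambda>t. 1 / t) has_field_derivative - ((1 / t) ^ 2)) (at t)"
          using True by (auto intro!: derivative_eq_intros simp: power2_eq_square)
        have "real k * (- (s ^ 2) * s ^ (k - Suc 0)) = - real k * s ^ (k + 1)" for s :: real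
          by (cases k) (simp_all add: power2_eq_square algebra_simps)
        note eq = this[of "1 / t"]
        show ?thesis using DERIV_power[OF d, of k] by (simp only: eq)
      qed
      have e: "((\<lambda>t. exp (- (c / t))) has_field_derivative exp (- (c / t)) * (c * (1 / t) ^ 2)) (at t)"
        using True by (auto intro!: derivative_eq_intros simp: power2_eq_square)
      have eq: "- real k * (1 / t) ^ (k + 1) * exp (- (c / t)) + exp (- (c / t)) * (c * (1 / t) ^ 2) * (1 / t) ^ k
        = c * flat (k + 2) c t - real k * flat (k + 1) c t"
        using True by (simp add: flat_def power_add mult_ac power2_eq_square)
      show ?thesis using DERIV_mult[OF p e] by (simp only: eq)
    qed
    then show ?thesis
      by (rule has_field_derivative_transform_within_open[of _ _ _ "{0<..}"])
        (use True in \<open>auto simp: flat_def\<close>)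
  next
    case neg: False
    have "((\<lambda>t. 0) has_field_derivative 0) (at t)" by simp
    then have "(flat k c has_field_derivative 0) (at t)"
      by (rule has_field_derivative_transform_within_open[of _ _ _ "{..<0}"])
        (use neg False in \<open>auto simp: flat_def\<close>)
    then show ?thesis using neg False by (simp add: flat_def)
  qed
qed

lemma flat_coord_has_derivative:
  assumes "0 < c"
  shows "((\<lambda>x::plane. flat k c (s * x $ l + a)) has_derivative
     (\<lambda>v. (c * flat (k + 2) c (s * x $ l + a) - real k * flat (k + 1) c (s * x $ l + a)) * (s * v $ l))) (at x)"
proof -
  have "((\<lambda>x::plane. s * x $ l + a) has_derivative (\<lambda>v. s * v $ l)) (at x)"
    using has_derivative_add[OF has_derivative_mult_right[OF has_derivative_coord, of s l x] has_derivative_const[of a]]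
    by simp
  from has_derivative_compose[OF this flat_has_derivative[OF assms, of k, unfolded has_field_derivative_def]]
  show ?thesis by simp
qed

definition smooth :: "(plane \<Rightarrow> real) \<Rightarrow> bool" where
  "smooth f \<longleftrightarrow> (\<forall>i x. partials i f differentiable (at x))"

lemma smooth_partials: "smooth f \<Longrightarrow> smooth (partials i f)"
  by (simp add: smooth_def flip: partials_append)

lemma smooth_partial: "smooth f \<Longrightarrow> smooth (partial k f)"
  using smooth_partials[of f "[k]"] by simp

lemma smooth_differentiable: "smooth f \<Longrightarrow> f differentiable (at x)"
  unfolding smooth_def by (metis partials.simps(1))

lemma smooth_continuous: "smooth f \<Longrightarrow> continuous_on A f"
  by (meson continuous_at_imp_continuous_on differentiable_imp_continuous_within smooth_differentiable)

lemma smooth_bounded: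
  assumes "smooth f" "bounded \<Omega>"
  obtains B where "0 \<le> B" "\<And>x. x \<in> \<Omega> \<Longrightarrow> \<bar>f x\<bar> \<le> B"
proof -
  have "compact (closure \<Omega>)" using assms(2) by simp
  then have "bounded (f ` closure \<Omega>)"
    by (intro compact_imp_bounded compact_continuous_image smooth_continuous assms(1))
  then obtain B where B: "\<And>x. x \<in> closure \<Omega> \<Longrightarrow> \<bar>f x\<bar> \<le> B" by (auto simp: bounded_iff)
  have "\<bar>f x\<bar> \<le> \<bar>B\<bar>" if "x \<in> \<Omega>" for x
    using B[of x] that closure_subset[of \<Omega>] by fastforce
  then show ?thesis using that[of "\<bar>B\<bar>"] by auto
qed

lemma smooth_coinduct:
  assumes "X f" and "\<And>f x. X f \<Longrightarrow> f differentiable (at x)" and "\<And>f k. X f \<Longrightarrow> X (partial k f)"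
  shows "smooth f"
proof -
  have "X (partials i f)" for i
    by (induction i) (auto simp: assms)
  then show ?thesis using assms(2) by (simp add: smooth_def)
qed

text \<open>Closure of the smooth functions under sums and products is proved by coinduction. The product
  rule produces sums of products, so the class that contains them all, and the one-dimensional building
  blocks, is generated at once; it is closed under partial derivatives.\<close>

inductive smooth_alg :: "(plane \<Rightarrow> real) \<Rightarrow> bool" where
  base: "smooth f \<Longrightarrow> smooth_alg f"
| flat: "0 < c \<Longrightarrow> smooth_alg (\<lambda>x. flat k c (s * x $ l + a))"
| coord: "smooth_alg (\<lambda>x. x $ l)"
| const: "smooth_alg (\<lambda>x. c)"
| add: "smooth_alg f \<Longrightarrow> smooth_alg g \<Longrightarrow> smooth_alg (\<lambda>x. f x + g x)"
| mult: "smooth_alg f \<Longrightarrow> smooth_alg g \<Longrightarrow> smooth_alg (\<lambda>x. f x * g x)"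

lemma smooth_alg_step:
  assumes "smooth_alg f"
  shows "(\<forall>x. f differentiable (at x)) \<and> (\<forall>k. smooth_alg (partial k f))"
  using assms
proof induction
  case (base f)
  then show ?case by (auto intro: smooth_alg.base smooth_partial smooth_differentiable)
next
  case (flat c k s l a)
  have "partial j (\<lambda>x. flat k c (s * x $ l + a)) =
     (\<lambda>x. (c * flat (k + 2) c (s * x $ l + a) + (- real k) * flat (k + 1) c (s * x $ l + a))
        * (s * (axis j 1 :: plane) $ l))" for j
    by (intro ext) (simp add: partial_eqI[OF flat_coord_has_derivative[OF flat]])
  moreover have "smooth_alg (\<lambda>x. (c * flat (k + 2) c (s * x $ l + a) + (- real k) * flat (k + 1) c (s * x $ l + a))
        * (s * (axis j 1 :: plane) $ l))" for j
    by (intro smooth_alg.mult smooth_alg.add smooth_alg.const smooth_alg.flat flat)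
  moreover have "(\<lambda>x. flat k c (s * x $ l + a)) differentiable (at x)" for x :: plane
    using flat_coord_has_derivative[OF flat] unfolding differentiable_def by blast
  ultimately show ?case by simp
next
  case (coord l)
  then show ?case
    using has_derivative_coord[of l] smooth_alg.const by (auto simp: partial_coord differentiable_def)
next
  case (const c)
  then show ?case by (auto intro: smooth_alg.const)
next
  case (add f g)
  then have "partial k (\<lambda>x. f x + g x) = (\<lambda>x. partial k f x + partial k g x)" for k
    by (intro ext partial_add) auto
  with add show ?case by (auto intro: smooth_alg.add)
next
  case (mult f g)
  then have "partial k (\<lambda>x. f x * g x) = (\<lambda>x. partial k f x * g x + f x * partial k g x)" for k
    by (intro ext partial_mult) auto
  with mult show ?case by (auto intro!: smooth_alg.add smooth_alg.mult)
qed

lemma smooth_alg_smooth: "smooth_alg f \<Longrightarrow> smooth f"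
  by (rule smooth_coinduct[of smooth_alg]) (use smooth_alg_step in auto)

lemma smooth_const [simp]: "smooth (\<lambda>x. c)"
  and smooth_coord [simp]: "smooth (\<lambda>x. x $ l)"
  and smooth_flat: "0 < c \<Longrightarrow> smooth (\<lambda>x. flat k c (s * x $ l + a))"
  and smooth_add: "smooth f \<Longrightarrow> smooth g \<Longrightarrow> smooth (\<lambda>x. f x + g x)"
  and smooth_mult: "smooth f \<Longrightarrow> smooth g \<Longrightarrow> smooth (\<lambda>x. f x * g x)"
  by (auto intro!: smooth_alg_smooth intro: smooth_alg.intros)

lemma smooth_cmult: "smooth f \<Longrightarrow> smooth (\<lambda>x. c * f x)"
  by (rule smooth_mult[OF smooth_const])

lemma smooth_diff: "smooth f \<Longrightarrow> smooth g \<Longrightarrow> smooth (\<lambda>x. f x - g x)"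
  using smooth_add[OF _ smooth_cmult[of g "-1"], of f] by simp

lemma partials_add:
  assumes "smooth f" "smooth g"
  shows "partials i (\<lambda>x. f x + g x) = (\<lambda>x. partials i f x + partials i g x)"
proof (induction i)
  case (Cons k i)
  show ?case
    by (simp add: Cons, intro ext partial_add smooth_differentiable smooth_partials assms)
qed simp

lemma partials_cmult:
  assumes "smooth f"
  shows "partials i (\<lambda>x. c * f x) = (\<lambda>x. c * partials i f x)"
proof (induction i)
  case (Cons k i)
  show ?case
    by (simp add: Cons, intro ext, subst partial_mult)
      (auto intro: smooth_differentiable smooth_partials assms)
qed simp

lemma smooth_iff_C_k_on: "smooth f \<longleftrightarrow> (\<forall>k. C_k_on k f UNIV)"
proof
  show "\<forall>k. C_k_on k f UNIV" if "smooth f"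
    using that smooth_continuous[OF smooth_partials] by (auto simp: C_k_on_def smooth_def)
  show "smooth f" if "\<forall>k. C_k_on k f UNIV"
    unfolding smooth_def
  proof (intro allI)
    fix i x
    show "partials i f differentiable (at x)"
      using that[rule_format, of "Suc (length i)"] by (auto simp: C_k_on_def)
  qed
qed

lemma partials_vanish:
  assumes "closed S" "\<And>x. x \<notin> S \<Longrightarrow> f x = 0" "x \<notin> S"
  shows "partials i f x = 0"
  using partials_cong_open[of "- S" f "\<lambda>_. 0" x i] assms by auto

lemma test_functionI:
  assumes "smooth \<phi>" "compact S" "S \<subseteq> \<Omega>" "\<And>x. x \<notin> S \<Longrightarrow> \<phi> x = 0"
  shows "test_function \<Omega> \<phi>"
proof -
  have "closure {x. \<phi> x \<noteq> 0} \<subseteq> S"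
    using assms compact_imp_closed by (intro closure_minimal) auto
  moreover have "compact (closure {x. \<phi> x \<noteq> 0})"
    using calculation assms(2) by (meson closed_closure compact_imp_bounded bounded_subset compact_eq_bounded_closed)
  ultimately show ?thesis
    using assms by (auto simp: test_function_def simp flip: smooth_iff_C_k_on)
qed

lemma test_functionE:
  assumes "test_function \<Omega> \<phi>"
  obtains S where "smooth \<phi>" "compact S" "S \<subseteq> \<Omega>" "\<And>x. x \<notin> S \<Longrightarrow> \<phi> x = 0"
    "\<And>i x. x \<notin> S \<Longrightarrow> partials i \<phi> x = 0"
proof -
  let ?S = "closure {x. \<phi> x \<noteq> 0}"
  have *: "x \<notin> ?S \<Longrightarrow> \<phi> x = 0" for x
    using closure_subset[of "{x. \<phi> x \<noteq> 0}"] by blast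
  show ?thesis
  proof (rule that[of ?S])
    show "smooth \<phi>" "compact ?S" "?S \<subseteq> \<Omega>"
      using assms by (simp_all add: test_function_def smooth_iff_C_k_on)
    show "\<phi> x = 0" if "x \<notin> ?S" for x by (rule * [OF that])
    show "partials i \<phi> x = 0" if "x \<notin> ?S" for i x
      by (rule partials_vanish[OF closed_closure * that])
  qed
qed

lemma test_smooth: "test_function \<Omega> \<phi> \<Longrightarrow> smooth \<phi>"
  by (auto simp: test_function_def smooth_iff_C_k_on)

lemma test_vanish: "test_function \<Omega> \<phi> \<Longrightarrow> x \<notin> \<Omega> \<Longrightarrow> partials i \<phi> x = 0"
  by (elim test_functionE) auto

lemma test_partials:
  assumes "test_function \<Omega> \<phi>" shows "test_function \<Omega> (partials i \<phi>)"
proof -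
  obtain S where "smooth \<phi>" "compact S" "S \<subseteq> \<Omega>" "\<And>i x. x \<notin> S \<Longrightarrow> partials i \<phi> x = 0"
    using test_functionE[OF assms] by metis
  then show ?thesis by (intro test_functionI[of _ S]) (auto intro: smooth_partials)
qed

lemma test_add:
  assumes "test_function \<Omega> \<phi>" "test_function \<Omega> \<psi>"
  shows "test_function \<Omega> (\<lambda>x. \<phi> x + \<psi> x)"
proof -
  obtain S where "smooth \<phi>" "compact S" "S \<subseteq> \<Omega>" "\<And>x. x \<notin> S \<Longrightarrow> \<phi> x = 0"
    using test_functionE[OF assms(1)] by metis
  moreover obtain T where "smooth \<psi>" "compact T" "T \<subseteq> \<Omega>" "\<And>x. x \<notin> T \<Longrightarrow> \<psi> x = 0"
    using test_functionE[OF assms(2)] by metis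
  ultimately show ?thesis
    by (intro test_functionI[of _ "S \<union> T"]) (auto intro: smooth_add)
qed

lemma test_mult:
  assumes "smooth \<eta>" "test_function \<Omega> \<phi>"
  shows "test_function \<Omega> (\<lambda>x. \<eta> x * \<phi> x)"
proof -
  obtain S where "smooth \<phi>" "compact S" "S \<subseteq> \<Omega>" "\<And>x. x \<notin> S \<Longrightarrow> \<phi> x = 0"
    using test_functionE[OF assms(2)] by metis
  then show ?thesis
    using assms by (intro test_functionI[of _ S]) (auto intro: smooth_mult)
qed

lemma test_cmult: "test_function \<Omega> \<phi> \<Longrightarrow> test_function \<Omega> (\<lambda>x. c * \<phi> x)"
  by (rule test_mult[OF smooth_const])

lemma test_zero: "test_function \<Omega> (\<lambda>x. 0)"
  by (rule test_functionI[of _ "{}"]) auto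

lemma test_mono: "test_function U \<phi> \<Longrightarrow> U \<subseteq> \<Omega> \<Longrightarrow> test_function \<Omega> \<phi>"
  by (auto simp: test_function_def)

lemma test_bounded:
  assumes "test_function \<Omega> \<phi>"
  obtains B where "0 \<le> B" "\<And>x. \<bar>partials i \<phi> x\<bar> \<le> B"
proof -
  obtain S where S: "smooth \<phi>" "compact S" "\<And>x. x \<notin> S \<Longrightarrow> partials i \<phi> x = 0"
    using test_functionE[OF assms] by metis
  obtain B where B: "0 \<le> B" "\<And>x. x \<in> S \<Longrightarrow> \<bar>partials i \<phi> x\<bar> \<le> B"
    using smooth_bounded[OF smooth_partials[OF S(1)] compact_imp_bounded[OF S(2)]] by blast
  have "\<bar>partials i \<phi> x\<bar> \<le> B" for x
    using S(3)[of x] B by (cases "x \<in> S") auto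
  then show ?thesis using that[OF B(1)] by blast
qed

section \<open>Integration of derivatives and symmetry of mixed partials\<close>

lemma lebesgue_on_eq_lborel:
  fixes f :: "plane \<Rightarrow> real"
  assumes "\<Omega> \<in> sets lebesgue" "f \<in> borel_measurable borel" "\<And>x. x \<notin> \<Omega> \<Longrightarrow> f x = 0"
  shows "(LINT x|lebesgue_on \<Omega>. f x) = (LINT x|lborel. f x)"
    and "integrable (lebesgue_on \<Omega>) f \<longleftrightarrow> integrable lborel f"
proof -
  have *: "(\<lambda>x. indicator \<Omega> x * f x) = f"
    using assms(3) by (auto simp: indicator_def fun_eq_iff)
  show "(LINT x|lebesgue_on \<Omega>. f x) = (LINT x|lborel. f x)"
    using assms by (subst integral_restrict_space) (auto simp: * integral_completion)
  show "integrable (lebesgue_on \<Omega>) f \<longleftrightarrow> integrable lborel f"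
    using assms by (subst integrable_restrict_space) (auto simp: * integrable_completion)
qed

lemma integrable_compact_support:
  fixes f :: "plane \<Rightarrow> real"
  assumes "continuous_on UNIV f" "compact S" "\<And>x. x \<notin> S \<Longrightarrow> f x = 0"
  shows "integrable lborel f"
proof -
  have "(\<lambda>x. indicator S x *\<^sub>R f x) = f"
    using assms(3) by (auto simp: indicator_def fun_eq_iff)
  then show ?thesis
    using borel_integrable_compact[OF assms(2) continuous_on_subset[OF assms(1) subset_UNIV]] by simp
qed

lemma bounded_compact_support:
  fixes f :: "plane \<Rightarrow> real"
  assumes "continuous_on UNIV f" "compact S" "\<And>x. x \<notin> S \<Longrightarrow> f x = 0"
  obtains B where "0 \<le> B" "\<And>x. \<bar>f x\<bar> \<le> B"
proof -
  have "bounded (f ` S)"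
    using assms by (intro compact_imp_bounded compact_continuous_image) (auto intro: continuous_on_subset)
  then obtain B where B: "\<And>x. x \<in> S \<Longrightarrow> \<bar>f x\<bar> \<le> B"
    by (auto simp: bounded_iff)
  have "\<bar>f x\<bar> \<le> \<bar>B\<bar>" for x
    using assms(3)[of x] B[of x] by (cases "x \<in> S") linarith+
  then show ?thesis using that[of "\<bar>B\<bar>"] by auto
qed

lemma partial_along_line:
  assumes "f differentiable (at (x + t *\<^sub>R axis k 1))"
  shows "((\<lambda>t. f (x + t *\<^sub>R axis k 1)) has_field_derivative partial k f (x + t *\<^sub>R axis k 1)) (at t)"
proof -
  let ?e = "axis k 1 :: plane"
  obtain f' where f': "(f has_derivative f') (at (x + t *\<^sub>R ?e))"
    using assms by (auto simp: differentiable_def)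
  have "((\<lambda>t. x + t *\<^sub>R ?e) has_derivative (\<lambda>h. h *\<^sub>R ?e)) (at t)"
    by (auto intro!: derivative_eq_intros)
  from has_derivative_compose[OF this f']
  have "((\<lambda>t. f (x + t *\<^sub>R ?e)) has_derivative (\<lambda>h. f' (h *\<^sub>R ?e))) (at t)" .
  moreover have "(\<lambda>h. f' (h *\<^sub>R ?e)) = (\<lambda>h. h * f' ?e)"
    using linear_scale[OF has_derivative_linear[OF f']] by simp
  ultimately show ?thesis
    by (simp add: has_field_derivative_def partial_eqI[OF f'] mult_commute_abs)
qed

text \<open>The difference quotients of \<open>F\<close> in direction \<open>k\<close> have integral zero by translation invariance.
  The mean value theorem bounds them by the supremum of the derivative, uniformly on a common ball, so
  dominated convergence applies.\<close>

lemma integral_partial_zero: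
  assumes d: "\<And>x. F differentiable (at x)" and c: "continuous_on UNIV (partial k F)"
    and S: "compact S" "\<And>x. x \<notin> S \<Longrightarrow> F x = 0"
  shows "(LINT x|lborel. partial k F x) = 0"
proof -
  let ?e = "axis k 1 :: plane"
  have cF: "continuous_on UNIV F"
    using d by (meson continuous_at_imp_continuous_on differentiable_imp_continuous_within)
  have zero: "partial k F x = 0" if "x \<notin> S" for x
    using partials_vanish[of S F x "[k]"] S that compact_imp_closed by auto
  obtain B where B: "0 \<le> B" "\<And>x. \<bar>partial k F x\<bar> \<le> B"
    using bounded_compact_support[OF c S(1) zero] by blast
  obtain R where R: "\<And>x. x \<in> S \<Longrightarrow> norm x \<le> R"
    using compact_imp_bounded[OF S(1)] by (auto simp: bounded_iff)
  define h where "h n = inverse (real (Suc n))" for n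
  have h: "0 < h n" "h n \<le> 1" for n by (auto simp: h_def divide_simps)
  have hlim: "filterlim h (at 0) sequentially"
    unfolding filterlim_at using LIMSEQ_inverse_real_of_nat h(1) by (auto simp: h_def[abs_def] less_le)
  define D where "D n x = (F (x + h n *\<^sub>R ?e) - F x) / h n" for n x
  have mF[measurable]: "F \<in> borel_measurable borel" "partial k F \<in> borel_measurable borel"
    using cF c by (auto intro: borel_measurable_continuous_onI)
  have shift: "(LINT x|lborel. F (x + a)) = (LINT x|lborel. F x)" and
    shifti: "integrable lborel (\<lambda>x. F (x + a))" for a
  proof -
    have "(LINT x|lborel. F x) = (LINT x|distr lborel borel ((+) a). F x)"
      by (simp add: lborel_distr_plus)
    also have "\<dots> = (LINT x|lborel. F (a + x))" by (rule integral_distr) auto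
    finally show "(LINT x|lborel. F (x + a)) = (LINT x|lborel. F x)" by (simp add: add.commute)
    have "integrable (distr lborel borel ((+) a)) F"
      using integrable_compact_support[OF cF S] by (simp add: lborel_distr_plus)
    then show "integrable lborel (\<lambda>x. F (x + a))"
      by (subst (asm) integrable_distr_eq) (auto simp: add.commute)
  qed
  have "(LINT x|lborel. D n x) = 0" for n
    unfolding D_def using shift shifti[of "h n *\<^sub>R ?e"] shifti[of 0] by simp
  moreover have "(\<lambda>n. LINT x|lborel. D n x) \<longlonglongrightarrow> (LINT x|lborel. partial k F x)"
  proof (rule integral_dominated_convergence)
    show "partial k F \<in> borel_measurable lborel" "\<And>n. D n \<in> borel_measurable lborel"
      unfolding D_def by measurable
    show "integrable lborel (\<lambda>x. indicator (cball (0::plane) (R + 1)) x *\<^sub>R B)"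
      by (rule borel_integrable_compact) auto
    show "AE x in lborel. (\<lambda>n. D n x) \<longlonglongrightarrow> partial k F x"
    proof (intro AE_I2)
      fix x
      have "((\<lambda>t. F (x + t *\<^sub>R ?e)) has_field_derivative partial k F x) (at 0)"
        using partial_along_line[where x = x and t = 0 and k = k, OF d] by simp
      then have "((\<lambda>t. (F (x + t *\<^sub>R ?e) - F x) / t) \<longlongrightarrow> partial k F x) (at 0)"
        by (simp add: has_field_derivative_iff)
      from filterlim_compose[OF this hlim] show "(\<lambda>n. D n x) \<longlonglongrightarrow> partial k F x"
        by (simp add: D_def)
    qed
    show "AE x in lborel. norm (D n x) \<le> indicator (cball 0 (R + 1)) x *\<^sub>R B" for n
    proof (intro AE_I2)
      fix x
      show "norm (D n x) \<le> indicator (cball 0 (R + 1)) x *\<^sub>R B"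
      proof (cases "x \<in> cball 0 (R + 1)")
        case True
        have "\<exists>z>0. z < h n \<and> F (x + h n *\<^sub>R ?e) - F (x + 0 *\<^sub>R ?e) = (h n - 0) * partial k F (x + z *\<^sub>R ?e)"
          by (rule MVT2[OF h(1)]) (rule partial_along_line[OF d])
        then obtain z where "F (x + h n *\<^sub>R ?e) - F x = h n * partial k F (x + z *\<^sub>R ?e)"
          by auto
        then have "D n x = partial k F (x + z *\<^sub>R ?e)" using h(1)[of n] by (simp add: D_def)
        then show ?thesis using B(2) True by simp
      next
        case False
        then have n: "norm x > R + 1" by simp
        then have "x \<notin> S" using R[of x] by auto
        moreover have "x + h n *\<^sub>R ?e \<notin> S"
        proof
          assume "x + h n *\<^sub>R ?e \<in> S"
          then have "norm (x + h n *\<^sub>R ?e) \<le> R" by (rule R)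
          moreover have "norm (h n *\<^sub>R ?e) \<le> 1" using h[of n] by simp
          moreover have "norm x \<le> norm (x + h n *\<^sub>R ?e) + norm (h n *\<^sub>R ?e)"
            using norm_triangle_ineq4[of "x + h n *\<^sub>R ?e" "h n *\<^sub>R ?e"] by simp
          ultimately show False using n by linarith
        qed
        ultimately show ?thesis using S(2) by (simp add: D_def B)
      qed
    qed
  qed
  ultimately show ?thesis by (simp add: LIMSEQ_const_iff)
qed

text \<open>Two applications of the mean value theorem, first in direction \<open>k\<close> and then in direction \<open>l\<close>.\<close>

lemma second_difference:
  assumes U: "ball x r \<subseteq> U" and h: "0 < h" "2 * h < r"
    and d: "\<And>z. z \<in> U \<Longrightarrow> f differentiable (at z)" "\<And>z. z \<in> U \<Longrightarrow> partial k f differentiable (at z)"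
  shows "\<exists>z. dist x z < 2 * h \<and>
     f (x + h *\<^sub>R axis k 1 + h *\<^sub>R axis l 1) - f (x + h *\<^sub>R axis k 1) - f (x + h *\<^sub>R axis l 1) + f x
      = h\<^sup>2 * partial l (partial k f) z"
proof -
  let ?a = "axis k 1 :: plane" and ?b = "axis l 1 :: plane"
  have near: "dist x (x + s *\<^sub>R ?a + t *\<^sub>R ?b) \<le> \<bar>s\<bar> + \<bar>t\<bar>" for s t
    using norm_triangle_ineq[of "s *\<^sub>R ?a" "t *\<^sub>R ?b"] norm_minus_cancel[of "s *\<^sub>R ?a + t *\<^sub>R ?b"]
    by (simp add: dist_norm algebra_simps)
  have inU: "x + s *\<^sub>R ?a + t *\<^sub>R ?b \<in> U" if "0 \<le> s" "s \<le> h" "0 \<le> t" "t \<le> h" for s t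
    using U near[of s t] h that by (intro subsetD[OF U]) auto
  define g where "g s = f (x + h *\<^sub>R ?b + s *\<^sub>R ?a) - f (x + s *\<^sub>R ?a)" for s
  have "\<exists>\<xi>>0. \<xi> < h \<and> g h - g 0 = (h - 0) * (partial k f (x + h *\<^sub>R ?b + \<xi> *\<^sub>R ?a) - partial k f (x + \<xi> *\<^sub>R ?a))"
    unfolding g_def
    by (rule MVT2[OF h(1)], intro DERIV_diff partial_along_line d(1))
      (use inU[of _ h] inU[of _ 0] h in \<open>auto simp: algebra_simps\<close>)
  then obtain \<xi> where \<xi>: "0 < \<xi>" "\<xi> < h"
    "g h - g 0 = h * (partial k f (x + h *\<^sub>R ?b + \<xi> *\<^sub>R ?a) - partial k f (x + \<xi> *\<^sub>R ?a))"
    by auto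
  have "\<exists>\<zeta>>0. \<zeta> < h \<and> partial k f ((x + \<xi> *\<^sub>R ?a) + h *\<^sub>R ?b) - partial k f ((x + \<xi> *\<^sub>R ?a) + 0 *\<^sub>R ?b)
     = (h - 0) * partial l (partial k f) ((x + \<xi> *\<^sub>R ?a) + \<zeta> *\<^sub>R ?b)"
    by (rule MVT2[OF h(1)], intro partial_along_line d(2)) (use inU[of \<xi>] \<xi> h in auto)
  then obtain \<zeta> where \<zeta>: "0 < \<zeta>" "\<zeta> < h"
    "partial k f (x + \<xi> *\<^sub>R ?a + h *\<^sub>R ?b) - partial k f (x + \<xi> *\<^sub>R ?a) = h * partial l (partial k f) (x + \<xi> *\<^sub>R ?a + \<zeta> *\<^sub>R ?b)"
    by auto
  have "g h - g 0 = h\<^sup>2 * partial l (partial k f) (x + \<xi> *\<^sub>R ?a + \<zeta> *\<^sub>R ?b)"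
    using \<xi>(3) \<zeta>(3) by (simp add: algebra_simps power2_eq_square)
  moreover have "g h - g 0 = f (x + h *\<^sub>R ?a + h *\<^sub>R ?b) - f (x + h *\<^sub>R ?a) - f (x + h *\<^sub>R ?b) + f x"
    by (simp add: g_def algebra_simps)
  moreover have "dist x (x + \<xi> *\<^sub>R ?a + \<zeta> *\<^sub>R ?b) < 2 * h"
    using near[of \<xi> \<zeta>] \<xi> \<zeta> by linarith
  ultimately show ?thesis by metis
qed

text \<open>The second difference is the same for the two orders of the directions, so values of both mixed derivatives
  at nearby points agree; continuity does the rest.\<close>

lemma mixed_partials_commute:
  assumes U: "open U" "x \<in> U"
    and d: "\<And>z. z \<in> U \<Longrightarrow> f differentiable (at z)" "\<And>z j. z \<in> U \<Longrightarrow> partial j f differentiable (at z)"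
    and c: "\<And>i j. continuous_on U (partial i (partial j f))"
  shows "partial k (partial l f) x = partial l (partial k f) x"
proof (rule ccontr)
  assume ne: "partial k (partial l f) x \<noteq> partial l (partial k f) x"
  define e where "e = \<bar>partial k (partial l f) x - partial l (partial k f) x\<bar> / 2"
  have e: "e > 0" using ne by (simp add: e_def)
  have ct: "isCont (partial i (partial j f)) x" for i j
    using c U by (simp add: continuous_on_eq_continuous_at)
  obtain r1 where r1: "r1 > 0" "\<And>z. dist z x < r1 \<Longrightarrow> dist (partial k (partial l f) z) (partial k (partial l f) x) < e"
    using ct[of k l] e unfolding continuous_at_eps_delta by blast
  obtain r2 where r2: "r2 > 0" "\<And>z. dist z x < r2 \<Longrightarrow> dist (partial l (partial k f) z) (partial l (partial k f) x) < e"
    using ct[of l k] e unfolding continuous_at_eps_delta by blast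
  obtain r3 where r3: "r3 > 0" "ball x r3 \<subseteq> U" using U openE by blast
  define h where "h = min r1 (min r2 r3) / 3"
  have h: "0 < h" "2 * h < r1" "2 * h < r2" "2 * h < r3"
    using r1 r2 r3 by (auto simp: h_def)
  obtain z where z: "dist x z < 2 * h"
     "f (x + h *\<^sub>R axis k 1 + h *\<^sub>R axis l 1) - f (x + h *\<^sub>R axis k 1) - f (x + h *\<^sub>R axis l 1) + f x
      = h\<^sup>2 * partial l (partial k f) z"
    using second_difference[OF r3(2) h(1,4) d(1) d(2)] by metis
  obtain w where w: "dist x w < 2 * h"
     "f (x + h *\<^sub>R axis l 1 + h *\<^sub>R axis k 1) - f (x + h *\<^sub>R axis l 1) - f (x + h *\<^sub>R axis k 1) + f x
      = h\<^sup>2 * partial k (partial l f) w"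
    using second_difference[OF r3(2) h(1,4) d(1) d(2)] by metis
  have "h\<^sup>2 * partial l (partial k f) z = h\<^sup>2 * partial k (partial l f) w"
    unfolding z(2)[symmetric] w(2)[symmetric] by (simp add: algebra_simps)
  then have "partial l (partial k f) z = partial k (partial l f) w" using h by simp
  moreover have "dist (partial l (partial k f) z) (partial l (partial k f) x) < e"
    using r2(2)[of z] z(1) h by (simp add: dist_commute)
  moreover have "dist (partial k (partial l f) w) (partial k (partial l f) x) < e"
    using r1(2)[of w] w(1) h by (simp add: dist_commute)
  moreover have "2 * e = \<bar>partial k (partial l f) x - partial l (partial k f) x\<bar>"
    by (simp add: e_def)
  ultimately show False unfolding dist_real_def by linarith
qed

lemma C_k_on_partials:
  assumes "C_k_on n f U" "length i \<le> n"
  shows "C_k_on (n - length i) (partials i f) U"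
  using assms by (auto simp: C_k_on_def simp flip: partials_append)

lemma partials_swap:
  assumes "open U" "C_k_on n f U" "length (i @ k # l # j) \<le> n" "x \<in> U"
  shows "partials (i @ k # l # j) f x = partials (i @ l # k # j) f x"
proof -
  have g: "C_k_on (n - length j) (partials j f) U" "length i + 2 \<le> n - length j"
    using C_k_on_partials[OF assms(2), of j] assms(3) by auto
  have "partial k (partial l (partials j f)) z = partial l (partial k (partials j f)) z" if "z \<in> U" for z
  proof (rule mixed_partials_commute[OF assms(1) that])
    have dd: "z \<in> U \<Longrightarrow> partials w (partials j f) differentiable (at z)" if "length w \<le> 1" for z w
      using g that by (auto simp: C_k_on_def)
    show "z \<in> U \<Longrightarrow> partials j f differentiable (at z)" for z
      using dd[of "[]"] by simp
    show "z \<in> U \<Longrightarrow> partial j' (partials j f) differentiable (at z)" for z j'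
      using dd[of "[j']"] by simp
    show "continuous_on U (partial i' (partial j' (partials j f)))" for i' j'
      using g by (auto simp: C_k_on_def dest!: conjunct2 spec[of _ "[i', j']"])
  qed
  then have "partials i (partials (k # l # j) f) x = partials i (partials (l # k # j) f) x"
    by (intro partials_cong_open[OF assms(1) _ assms(4)]) auto
  then show ?thesis by (simp add: partials_append)
qed

lemma partials_front:
  assumes "open U" "C_k_on n f U" "length (i @ k # j) \<le> n" "x \<in> U"
  shows "partials (i @ k # j) f x = partials (k # i @ j) f x"
  using assms(3)
proof (induction i arbitrary: j rule: rev_induct)
  case (snoc l i)
  have "partials ((i @ [l]) @ k # j) f x = partials (i @ k # l # j) f x"
    using partials_swap[OF assms(1,2) _ assms(4), of i l k j] snoc.prems by simp
  also have "\<dots> = partials (k # i @ (l # j)) f x"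
    using snoc.prems by (intro snoc.IH) auto
  finally show ?case by simp
qed simp

lemma partials_mset:
  assumes U: "open U" "C_k_on n f U" and "mset i = mset j" "length i \<le> n" "x \<in> U"
  shows "partials i f x = partials j f x"
  using assms(3-)
proof (induction i arbitrary: j x)
  case (Cons k i)
  then have "k \<in> set j" by (metis list.set_intros(1) mset_eq_setD)
  then obtain a b where j: "j = a @ k # b" by (meson split_list)
  have l: "length j = Suc (length i)" using Cons.prems(1) mset_eq_length by fastforce
  have "partials i f z = partials (a @ b) f z" if "z \<in> U" for z
    using Cons.prems j that by (intro Cons.IH) auto
  then have "partial k (partials i f) x = partial k (partials (a @ b) f) x"
    by (rule partial_cong_open[OF U(1) Cons.prems(3)])
  then have "partials (k # i) f x = partials (k # a @ b) f x"
    by simp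
  also have "\<dots> = partials j f x"
    unfolding j using l Cons.prems j by (intro partials_front[OF U, symmetric]) auto
  finally show ?case .
qed simp

section \<open>Bump functions and the fundamental lemma\<close>

text \<open>The parameter \<open>1 / (n + 1)\<close> amounts to taking a root of a fixed bump, so that the bumps
  tend to the indicator of the open box while staying between \<open>0\<close> and \<open>1\<close>.\<close>

definition bump :: "nat \<Rightarrow> plane \<Rightarrow> plane \<Rightarrow> plane \<Rightarrow> real" where
  "bump n a b x = (let c = 1 / real (Suc n) in
     (flat 0 c (1 * x $ 1 + - a $ 1) * flat 0 c (- 1 * x $ 1 + b $ 1)) *
     (flat 0 c (1 * x $ 2 + - a $ 2) * flat 0 c (- 1 * x $ 2 + b $ 2)))"

lemma flat_0_bounds: "0 < c \<Longrightarrow> 0 \<le> flat 0 c t" "0 < c \<Longrightarrow> flat 0 c t \<le> 1"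
  by (auto simp: flat_def)

lemma flat_0_tendsto: "(\<lambda>n. flat 0 (1 / real (Suc n)) t) \<longlonglongrightarrow> (if 0 < t then 1 else 0)"
proof (cases "0 < t")
  case True
  have "(\<lambda>n. exp (- (1 / real (Suc n) / t))) \<longlonglongrightarrow> exp (- (0 / t))"
    by (intro tendsto_intros LIMSEQ_Suc[OF lim_1_over_n]) (use True in auto)
  then show ?thesis using True by (simp add: flat_def)
qed (simp add: flat_def)

lemma smooth_bump: "smooth (bump n a b)"
  unfolding bump_def[abs_def] Let_def by (intro smooth_mult smooth_flat) auto

lemma bump_zero: "x \<notin> box a b \<Longrightarrow> bump n a b x = 0"
  by (auto simp: bump_def mem_box_cart forall_2 flat_def)

lemma bump_bounds: "0 \<le> bump n a b x" "bump n a b x \<le> 1"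
  unfolding bump_def Let_def by (auto intro!: mult_nonneg_nonneg mult_le_one flat_0_bounds)

lemma bump_tendsto: "(\<lambda>n. bump n a b x) \<longlonglongrightarrow> indicator (box a b) x"
proof -
  have "(\<lambda>n. bump n a b x) \<longlonglongrightarrow>
    ((if 0 < 1 * x $ 1 + - a $ 1 then 1 else 0) * (if 0 < - 1 * x $ 1 + b $ 1 then 1 else 0)) *
    ((if 0 < 1 * x $ 2 + - a $ 2 then 1 else 0) * (if 0 < - 1 * x $ 2 + b $ 2 then 1 else 0))"
    unfolding bump_def Let_def by (intro tendsto_mult flat_0_tendsto)
  then show ?thesis
    by (auto simp: indicator_def mem_box_cart forall_2 split: if_splits)
qed

lemma test_bump: "cbox a b \<subseteq> \<Omega> \<Longrightarrow> test_function \<Omega> (bump n a b)"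
  by (rule test_functionI[of _ "cbox a b"]) (use smooth_bump box_subset_cbox[of a b] in \<open>auto intro!: bump_zero\<close>)

text \<open>Boxes form a generator that is stable under intersections, so the sets over which \<open>h\<close> integrates
  to zero include all Borel sets.\<close>

lemma AE_zero_of_box_integrals:
  fixes h :: "plane \<Rightarrow> real"
  assumes h: "integrable lborel h" and z: "\<And>a b. (LINT x|lborel. indicator (box a b) x * h x) = 0"
  shows "AE x in lborel. h x = 0"
proof (rule density_unique_real[OF h])
  have all: "(LINT x|lborel. h x) = 0"
  proof -
    have "(\<lambda>n. LINT x|lborel. indicator (box (- (real n *\<^sub>R One)) (real n *\<^sub>R One)) x * h x) \<longlonglongrightarrow> (LINT x|lborel. h x)"
    proof (rule integral_dominated_convergence[where w = "\<lambda>x. \<bar>h x\<bar>"])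
      show "AE x in lborel. (\<lambda>n. indicator (box (- (real n *\<^sub>R One)) (real n *\<^sub>R One)) x * h x) \<longlonglongrightarrow> h x"
      proof (intro AE_I2 tendsto_eventually)
        fix x :: plane
        obtain N :: nat where N: "norm x < real N" using reals_Archimedean2 by blast
        have "x \<in> box (- (real n *\<^sub>R One)) (real n *\<^sub>R One)" if "n \<ge> N" for n
          unfolding mem_box
        proof (intro ballI)
          fix i :: plane assume "i \<in> Basis"
          then have "\<bar>x \<bullet> i\<bar> \<le> norm x" "One \<bullet> i = (1::real)" by (auto simp: Basis_le_norm)
          with N that show "- (real n *\<^sub>R One) \<bullet> i < x \<bullet> i \<and> x \<bullet> i < (real n *\<^sub>R One) \<bullet> i" by auto
        qed
        then show "\<forall>\<^sub>F n in sequentially. indicator (box (- (real n *\<^sub>R One)) (real n *\<^sub>R One)) x * h x = h x"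
          by (auto simp: eventually_sequentially intro!: exI[of _ N])
      qed
    qed (use h in \<open>auto simp: abs_mult indicator_def\<close>)
    then show ?thesis by (simp add: z LIMSEQ_const_iff)
  qed
  fix A :: "plane set" assume "A \<in> sets lborel"
  then have A: "A \<in> sigma_sets UNIV (range (\<lambda>(a, b). box a b))"
    by (simp add: borel_eq_box)
  have "Int_stable (range (\<lambda>(a, b). box a b :: plane set))"
    by (auto simp: Int_stable_def box_Int_box)
  moreover have "range (\<lambda>(a, b). box a b :: plane set) \<subseteq> Pow UNIV" by auto
  ultimately have "(LINT x|lborel. indicator A x * h x) = 0"
    using A
  proof (induction rule: sigma_sets_induct_disjoint)
    fix A assume "A \<in> range (\<lambda>(a, b). box a b :: plane set)"
    then show "(LINT x|lborel. indicator A x * h x) = 0" using z by auto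
  next
    fix A :: "plane set" assume A: "A \<in> sigma_sets UNIV (range (\<lambda>(a, b). box a b))"
      and 0: "(LINT x|lborel. indicator A x * h x) = 0"
    then have [measurable]: "A \<in> sets borel" by (simp add: borel_eq_box)
    have "(\<lambda>x. indicator (UNIV - A) x * h x) = (\<lambda>x. h x - indicator A x * h x)"
      by (auto simp: indicator_def fun_eq_iff)
    moreover have "integrable lborel (\<lambda>x. indicator A x * h x)"
      using integrable_mult_indicator[OF _ h, of A] by simp
    ultimately show "(LINT x|lborel. indicator (UNIV - A) x * h x) = 0"
      using h 0 all by simp
  next
    fix A :: "nat \<Rightarrow> plane set"
    assume dj: "disjoint_family A" and A: "range A \<subseteq> sigma_sets UNIV (range (\<lambda>(a, b). box a b))"
      and 0: "\<And>i. (LINT x|lborel. indicator (A i) x * h x) = 0"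
    then have m[measurable]: "\<And>i. A i \<in> sets borel" by (auto simp: borel_eq_box)
    have "(\<lambda>n. LINT x|lborel. indicator (\<Union>i<n. A i) x * h x) \<longlonglongrightarrow> (LINT x|lborel. indicator (\<Union>i. A i) x * h x)"
    proof (rule integral_dominated_convergence[where w = "\<lambda>x. \<bar>h x\<bar>"])
      show "AE x in lborel. (\<lambda>n. indicator (\<Union>i<n. A i) x * h x) \<longlonglongrightarrow> indicator (\<Union>i. A i) x * h x"
        by (intro AE_I2 tendsto_mult_right) (rule LIMSEQ_indicator_UN)
    qed (use h in \<open>auto simp: abs_mult indicator_def\<close>)
    moreover have "(LINT x|lborel. indicator (\<Union>i<n. A i) x * h x) = 0" for n
    proof -
      have "(\<lambda>x. indicator (\<Union>i<n. A i) x * h x) = (\<lambda>x. \<Sum>i<n. indicator (A i) x * h x)"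
        unfolding sum_distrib_right[symmetric]
        by (subst indicator_UN_disjoint) (auto intro: disjoint_family_on_mono[OF _ dj])
      moreover have "integrable lborel (\<lambda>x. indicator (A i) x * h x)" for i
        using integrable_mult_indicator[OF _ h, of "A i"] by simp
      ultimately show ?thesis using 0 by (simp only: Bochner_Integration.integral_sum) simp
    qed
    ultimately show "(LINT x|lborel. indicator (\<Union>i. A i) x * h x) = 0"
      by (simp add: LIMSEQ_const_iff)
  qed auto
  then show "(LINT x:A|lborel. h x) = (LINT x:A|lborel. 0)"
    by (simp add: set_lebesgue_integral_def)
qed auto

text \<open>Bumps replace indicators of boxes in the limit, so \<open>g\<close> integrates to zero over every box whose closure
  lies in \<open>\<Omega>\<close>. Countably many such boxes cover \<open>\<Omega>\<close>.\<close>

lemma fundamental_lemma: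
  fixes g :: "plane \<Rightarrow> real"
  assumes \<Omega>: "open \<Omega>" and g: "integrable (lebesgue_on \<Omega>) g"
    and z: "\<And>\<phi>. test_function \<Omega> \<phi> \<Longrightarrow> (LINT x|lebesgue_on \<Omega>. g x * \<phi> x) = 0"
  shows "AE x in lebesgue_on \<Omega>. g x = 0"
proof -
  have \<Omega>m[measurable]: "\<Omega> \<in> sets lebesgue" "\<Omega> \<in> sets borel" using \<Omega> by auto
  define G where "G x = indicator \<Omega> x * g x" for x
  have G: "integrable lebesgue G"
    using g by (simp add: integrable_restrict_space G_def[abs_def])
  have int_on: "(LINT x|lebesgue_on \<Omega>. g x * w x) = (LINT x|lebesgue. w x * G x)" for w
    by (subst integral_restrict_space) (auto simp: G_def mult_ac)
  have box0: "(LINT x|lebesgue. indicator (box a b) x * G x) = 0" if "cbox a b \<subseteq> \<Omega>" for a b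
  proof -
    have "(\<lambda>n. LINT x|lebesgue. bump n a b x * G x) \<longlonglongrightarrow> (LINT x|lebesgue. indicator (box a b) x * G x)"
    proof (rule integral_dominated_convergence[where w = "\<lambda>x. \<bar>G x\<bar>"])
      show "AE x in lebesgue. (\<lambda>n. bump n a b x * G x) \<longlonglongrightarrow> indicator (box a b) x * G x"
        by (intro AE_I2 tendsto_mult_right bump_tendsto)
      show "AE x in lebesgue. norm (bump n a b x * G x) \<le> \<bar>G x\<bar>" for n
        by (intro AE_I2) (auto simp: abs_mult bump_bounds intro!: mult_left_le_one_le)
      have "bump n a b \<in> borel_measurable borel" for n
        by (intro borel_measurable_continuous_onI smooth_continuous smooth_bump)
      then have bm: "bump n a b \<in> borel_measurable lebesgue" for n
        by (intro measurable_completion) simp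
      have Gm[measurable]: "G \<in> borel_measurable lebesgue" by (rule borel_measurable_integrable[OF G])
      show "(\<lambda>x. bump n a b x * G x) \<in> borel_measurable lebesgue" for n
        by (rule borel_measurable_times[OF bm Gm])
      have "box a b \<in> sets lebesgue" by simp
      then show "(\<lambda>x. indicator (box a b) x * G x) \<in> borel_measurable lebesgue"
        by (intro borel_measurable_times borel_measurable_indicator Gm)
      show "integrable lebesgue (\<lambda>x. \<bar>G x\<bar>)" using G by simp
    qed
    moreover have "(LINT x|lebesgue. bump n a b x * G x) = 0" for n
      using z[OF test_bump[OF that], of n] by (simp add: int_on)
    ultimately show ?thesis by (simp add: LIMSEQ_const_iff)
  qed
  have loc: "AE x in lebesgue. x \<in> box c d \<longrightarrow> G x = 0" if cd: "cbox c d \<subseteq> \<Omega>" for c d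
  proof -
    obtain G' where G': "G' \<in> borel_measurable lborel" "AE x in lborel. G x = G' x"
      using completion_ex_borel_measurable_real[OF borel_measurable_integrable[OF G]] by auto
    have G'i: "integrable lborel G'"
      using integrable_cong_AE_imp[OF G measurable_completion[OF G'(1)] AE_completion[OF G'(2)]]
        integrable_completion[OF G'(1)] by simp
    have "AE x in lborel. indicator (box c d) x * G' x = 0"
    proof (rule AE_zero_of_box_integrals)
      show "integrable lborel (\<lambda>x. indicator (box c d) x * G' x)"
        using integrable_mult_indicator[OF _ G'i, of "box c d"] by simp
      fix a b :: plane
      obtain p q where pq: "box a b \<inter> box c d = box p q" using that[OF box_Int_box] .
      have "(LINT x|lborel. indicator (box p q) x * G' x) = (LINT x|lebesgue. indicator (box p q) x * G x)"
      proof -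
        have m: "G \<in> borel_measurable lebesgue" "G' \<in> borel_measurable lebesgue" "box p q \<in> sets lebesgue"
          using G measurable_completion[OF G'(1)] by auto
        have "(\<lambda>x. indicator (box p q) x * G' x) \<in> borel_measurable lborel"
          using G'(1) by measurable
        then have "(LINT x|lborel. indicator (box p q) x * G' x) = (LINT x|lebesgue. indicator (box p q) x * G' x)"
          by (simp add: integral_completion)
        also have "\<dots> = (LINT x|lebesgue. indicator (box p q) x * G x)"
        proof (rule integral_cong_AE)
          show "AE x in lebesgue. indicator (box p q) x * G' x = indicator (box p q) x * G x"
            using AE_completion[OF G'(2)] by eventually_elim simp
        qed (intro borel_measurable_times borel_measurable_indicator m)+
        finally show ?thesis .
      qed
      also have "\<dots> = 0"
      proof (cases "box p q = {}")
        case False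
        then have "cbox p q \<subseteq> cbox c d"
          using pq closure_mono[of "box p q" "box c d"] by (cases "box c d = {}") auto
        then show ?thesis using box0 cd by blast
      qed simp
      finally show "(LINT x|lborel. indicator (box a b) x * (indicator (box c d) x * G' x)) = 0"
        unfolding pq[symmetric] by (simp add: indicator_inter_arith mult.assoc)
    qed
    then have "AE x in lborel. x \<in> box c d \<longrightarrow> G x = 0"
      using G'(2) by eventually_elim (auto simp: indicator_def split: if_splits)
    then show ?thesis by (rule AE_completion)
  qed
  define a' :: "(plane \<Rightarrow> real \<times> real) \<Rightarrow> plane" where "a' f = (\<Sum>i\<in>Basis. fst (f i) *\<^sub>R i)" for f
  define b' :: "(plane \<Rightarrow> real \<times> real) \<Rightarrow> plane" where "b' f = (\<Sum>i\<in>Basis. snd (f i) *\<^sub>R i)" for f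
  define J :: "(plane \<Rightarrow> real \<times> real) set"
    where "J = {f \<in> Basis \<rightarrow>\<^sub>E \<rat> \<times> \<rat>. cbox (a' f) (b' f) \<subseteq> \<Omega>}"
  have J: "countable J"
    unfolding J_def by (intro countable_Collect countable_PiE countable_SIGMA countable_rat) auto
  have cover: "\<exists>f\<in>J. x \<in> box (a' f) (b' f)" if x: "x \<in> \<Omega>" for x
  proof -
    obtain e where e: "e > 0" "cball x e \<subseteq> \<Omega>"
      using bspec[OF iffD1[OF open_contains_cball \<Omega>] x] by auto
    have "ball x e = (\<Union>f\<in>{f\<in>Basis \<rightarrow>\<^sub>E \<rat> \<times> \<rat>. box (a' f) (b' f) \<subseteq> ball x e}. box (a' f) (b' f))"
      using open_UNION_box[OF open_ball[of x e]] unfolding a'_def[abs_def] b'_def[abs_def] .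
    moreover have "x \<in> ball x e" using e(1) by simp
    ultimately have "x \<in> (\<Union>f\<in>{f\<in>Basis \<rightarrow>\<^sub>E \<rat> \<times> \<rat>. box (a' f) (b' f) \<subseteq> ball x e}. box (a' f) (b' f))"
      by (rule equalityD1[THEN subsetD])
    then obtain f where f: "f \<in> Basis \<rightarrow>\<^sub>E \<rat> \<times> \<rat>" "box (a' f) (b' f) \<subseteq> ball x e" "x \<in> box (a' f) (b' f)"
      by blast
    have "cbox (a' f) (b' f) \<subseteq> cball x e"
    proof -
      have "closure (box (a' f) (b' f)) = cbox (a' f) (b' f)"
        using f(3) by (intro closure_box) auto
      then show ?thesis
        using closure_mono[OF f(2)] closure_ball[OF e(1), of x] by simp
    qed
    then show ?thesis using f e(2) unfolding J_def by blast
  qed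
  have "AE x in lebesgue. \<forall>f\<in>J. x \<in> box (a' f) (b' f) \<longrightarrow> G x = 0"
    by (intro AE_ball_countable' J) (auto simp: J_def intro!: loc)
  then have "AE x in lebesgue. x \<in> \<Omega> \<longrightarrow> g x = 0"
    by eventually_elim (use cover in \<open>auto simp: G_def\<close>)
  then show ?thesis by (simp add: AE_restrict_space_iff)
qed

section \<open>Integration by parts and weak derivatives\<close>

lemma cont_borel_lebesgue_on:
  fixes f :: "plane \<Rightarrow> real"
  assumes "continuous_on UNIV f"
  shows "f \<in> borel_measurable (lebesgue_on \<Omega>)"
proof -
  have "f \<in> borel_measurable borel" using assms by (rule borel_measurable_continuous_onI)
  then have "f \<in> borel_measurable lebesgue" by (intro measurable_completion) simp
  then show ?thesis by (rule measurable_restrict_space1)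
qed

lemma finite_measure_open_bounded: "bounded \<Omega> \<Longrightarrow> open \<Omega> \<Longrightarrow> finite_measure (lebesgue_on \<Omega>)" for \<Omega> :: "plane set"
  by (rule finite_measure_lebesgue_on) (rule lmeasurable_open)

lemma sqint_const:
  fixes \<Omega> :: "plane set"
  assumes "bounded \<Omega>" "open \<Omega>" shows "sqint (lebesgue_on \<Omega>) (\<lambda>_. c)"
  by (rule nrm_le_of_bounded(1)[OF finite_measure_open_bounded[OF assms]]) auto

lemma sqint_smooth:
  assumes "smooth f" "bounded \<Omega>" "open \<Omega>"
  shows "sqint (lebesgue_on \<Omega>) f"
proof -
  obtain B where "\<And>x. x \<in> \<Omega> \<Longrightarrow> \<bar>f x\<bar> \<le> B" using smooth_bounded[OF assms(1,2)] by blast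
  then show ?thesis
    by (intro nrm_le_of_bounded(1)[OF finite_measure_open_bounded[OF assms(2,3)]]
        cont_borel_lebesgue_on smooth_continuous assms(1)) auto
qed

lemma sqint_test: "test_function \<Omega> \<phi> \<Longrightarrow> bounded \<Omega> \<Longrightarrow> open \<Omega> \<Longrightarrow> sqint (lebesgue_on \<Omega>) (partials i \<phi>)"
  by (intro sqint_smooth smooth_partials test_smooth)

lemma sqint_integrable_on:
  fixes \<Omega> :: "plane set"
  assumes "bounded \<Omega>" "open \<Omega>" "sqint (lebesgue_on \<Omega>) f"
  shows "integrable (lebesgue_on \<Omega>) f"
  using sqint_mult[OF assms(3) sqint_const[OF assms(1,2), of 1]] by simp

lemma nrm_indicator:
  fixes \<Omega> :: "plane set"
  assumes "open \<Omega>" "bounded \<Omega>" "A \<in> sets lebesgue" "A \<subseteq> \<Omega>"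
  shows "sqint (lebesgue_on \<Omega>) (indicator A)" "nrm (lebesgue_on \<Omega>) (indicator A) = sqrt (measure lebesgue A)"
proof -
  have \<Omega>m: "\<Omega> \<in> sets lebesgue" using assms by auto
  have m: "(indicator A :: plane \<Rightarrow> real) \<in> borel_measurable (lebesgue_on \<Omega>)"
    by (rule measurable_restrict_space1[OF borel_measurable_indicator[OF assms(3)]])
  show s: "sqint (lebesgue_on \<Omega>) (indicator A)"
    by (rule nrm_le_of_bounded(1)[OF finite_measure_open_bounded[OF assms(2,1)] m, of 1]) (simp add: indicator_def)
  have "(LINT x|lebesgue_on \<Omega>. (indicator A x)\<^sup>2) = (LINT x|lebesgue_on \<Omega>. indicator A x :: real)"
    by (intro Bochner_Integration.integral_cong) (auto simp: indicator_def)
  also have "\<dots> = measure (lebesgue_on \<Omega>) (A \<inter> space (lebesgue_on \<Omega>))"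
    by (rule Bochner_Integration.integral_indicator)
  also have "A \<inter> space (lebesgue_on \<Omega>) = A" using assms(4) by auto
  also have "measure (lebesgue_on \<Omega>) A = measure lebesgue A"
    using assms \<Omega>m by (intro measure_restrict_space) auto
  finally show "nrm (lebesgue_on \<Omega>) (indicator A) = sqrt (measure lebesgue A)" by (simp add: nrm_def)
qed

lemma nrm_on_small_set:
  fixes \<Omega> :: "plane set"
  assumes "open \<Omega>" "bounded \<Omega>" "A \<in> sets lebesgue" "A \<subseteq> \<Omega>" "f \<in> borel_measurable (lebesgue_on \<Omega>)"
    "\<And>x. x \<in> A \<Longrightarrow> \<bar>f x\<bar> \<le> B" "0 \<le> B"
  shows "sqint (lebesgue_on \<Omega>) (\<lambda>x. indicator A x * f x)"
    "nrm (lebesgue_on \<Omega>) (\<lambda>x. indicator A x * f x) \<le> B * sqrt (measure lebesgue A)"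
proof -
  note i = nrm_indicator[OF assms(1-4)]
  have m: "(\<lambda>x. indicator A x * f x) \<in> borel_measurable (lebesgue_on \<Omega>)"
    using i(1) assms(5) by (intro borel_measurable_times) (auto simp: sqint_def)
  have le: "\<bar>indicator A x * f x\<bar> \<le> \<bar>B * indicator A x\<bar>" for x
    using assms(6)[of x] assms(7) by (auto simp: indicator_def)
  note mono = nrm_mono[OF sqint_cmult[OF i(1)] m le]
  show "sqint (lebesgue_on \<Omega>) (\<lambda>x. indicator A x * f x)" by (rule mono(1))
  show "nrm (lebesgue_on \<Omega>) (\<lambda>x. indicator A x * f x) \<le> B * sqrt (measure lebesgue A)"
    using mono(2) i(2) assms(7) by (simp add: nrm_cmult)
qed

text \<open>Extension by zero: \<open>g\<close> may be arbitrary outside \<open>U\<close>, where it is multiplied by zero.\<close>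

lemma local_product:
  assumes U: "open U" "U \<subseteq> \<Omega>" "\<Omega> \<in> sets lebesgue" and g: "continuous_on U g" and \<phi>: "test_function U \<phi>"
  shows "continuous_on UNIV (\<lambda>x. if x \<in> U then g x * \<phi> x else 0)"
    and "(LINT x|lebesgue_on \<Omega>. g x * \<phi> x) = (LINT x|lborel. (if x \<in> U then g x * \<phi> x else 0))"
    and "integrable lborel (\<lambda>x. if x \<in> U then g x * \<phi> x else 0)"
proof -
  obtain S where S: "smooth \<phi>" "compact S" "S \<subseteq> U" "\<And>x. x \<notin> S \<Longrightarrow> \<phi> x = 0"
    using test_functionE[OF \<phi>] by metis
  let ?h = "\<lambda>x. if x \<in> U then g x * \<phi> x else 0"
  have "continuous_on U (\<lambda>x. g x * \<phi> x)"
    by (intro continuous_intros g smooth_continuous S)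
  then have "continuous_on U ?h" by (rule continuous_on_eq) auto
  moreover have "continuous_on (- S) ?h"
    by (rule continuous_on_eq[of _ "\<lambda>_. 0"]) (use S in auto)
  ultimately have "continuous_on (U \<union> - S) ?h"
    using U(1) compact_imp_closed[OF S(2)] by (intro continuous_on_open_Un) (auto simp: open_Compl)
  moreover have "U \<union> - S = UNIV" using S by auto
  ultimately show c: "continuous_on UNIV ?h" by simp
  show "integrable lborel ?h"
    by (rule integrable_compact_support[OF c S(2)]) (use S in auto)
  have "(LINT x|lebesgue_on \<Omega>. g x * \<phi> x) = (LINT x|lebesgue_on \<Omega>. ?h x)"
    using S by (intro Bochner_Integration.integral_cong) auto
  also have "\<dots> = (LINT x|lborel. ?h x)"
    using U c by (intro lebesgue_on_eq_lborel(1)) (auto intro: borel_measurable_continuous_onI)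
  finally show "(LINT x|lebesgue_on \<Omega>. g x * \<phi> x) = (LINT x|lborel. ?h x)" .
qed

lemma integral_by_parts:
  assumes U: "open U" "U \<subseteq> \<Omega>" "\<Omega> \<in> sets lebesgue" and \<phi>: "test_function U \<phi>"
    and f: "\<And>x. x \<in> U \<Longrightarrow> f differentiable (at x)" "continuous_on U (partial k f)"
  shows "(LINT x|lebesgue_on \<Omega>. f x * partial k \<phi> x) = - (LINT x|lebesgue_on \<Omega>. partial k f x * \<phi> x)"
proof -
  obtain S where S: "smooth \<phi>" "compact S" "S \<subseteq> U" "\<And>x. x \<notin> S \<Longrightarrow> \<phi> x = 0"
     "\<And>i x. x \<notin> S \<Longrightarrow> partials i \<phi> x = 0"
    using test_functionE[OF \<phi>] by metis
  have S0: "x \<notin> S \<Longrightarrow> partial k \<phi> x = 0" for x using S(5)[of x "[k]"] by simp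
  have cf: "continuous_on U f"
    using f(1) by (meson continuous_at_imp_continuous_on differentiable_imp_continuous_within)
  have \<phi>': "test_function U (partial k \<phi>)" using test_partials[OF \<phi>, of "[k]"] by simp
  let ?F = "\<lambda>x. if x \<in> U then f x * \<phi> x else 0"
  let ?A = "\<lambda>x. if x \<in> U then f x * partial k \<phi> x else 0"
  let ?B = "\<lambda>x. if x \<in> U then partial k f x * \<phi> x else 0"
  note A = local_product[OF U cf \<phi>']
  note B = local_product[OF U f(2) \<phi>]
  have d\<phi>: "\<phi> differentiable (at x)" for x using S(1) by (rule smooth_differentiable)
  have out: "(?F has_derivative (\<lambda>_. 0)) (at x)" if "x \<notin> S" for x
  proof (rule has_derivative_transform_within_open[of "\<lambda>_. 0" _ _ _ "- S"])
    show "open (- S)" using S(2) compact_imp_closed by blast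
  qed (use that S in auto)
  have "?F differentiable (at x) \<and> partial k ?F x = ?A x + ?B x" for x
  proof (cases "x \<in> U")
    case True
    have m: "(\<lambda>x. f x * \<phi> x) differentiable (at x)"
      using f(1)[OF True] d\<phi> by (rule differentiable_mult)
    then obtain D where D: "((\<lambda>x. f x * \<phi> x) has_derivative D) (at x)" by (auto simp: differentiable_def)
    have "(?F has_derivative D) (at x)"
      by (rule has_derivative_transform_within_open[OF D U(1) True]) auto
    moreover have "partial k ?F x = partial k (\<lambda>x. f x * \<phi> x) x"
      by (rule partial_cong_open[OF U(1) True]) auto
    ultimately show ?thesis
      using partial_mult[OF f(1)[OF True] d\<phi>, of k] True by (auto simp: differentiable_def)
  next
    case False
    then have "x \<notin> S" using S by auto
    from out[OF this] show ?thesis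
      using False partial_eqI[OF out[OF \<open>x \<notin> S\<close>]] by (auto simp: differentiable_def)
  qed
  then have F: "\<And>x. ?F differentiable (at x)" "partial k ?F = (\<lambda>x. ?A x + ?B x)" by auto
  have "(LINT x|lborel. partial k ?F x) = 0"
  proof (rule integral_partial_zero[OF F(1) _ S(2)])
    show "continuous_on UNIV (partial k ?F)"
      unfolding F(2) by (intro continuous_on_add A B)
  qed (use S in auto)
  also have "(LINT x|lborel. partial k ?F x) = (LINT x|lborel. ?A x) + (LINT x|lborel. ?B x)"
    unfolding F(2) by (rule Bochner_Integration.integral_add[OF A(3) B(3)])
  finally show ?thesis unfolding A(2) B(2) by simp
qed

text \<open>Moving the derivatives over one by one reverses the word; the symmetry of mixed derivatives repairs the order.\<close>

lemma integral_by_parts_word: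
  assumes U: "open U" "U \<subseteq> \<Omega>" "\<Omega> \<in> sets lebesgue" and \<phi>: "test_function U \<phi>"
    and f: "C_k_on n f U" "length i \<le> n"
  shows "(LINT x|lebesgue_on \<Omega>. f x * partials i \<phi> x)
    = (-1) ^ length i * (LINT x|lebesgue_on \<Omega>. partials i f x * \<phi> x)"
  using f
proof (induction i arbitrary: f n)
  case (Cons k i)
  have C: "C_k_on (n - 1) (partial k f) U" "length i \<le> n - 1"
    using C_k_on_partials[OF Cons.prems(1), of "[k]"] Cons.prems(2) by auto
  have d: "f differentiable (at x)" if "x \<in> U" for x
    using Cons.prems that by (auto simp: C_k_on_def dest!: conjunct1 spec[of _ "[]"])
  have c: "continuous_on U (partial k f)"
    using Cons.prems by (auto simp: C_k_on_def dest!: conjunct2 spec[of _ "[k]"])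
  have "(LINT x|lebesgue_on \<Omega>. f x * partial k (partials i \<phi>) x)
     = - (LINT x|lebesgue_on \<Omega>. partial k f x * partials i \<phi> x)"
    by (rule integral_by_parts[OF U test_partials[OF \<phi>] d c])
  also have "(LINT x|lebesgue_on \<Omega>. partial k f x * partials i \<phi> x)
     = (-1) ^ length i * (LINT x|lebesgue_on \<Omega>. partials i (partial k f) x * \<phi> x)"
    by (rule Cons.IH[OF C])
  also have "(LINT x|lebesgue_on \<Omega>. partials i (partial k f) x * \<phi> x)
     = (LINT x|lebesgue_on \<Omega>. partials (k # i) f x * \<phi> x)"
  proof (rule Bochner_Integration.integral_cong[OF refl])
    fix x
    show "partials i (partial k f) x * \<phi> x = partials (k # i) f x * \<phi> x"
    proof (cases "x \<in> U")
      case True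
      have "partials (i @ [k]) f x = partials (k # i) f x"
        using Cons.prems by (intro partials_mset[OF U(1) Cons.prems(1) _ _ True]) auto
      then show ?thesis by (simp add: partials_append)
    next
      case False
      then show ?thesis using test_vanish[OF \<phi>, of x "[]"] by simp
    qed
  qed
  finally show ?case by simp
qed simp

lemma weak_partial_unique:
  assumes \<Omega>: "open \<Omega>" "bounded \<Omega>" and g: "is_weak_partial \<Omega> i u g" "is_weak_partial \<Omega> i u h"
  shows "AE x in lebesgue_on \<Omega>. g x = h x"
proof -
  have s: "sqint (lebesgue_on \<Omega>) g" "sqint (lebesgue_on \<Omega>) h"
    using g by (auto simp: is_weak_partial_def L2_def sqint_def)
  have "AE x in lebesgue_on \<Omega>. g x - h x = 0"
  proof (rule fundamental_lemma[OF \<Omega>(1)])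
    show "integrable (lebesgue_on \<Omega>) (\<lambda>x. g x - h x)"
      by (rule sqint_integrable_on[OF \<Omega>(2,1) sqint_diff[OF s]])
    fix \<phi> assume \<phi>: "test_function \<Omega> \<phi>"
    have "integrable (lebesgue_on \<Omega>) (\<lambda>x. g x * \<phi> x)" "integrable (lebesgue_on \<Omega>) (\<lambda>x. h x * \<phi> x)"
      using sqint_mult[OF s(1) sqint_test[OF \<phi> \<Omega>(2,1), of "[]"]]
        sqint_mult[OF s(2) sqint_test[OF \<phi> \<Omega>(2,1), of "[]"]] by auto
    moreover have "(LINT x|lebesgue_on \<Omega>. g x * \<phi> x) = (LINT x|lebesgue_on \<Omega>. h x * \<phi> x)"
      using g \<phi> by (auto simp: is_weak_partial_def)
    ultimately show "(LINT x|lebesgue_on \<Omega>. (g x - h x) * \<phi> x) = 0"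
      by (simp add: left_diff_distrib)
  qed
  then show ?thesis by eventually_elim simp
qed

text \<open>The classical derivative is only continuous on the open set \<open>U\<close>; the bound makes it integrable there.\<close>

lemma weak_partial_classical:
  assumes \<Omega>: "open \<Omega>" "bounded \<Omega>" and U: "open U" "U \<subseteq> \<Omega>"
    and g: "is_weak_partial \<Omega> i u g" and C: "C_k_on n u U" "length i \<le> n"
    and B: "\<And>x. x \<in> U \<Longrightarrow> \<bar>partials i u x\<bar> \<le> B"
  shows "AE x in lebesgue_on U. g x = partials i u x"
proof -
  have bU: "bounded U" using \<Omega> U bounded_subset by blast
  have m[measurable]: "\<Omega> \<in> sets lebesgue" "U \<in> sets lebesgue" using \<Omega> U by auto
  have "sqint (lebesgue_on \<Omega>) g"
    using g by (auto simp: is_weak_partial_def L2_def sqint_def)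
  then have "integrable (lebesgue_on \<Omega>) g" by (rule sqint_integrable_on[OF \<Omega>(2,1)])
  then have "integrable lebesgue (\<lambda>x. indicator \<Omega> x * g x)"
    by (simp add: integrable_restrict_space)
  then have "integrable lebesgue (\<lambda>x. indicator U x *\<^sub>R (indicator \<Omega> x * g x))"
    by (rule integrable_mult_indicator[rotated]) auto
  moreover have "(\<lambda>x. indicator U x *\<^sub>R (indicator \<Omega> x * g x)) = (\<lambda>x. indicator U x * g x)"
    using U by (auto simp: indicator_def fun_eq_iff)
  ultimately have gU: "integrable (lebesgue_on U) g"
    by (simp add: integrable_restrict_space)
  have cU: "continuous_on U (partials i u)" using C by (auto simp: C_k_on_def)
  have "sqint (lebesgue_on U) (partials i u)"
    by (rule nrm_le_of_bounded(1)[OF finite_measure_open_bounded[OF bU U(1)]])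
      (use B cU in \<open>auto intro: continuous_imp_measurable_on_sets_lebesgue\<close>)
  then have uU: "integrable (lebesgue_on U) (partials i u)" by (rule sqint_integrable_on[OF bU U(1)])
  have "AE x in lebesgue_on U. g x - partials i u x = 0"
  proof (rule fundamental_lemma[OF U(1)])
    show "integrable (lebesgue_on U) (\<lambda>x. g x - partials i u x)" using gU uU by simp
    fix \<phi> assume \<phi>: "test_function U \<phi>"
    have \<phi>\<Omega>: "test_function \<Omega> \<phi>" using test_mono[OF \<phi> U(2)] .
    obtain B' where B': "0 \<le> B'" "\<And>x. \<bar>\<phi> x\<bar> \<le> B'" using test_bounded[OF \<phi>, of "[]"] by auto
    have \<phi>m: "\<phi> \<in> borel_measurable (lebesgue_on U)"
      by (intro cont_borel_lebesgue_on smooth_continuous test_smooth[OF \<phi>])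
    have ii: "integrable (lebesgue_on U) (\<lambda>x. h x * \<phi> x)" if h: "integrable (lebesgue_on U) h" for h
    proof (rule Bochner_Integration.integrable_bound[of _ "\<lambda>x. B' * h x"])
      show "AE x in lebesgue_on U. norm (h x * \<phi> x) \<le> norm (B' * h x)"
        using B' by (intro AE_I2) (auto simp: abs_mult mult.commute[of "\<bar>h _\<bar>"] intro!: mult_right_mono)
    qed (use h \<phi>m in \<open>auto intro: borel_measurable_times\<close>)
    have "(LINT x|lebesgue_on \<Omega>. u x * partials i \<phi> x) = (-1) ^ length i * (LINT x|lebesgue_on \<Omega>. g x * \<phi> x)"
      using g \<phi>\<Omega> by (auto simp: is_weak_partial_def)
    moreover have "(LINT x|lebesgue_on \<Omega>. u x * partials i \<phi> x)
       = (-1) ^ length i * (LINT x|lebesgue_on \<Omega>. partials i u x * \<phi> x)"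
      by (rule integral_by_parts_word[OF U m(1) \<phi> C])
    ultimately have eq: "(LINT x|lebesgue_on \<Omega>. g x * \<phi> x) = (LINT x|lebesgue_on \<Omega>. partials i u x * \<phi> x)"
      by simp
    have res: "(LINT x|lebesgue_on \<Omega>. h x * \<phi> x) = (LINT x|lebesgue_on U. h x * \<phi> x)" for h
    proof -
      have "(LINT x|lebesgue_on \<Omega>. h x * \<phi> x) = (LINT x|lebesgue. indicator \<Omega> x *\<^sub>R (h x * \<phi> x))"
        by (rule integral_restrict_space) simp
      also have "\<dots> = (LINT x|lebesgue. indicator U x *\<^sub>R (h x * \<phi> x))"
        using U test_vanish[OF \<phi>, of _ "[]"]
        by (intro Bochner_Integration.integral_cong) (auto simp: indicator_def)
      also have "\<dots> = (LINT x|lebesgue_on U. h x * \<phi> x)"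
        by (rule integral_restrict_space[symmetric]) simp
      finally show ?thesis .
    qed
    show "(LINT x|lebesgue_on U. (g x - partials i u x) * \<phi> x) = 0"
      using eq ii[OF gU] ii[OF uU] by (simp add: res left_diff_distrib)
  qed
  then show ?thesis by eventually_elim simp
qed

lemma weak_partial_smooth:
  assumes "open \<Omega>" "bounded \<Omega>" "smooth f"
  shows "is_weak_partial \<Omega> i f (partials i f)"
  unfolding is_weak_partial_def
proof (intro conjI allI impI)
  show "partials i f \<in> L2 \<Omega>"
    using sqint_smooth[OF smooth_partials[OF assms(3)] assms(2,1)] by (simp add: L2_def sqint_def)
  fix \<phi> assume \<phi>: "test_function \<Omega> \<phi>"
  have "C_k_on (length i) f \<Omega>"
    using assms(3) smooth_continuous[OF smooth_partials[OF assms(3)]] by (auto simp: smooth_def C_k_on_def)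
  then show "(LINT x|lebesgue_on \<Omega>. f x * partials i \<phi> x) = (- 1) ^ length i * (LINT x|lebesgue_on \<Omega>. partials i f x * \<phi> x)"
    using assms(1) by (intro integral_by_parts_word[OF assms(1) order_refl _ \<phi>]) auto
qed

lemma is_weak_partial_diff:
  assumes \<Omega>: "open \<Omega>" "bounded \<Omega>" and u: "sqint (lebesgue_on \<Omega>) u" "sqint (lebesgue_on \<Omega>) v"
    and g: "is_weak_partial \<Omega> i u g" "is_weak_partial \<Omega> i v h"
  shows "is_weak_partial \<Omega> i (\<lambda>x. u x - v x) (\<lambda>x. g x - h x)"
  unfolding is_weak_partial_def
proof (intro conjI allI impI)
  have s: "sqint (lebesgue_on \<Omega>) g" "sqint (lebesgue_on \<Omega>) h"
    using g by (auto simp: is_weak_partial_def L2_def sqint_def)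
  show "(\<lambda>x. g x - h x) \<in> L2 \<Omega>"
    using sqint_diff[OF s] by (simp add: L2_def sqint_def)
  fix \<phi> assume \<phi>: "test_function \<Omega> \<phi>"
  have e: "(LINT x|lebesgue_on \<Omega>. u x * partials i \<phi> x) = (- 1) ^ length i * (LINT x|lebesgue_on \<Omega>. g x * \<phi> x)"
     "(LINT x|lebesgue_on \<Omega>. v x * partials i \<phi> x) = (- 1) ^ length i * (LINT x|lebesgue_on \<Omega>. h x * \<phi> x)"
    using g \<phi> by (auto simp: is_weak_partial_def)
  note t = sqint_test[OF \<phi> \<Omega>(2,1)]
  show "(LINT x|lebesgue_on \<Omega>. (u x - v x) * partials i \<phi> x)
      = (- 1) ^ length i * (LINT x|lebesgue_on \<Omega>. (g x - h x) * \<phi> x)"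
    using e sqint_mult[OF u(1) t] sqint_mult[OF u(2) t] sqint_mult[OF s(1) t[of "[]"]] sqint_mult[OF s(2) t[of "[]"]]
    by (simp add: left_diff_distrib right_diff_distrib)
qed

lemma Hm_weak_partial:
  assumes "u \<in> Hm m \<Omega>" "length i \<le> m"
  shows "is_weak_partial \<Omega> i u (weak_partial \<Omega> i u)" "sqint (lebesgue_on \<Omega>) (weak_partial \<Omega> i u)"
proof -
  show "is_weak_partial \<Omega> i u (weak_partial \<Omega> i u)"
  proof -
    have "\<exists>g. is_weak_partial \<Omega> i u g" using assms by (auto simp: Hm_def)
    then show ?thesis unfolding weak_partial_def by (rule someI_ex)
  qed
  then show "sqint (lebesgue_on \<Omega>) (weak_partial \<Omega> i u)"
    by (auto simp: is_weak_partial_def L2_def sqint_def)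
qed

lemma Hm_sqint: "u \<in> Hm m \<Omega> \<Longrightarrow> sqint (lebesgue_on \<Omega>) u"
  by (auto simp: Hm_def L2_def sqint_def)

lemma Hm_weak_partial_Nil:
  assumes "open \<Omega>" "bounded \<Omega>" "u \<in> Hm m \<Omega>"
  shows "AE x in lebesgue_on \<Omega>. weak_partial \<Omega> [] u x = u x"
  by (rule weak_partial_unique[OF assms(1,2) Hm_weak_partial(1)[OF assms(3)]])
    (use assms in \<open>auto simp: is_weak_partial_def Hm_def\<close>)

lemma Hm_smooth: "open \<Omega> \<Longrightarrow> bounded \<Omega> \<Longrightarrow> smooth f \<Longrightarrow> f \<in> Hm m \<Omega>"
  using weak_partial_smooth sqint_smooth[of f \<Omega>] by (auto simp: Hm_def L2_def sqint_def)

lemma weak_partial_diff_AE: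
  assumes \<Omega>: "open \<Omega>" "bounded \<Omega>" and u: "u \<in> Hm m \<Omega>" "v \<in> Hm m \<Omega>" and "length i \<le> m"
  shows "(\<lambda>x. u x - v x) \<in> Hm m \<Omega>"
    and "AE x in lebesgue_on \<Omega>. weak_partial \<Omega> i (\<lambda>x. u x - v x) x = weak_partial \<Omega> i u x - weak_partial \<Omega> i v x"
proof -
  have w: "is_weak_partial \<Omega> j (\<lambda>x. u x - v x) (\<lambda>x. weak_partial \<Omega> j u x - weak_partial \<Omega> j v x)"
    if "length j \<le> m" for j
    by (rule is_weak_partial_diff[OF \<Omega> Hm_sqint[OF u(1)] Hm_sqint[OF u(2)]
          Hm_weak_partial(1)[OF u(1) that] Hm_weak_partial(1)[OF u(2) that]])
  show H: "(\<lambda>x. u x - v x) \<in> Hm m \<Omega>"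
    using w sqint_diff[OF Hm_sqint[OF u(1)] Hm_sqint[OF u(2)]] by (auto simp: Hm_def L2_def sqint_def)
  show "AE x in lebesgue_on \<Omega>. weak_partial \<Omega> i (\<lambda>x. u x - v x) x = weak_partial \<Omega> i u x - weak_partial \<Omega> i v x"
    by (rule weak_partial_unique[OF \<Omega> Hm_weak_partial(1)[OF H assms(5)] w[OF assms(5)]])
qed

lemma weak_partial_smooth_AE:
  assumes "open \<Omega>" "bounded \<Omega>" "smooth f"
  shows "AE x in lebesgue_on \<Omega>. weak_partial \<Omega> i f x = partials i f x"
  by (rule weak_partial_unique[OF assms(1,2) Hm_weak_partial(1)[OF Hm_smooth[OF assms]] weak_partial_smooth[OF assms]])
    (rule order_refl)

section \<open>Inequalities for test functions\<close>

lemma integral_test_parts: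
  assumes "open \<Omega>" "smooth f" "test_function \<Omega> \<phi>"
  shows "(LINT x|lebesgue_on \<Omega>. f x * partial k \<phi> x) = - (LINT x|lebesgue_on \<Omega>. partial k f x * \<phi> x)"
  using assms by (intro integral_by_parts[of \<Omega>] smooth_differentiable smooth_continuous smooth_partial) auto

lemma integral_test_partials_zero:
  assumes "open \<Omega>" "test_function \<Omega> \<phi>" "i \<noteq> []"
  shows "(LINT x|lebesgue_on \<Omega>. partials i \<phi> x) = 0"
proof -
  obtain k j where i: "i = k # j" using assms(3) by (cases i) auto
  show ?thesis
    using integral_test_parts[OF assms(1) smooth_const[of 1] test_partials[OF assms(2), of j], of k]
    by (simp add: i)
qed

text \<open>Integrate \<open>\<partial>\<^sub>k \<psi> \<cdot> \<partial>\<^sub>k \<psi>\<close> by parts.\<close>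

lemma interpolation_test:
  assumes "open \<Omega>" "bounded \<Omega>" "test_function \<Omega> \<psi>"
  shows "(nrm (lebesgue_on \<Omega>) (partial k \<psi>))\<^sup>2 \<le> nrm (lebesgue_on \<Omega>) \<psi> * nrm (lebesgue_on \<Omega>) (partial k (partial k \<psi>))"
proof -
  have "(nrm (lebesgue_on \<Omega>) (partial k \<psi>))\<^sup>2 = - (LINT x|lebesgue_on \<Omega>. partial k (partial k \<psi>) x * \<psi> x)"
    using integral_test_parts[OF assms(1) smooth_partial[OF test_smooth[OF assms(3)]] assms(3), of k k]
    unfolding nrm_sq by (simp add: power2_eq_square)
  also have "\<dots> \<le> nrm (lebesgue_on \<Omega>) (partial k (partial k \<psi>)) * nrm (lebesgue_on \<Omega>) \<psi>"
    using Cauchy_Schwarz_sqint[of "lebesgue_on \<Omega>" "partial k (partial k \<psi>)" \<psi>]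
      sqint_test[OF assms(3,2,1), of "[k, k]"] sqint_test[OF assms(3,2,1), of "[]"] by auto
  finally show ?thesis by (simp add: mult.commute)
qed

text \<open>Integrate \<open>\<psi>\<^sup>2 = \<psi>\<^sup>2 \<partial>\<^sub>k x\<^sub>k\<close> by parts.\<close>

lemma Poincare_test:
  assumes \<Omega>: "open \<Omega>" "bounded \<Omega>" and \<psi>: "test_function \<Omega> \<psi>" and R: "0 \<le> R" "\<And>x. x \<in> \<Omega> \<Longrightarrow> \<bar>x $ k\<bar> \<le> R"
  shows "nrm (lebesgue_on \<Omega>) \<psi> \<le> 2 * R * nrm (lebesgue_on \<Omega>) (partial k \<psi>)"
proof -
  let ?M = "lebesgue_on \<Omega>"
  have s: "smooth \<psi>" using \<psi> by (rule test_smooth)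
  have t: "test_function \<Omega> (\<lambda>x. \<psi> x * \<psi> x)" by (rule test_mult[OF s \<psi>])
  have q: "sqint ?M \<psi>" "sqint ?M (partial k \<psi>)"
    using sqint_test[OF \<psi> \<Omega>(2,1), of "[]"] sqint_test[OF \<psi> \<Omega>(2,1), of "[k]"] by auto
  have xm: "(\<lambda>x::plane. x $ k) \<in> borel_measurable ?M"
    by (intro cont_borel_lebesgue_on smooth_continuous smooth_coord)
  have Rb: "\<bar>x $ k\<bar> \<le> R" if "x \<in> space ?M" for x using R(2)[of x] that by simp
  have p: "partial k (\<lambda>x. \<psi> x * \<psi> x) = (\<lambda>x. 2 * (\<psi> x * partial k \<psi> x))"
    using partial_mult[OF smooth_differentiable[OF s] smooth_differentiable[OF s]] by auto
  have "(nrm ?M \<psi>)\<^sup>2 = - (LINT x|?M. x $ k * (2 * (\<psi> x * partial k \<psi> x)))"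
    using integral_test_parts[OF \<Omega>(1) smooth_coord[of k] t, of k]
    unfolding nrm_sq by (simp add: p power2_eq_square partial_coord)
  also have "(LINT x|?M. x $ k * (2 * (\<psi> x * partial k \<psi> x))) = 2 * (LINT x|?M. (x $ k * \<psi> x) * partial k \<psi> x)"
    by (subst integral_mult_right_zero[symmetric]) (simp add: mult_ac)
  also have "- (2 * (LINT x|?M. (x $ k * \<psi> x) * partial k \<psi> x)) \<le> 2 * (nrm ?M (\<lambda>x. x $ k * \<psi> x) * nrm ?M (partial k \<psi>))"
    using Cauchy_Schwarz_sqint[OF sqint_bounded_mult[OF q(1) xm Rb] q(2)] by linarith
  also have "\<dots> \<le> 2 * ((R * nrm ?M \<psi>) * nrm ?M (partial k \<psi>))"
    by (intro mult_left_mono mult_right_mono nrm_bounded_mult[OF q(1) xm Rb R(1)]) auto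
  finally have *: "nrm ?M \<psi> * nrm ?M \<psi> \<le> nrm ?M \<psi> * (2 * R * nrm ?M (partial k \<psi>))"
    by (simp add: power2_eq_square mult_ac)
  show ?thesis
  proof (cases "nrm ?M \<psi> = 0")
    case False
    then have "0 < nrm ?M \<psi>" using nrm_nonneg[of ?M \<psi>] by linarith
    then show ?thesis using * by simp
  qed (use R in simp)
qed

lemma finite_words [simp]: "finite (words m)"
  using finite_lists_length_eq[of "UNIV :: 2 set" m] by (simp add: words_def)

text \<open>Any lower derivative is completed to order \<open>m\<close> by further derivatives in the first direction.\<close>

lemma Poincare_words:
  assumes \<Omega>: "open \<Omega>" "bounded \<Omega>"
  obtains C where "0 \<le> C" "\<And>\<psi> (b :: word2). test_function \<Omega> \<psi> \<Longrightarrow> length b \<le> m \<Longrightarrow>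
    nrm (lebesgue_on \<Omega>) (partials b \<psi>) \<le> C * tnrm (words m) (lebesgue_on \<Omega>) (\<lambda>i. partials i \<psi>)"
proof -
  let ?M = "lebesgue_on \<Omega>"
  obtain R0 where R0: "\<And>x. x \<in> \<Omega> \<Longrightarrow> norm x \<le> R0" using \<Omega>(2) by (auto simp: bounded_iff)
  \<comment> \<open>at least \<open>1\<close>, so that \<open>R ^ m\<close> dominates the constant for every number of steps up to \<open>m\<close>\<close>
  define R where "R = max 1 (2 * R0)"
  have R: "1 \<le> R" by (simp add: R_def)
  have step: "nrm ?M \<psi> \<le> R * nrm ?M (partial 1 \<psi>)" if "test_function \<Omega> \<psi>" for \<psi>
  proof -
    have "nrm ?M \<psi> \<le> 2 * (R / 2) * nrm ?M (partial 1 \<psi>)"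
    proof (rule Poincare_test[OF \<Omega> that])
      show "\<bar>x $ 1\<bar> \<le> R / 2" if "x \<in> \<Omega>" for x
        using R0[OF that] component_le_norm_cart[of x 1] by (simp add: R_def)
    qed (use R in simp)
    then show ?thesis by simp
  qed
  have it: "nrm ?M (partials b \<psi>) \<le> R ^ j * nrm ?M (partials (replicate j 1 @ b) \<psi>)"
    if "test_function \<Omega> \<psi>" for j \<psi> and b :: word2
  proof (induction j)
    case (Suc j)
    have "R ^ j * nrm ?M (partials (replicate j 1 @ b) \<psi>)
      \<le> R ^ j * (R * nrm ?M (partial 1 (partials (replicate j 1 @ b) \<psi>)))"
      using R by (intro mult_left_mono step test_partials that) auto
    with Suc show ?case by (simp add: mult_ac)
  qed simp
  show ?thesis
  proof (rule that[of "R ^ m"])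
    fix \<psi> and b :: word2 assume \<psi>: "test_function \<Omega> \<psi>" and b: "length b \<le> m"
    let ?i = "replicate (m - length b) 1 @ b"
    have "nrm ?M (partials b \<psi>) \<le> R ^ (m - length b) * nrm ?M (partials ?i \<psi>)" by (rule it[OF \<psi>])
    also have "\<dots> \<le> R ^ m * tnrm (words m) ?M (\<lambda>i. partials i \<psi>)"
      using R b nrm_le_tnrm[of "words m" ?i ?M "\<lambda>i. partials i \<psi>"]
      by (intro mult_mono power_increasing) (auto simp: words_def finite_words[unfolded words_def])
    finally show "nrm ?M (partials b \<psi>) \<le> R ^ m * tnrm (words m) ?M (\<lambda>i. partials i \<psi>)" .
  qed (use R in auto)
qed

section \<open>Pointwise values of test functions\<close>

definition vec2 :: "real \<Rightarrow> real \<Rightarrow> plane" where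
  "vec2 a b = (\<chi> i. if i = 1 then a else b)"

lemma vec2_nth [simp]: "vec2 a b $ 1 = a" "vec2 a b $ 2 = b"
  by (simp_all add: vec2_def)

lemma vec2_eta: "vec2 (x $ 1) (x $ 2) = x"
  by (simp add: vec_eq_iff forall_2)

lemma vec2_line: "vec2 a b = vec2 a 0 + b *\<^sub>R axis 2 1" "vec2 a b = vec2 0 b + a *\<^sub>R axis 1 1"
  by (simp_all add: vec_eq_iff forall_2 axis_def)

lemma continuous_vec2: "continuous_on UNIV (\<lambda>p. vec2 (fst p) (snd p))"
  unfolding vec2_def
proof (rule continuous_on_vec_lambda)
  show "continuous_on UNIV (\<lambda>p::real \<times> real. if i = 1 then fst p else snd p)" for i :: 2
    by (cases "i = 1") (simp_all add: continuous_on_fst continuous_on_snd continuous_on_id)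
qed

lemma measurable_vec2: "(\<lambda>p. vec2 (fst p) (snd p)) \<in> lborel \<Otimes>\<^sub>M lborel \<rightarrow>\<^sub>M borel"
proof -
  have "(\<lambda>p. vec2 (fst p) (snd p)) \<in> borel_measurable borel"
    by (rule borel_measurable_continuous_onI[OF continuous_vec2])
  then show ?thesis by (simp add: lborel_prod)
qed

lemma Basis_plane: "(Basis :: plane set) = {axis 1 1, axis 2 1}"
  by (auto simp: Basis_vec_def UNIV_2)

text \<open>Transfers Fubini's theorem from pairs of reals to vectors with two components.\<close>

lemma lborel_plane: "(lborel :: plane measure) = distr (lborel \<Otimes>\<^sub>M lborel) borel (\<lambda>p. vec2 (fst p) (snd p))"
proof (rule lborel_eqI)
  fix l u :: plane assume le: "\<And>b. b \<in> Basis \<Longrightarrow> l \<bullet> b \<le> u \<bullet> b"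
  have le': "l $ 1 \<le> u $ 1" "l $ 2 \<le> u $ 2"
    using le[of "axis 1 1"] le[of "axis 2 1"] by (auto simp: Basis_plane inner_axis)
  have pre: "(\<lambda>p. vec2 (fst p) (snd p)) -` box l u \<inter> space (lborel \<Otimes>\<^sub>M lborel) = {l $ 1 <..< u $ 1} \<times> {l $ 2 <..< u $ 2}"
    by (auto simp: mem_box_cart forall_2 space_pair_measure)
  have "emeasure (distr (lborel \<Otimes>\<^sub>M lborel) borel (\<lambda>p. vec2 (fst p) (snd p))) (box l u)
    = emeasure (lborel \<Otimes>\<^sub>M lborel) ({l $ 1 <..< u $ 1} \<times> {l $ 2 <..< u $ 2})"
    by (subst emeasure_distr[OF measurable_vec2]) (auto simp: pre)
  also have "\<dots> = ennreal (u $ 1 - l $ 1) * ennreal (u $ 2 - l $ 2)"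
    using le' by (subst lborel.emeasure_pair_measure_Times) auto
  also have "\<dots> = ennreal ((u $ 1 - l $ 1) * (u $ 2 - l $ 2))"
    using le' by (simp add: ennreal_mult)
  also have "(u $ 1 - l $ 1) * (u $ 2 - l $ 2) = (\<Prod>b\<in>Basis. (u - l) \<bullet> b)"
    by (simp add: Basis_plane axis_eq_axis inner_axis)
  finally show "emeasure (distr (lborel \<Otimes>\<^sub>M lborel) borel (\<lambda>p. vec2 (fst p) (snd p))) (box l u) = (\<Prod>b\<in>Basis. (u - l) \<bullet> b)" .
qed simp

lemma integral_plane:
  fixes f :: "plane \<Rightarrow> real"
  assumes "integrable lborel f"
  shows "(LINT x|lborel. f x) = (LINT a|lborel. (LINT b|lborel. f (vec2 a b)))"
proof -
  have f: "f \<in> borel_measurable borel" using assms by auto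
  have i: "integrable (lborel \<Otimes>\<^sub>M lborel) (\<lambda>p. f (vec2 (fst p) (snd p)))"
    using assms by (subst (asm) lborel_plane) (simp add: integrable_distr_eq[OF measurable_vec2 f])
  have "(LINT x|lborel. f x) = (LINT p|(lborel \<Otimes>\<^sub>M lborel). f (vec2 (fst p) (snd p)))"
    by (subst lborel_plane) (rule integral_distr[OF measurable_vec2 f])
  also have "\<dots> = (LINT a|lborel. (LINT b|lborel. f (vec2 a b)))"
    using lborel_pair.integral_fst'[OF i] by simp
  finally show ?thesis .
qed

lemma integral_derivative_halfline:
  fixes h h' :: "real \<Rightarrow> real"
  assumes "\<And>t. (h has_field_derivative h' t) (at t)" "continuous_on UNIV h'"
    and R: "\<And>t. t \<le> R \<Longrightarrow> h t = 0" "\<And>t. t \<le> R \<Longrightarrow> h' t = 0"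
  shows "(LINT t|lborel. indicator {..c} t * h' t) = h c"
proof -
  let ?A = "min R c"
  have "(\<lambda>t. indicator {..c} t * h' t) = (\<lambda>t. h' t * indicator {?A..c} t)"
    using R(2) by (auto simp: indicator_def fun_eq_iff)
  then have "(LINT t|lborel. indicator {..c} t * h' t) = h c - h ?A"
    using integral_FTC_Icc_real[of ?A c h h'] assms by (auto simp: continuous_on_eq_continuous_at)
  then show ?thesis using R(1) by simp
qed

definition quadrant :: "plane \<Rightarrow> plane set" where
  "quadrant x = {z. z $ 1 \<le> x $ 1 \<and> z $ 2 \<le> x $ 2}"

lemma closed_quadrant: "closed (quadrant x)"
  unfolding quadrant_def by (intro closed_Collect_conj closed_Collect_le continuous_intros)

text \<open>The fundamental theorem of calculus in both variables. It exhibits point evaluation as a functional that is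
  bounded by the square integral of a second derivative.\<close>

lemma test_function_representation:
  assumes \<Omega>: "open \<Omega>" and \<psi>: "test_function \<Omega> \<psi>"
  shows "\<psi> x = (LINT z|lebesgue_on \<Omega>. indicator (quadrant x) z * partials [2, 1] \<psi> z)"
proof -
  obtain S where S: "smooth \<psi>" "compact S" "S \<subseteq> \<Omega>" "\<And>x. x \<notin> S \<Longrightarrow> \<psi> x = 0" "\<And>i x. x \<notin> S \<Longrightarrow> partials i \<psi> x = 0"
    using test_functionE[OF \<psi>] by metis
  obtain R where R: "\<And>x. x \<in> S \<Longrightarrow> norm x \<le> R" using compact_imp_bounded[OF S(2)] by (auto simp: bounded_iff)
  let ?R = "- R - 1"
  have out: "partials i \<psi> z = 0" if "z $ 1 \<le> ?R \<or> z $ 2 \<le> ?R" for i z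
  proof (rule S(5))
    show "z \<notin> S"
      using R[of z] that component_le_norm_cart[of z 1] component_le_norm_cart[of z 2] by auto
  qed
  let ?F = "partials [2, 1] \<psi>"
  have sm: "smooth (partials i \<psi>)" for i by (rule smooth_partials[OF S(1)])
  have qm: "quadrant x \<in> sets borel" by (rule borel_closed[OF closed_quadrant])
  have iF: "integrable lborel ?F"
    by (rule integrable_compact_support[OF smooth_continuous[OF sm] S(2)]) (use S in blast)
  have iq: "integrable lborel (\<lambda>z. indicator (quadrant x) z * ?F z)"
    using integrable_mult_indicator[OF _ iF, of "quadrant x"] qm by simp
  have "(LINT z|lebesgue_on \<Omega>. indicator (quadrant x) z * ?F z) = (LINT z|lborel. indicator (quadrant x) z * ?F z)"
    using \<Omega> iq test_vanish[OF \<psi>, of _ "[2, 1]"] by (intro lebesgue_on_eq_lborel(1)) auto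
  also have "\<dots> = (LINT a|lborel. (LINT b|lborel. indicator (quadrant x) (vec2 a b) * ?F (vec2 a b)))"
    by (rule integral_plane[OF iq])
  also have "\<dots> = (LINT a|lborel. indicator {..x $ 1} a * partials [1] \<psi> (vec2 a (x $ 2)))"
  proof (rule Bochner_Integration.integral_cong[OF refl])
    fix a
    have "(LINT b|lborel. indicator (quadrant x) (vec2 a b) * ?F (vec2 a b))
      = (LINT b|lborel. indicator {..x $ 1} a * (indicator {..x $ 2} b * ?F (vec2 a b)))"
      by (intro Bochner_Integration.integral_cong) (auto simp: quadrant_def indicator_def)
    also have "\<dots> = indicator {..x $ 1} a * (LINT b|lborel. indicator {..x $ 2} b * ?F (vec2 a b))" by simp
    also have "(LINT b|lborel. indicator {..x $ 2} b * ?F (vec2 a b)) = partials [1] \<psi> (vec2 a (x $ 2))"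
    proof (rule integral_derivative_halfline[where R = ?R])
      show "((\<lambda>b. partials [1] \<psi> (vec2 a b)) has_real_derivative ?F (vec2 a b)) (at b)" for b
        using partial_along_line[of "partials [1] \<psi>" "vec2 a 0" b 2] smooth_differentiable[OF sm, of "[1]"]
        by (simp flip: vec2_line(1))
      have "continuous_on UNIV (\<lambda>b. ?F (vec2 a 0 + b *\<^sub>R axis 2 1))"
        by (intro continuous_on_compose2[OF smooth_continuous[OF sm, of UNIV]] continuous_intros) auto
      then show "continuous_on UNIV (\<lambda>b. ?F (vec2 a b))" by (simp flip: vec2_line(1))
    qed (use out in \<open>simp_all del: partials.simps\<close>)
    finally show "(LINT b|lborel. indicator (quadrant x) (vec2 a b) * ?F (vec2 a b))
      = indicator {..x $ 1} a * partials [1] \<psi> (vec2 a (x $ 2))" .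
  qed
  also have "\<dots> = partials [] \<psi> (vec2 (x $ 1) (x $ 2))"
  proof (rule integral_derivative_halfline[where R = ?R])
    show "((\<lambda>a. partials [] \<psi> (vec2 a (x $ 2))) has_real_derivative partials [1] \<psi> (vec2 a (x $ 2))) (at a)" for a
      using partial_along_line[of "\<psi>" "vec2 0 (x $ 2)" a 1] smooth_differentiable[OF S(1)]
      by (simp flip: vec2_line(2))
    have "continuous_on UNIV (\<lambda>a. partials [1] \<psi> (vec2 0 (x $ 2) + a *\<^sub>R axis 1 1))"
      by (intro continuous_on_compose2[OF smooth_continuous[OF sm, of UNIV]] continuous_intros) auto
    then show "continuous_on UNIV (\<lambda>a. partials [1] \<psi> (vec2 a (x $ 2)))" by (simp flip: vec2_line(2))
  qed (use out in \<open>simp_all del: partials.simps\<close>)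
  finally show ?thesis by (simp add: vec2_eta)
qed

section \<open>Compactness for bounded sequences of test functions\<close>

text \<open>The discriminant condition for a quadratic polynomial in \<open>t\<close>, including the degenerate case \<open>N = 0\<close>.\<close>

lemma quadratic_nonneg_bound:
  fixes d N \<delta> :: real
  assumes quad: "\<And>t. 0 \<le> t * d + t\<^sup>2 * N\<^sup>2 / 2 + \<delta>\<^sup>2 / 2" and "0 \<le> N" "0 \<le> \<delta>"
  shows "\<bar>d\<bar> \<le> \<delta> * N"
proof -
  have "d\<^sup>2 \<le> (\<delta> * N)\<^sup>2"
  proof (cases "N = 0")
    case True
    have "d = 0"
    proof (rule ccontr)
      assume "d \<noteq> 0"
      then have "- (\<delta>\<^sup>2 + 1) / d * d = - (\<delta>\<^sup>2 + 1)" by simp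
      then show False
        using quad[of "- (\<delta>\<^sup>2 + 1) / d"] True zero_le_power2[of \<delta>] by simp
    qed
    then show ?thesis by simp
  next
    case False
    define P where "P = N\<^sup>2"
    have P: "0 < P" using False by (simp add: P_def)
    have "0 \<le> (- d / P) * d + (- d / P)\<^sup>2 * P / 2 + \<delta>\<^sup>2 / 2"
      using quad[of "- d / P"] by (simp only: P_def)
    also have "\<dots> = (\<delta>\<^sup>2 - d\<^sup>2 / P) / 2"
      using P by (simp add: field_simps power2_eq_square)
    finally have "d\<^sup>2 / P \<le> \<delta>\<^sup>2" by simp
    then show ?thesis using P by (simp add: P_def field_simps power_mult_distrib)
  qed
  then have "\<bar>d\<bar> \<le> \<bar>\<delta> * N\<bar>" by (simp add: abs_le_square_iff)
  then show ?thesis using assms by simp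
qed

text \<open>A substitute for the Riesz representation theorem that avoids completing the space. The functional
  \<open>Q \<phi> = a \<phi> \<phi> / 2 - L \<phi>\<close> is bounded below; if \<open>\<phi>\<close> is within \<open>\<delta>\<^sup>2 / 2\<close> of the infimum, then comparing
  \<open>Q \<phi>\<close> with \<open>Q (\<phi> + t \<psi>)\<close> for all \<open>t\<close> shows that the
  first variation of \<open>Q\<close> at \<open>\<phi>\<close> in direction \<open>\<psi>\<close> is at most \<open>\<delta>\<close> times the norm of \<open>\<psi>\<close>.\<close>

lemma approximate_Riesz:
  fixes \<Omega> :: "plane set" and m :: nat and L :: "(plane \<Rightarrow> real) \<Rightarrow> real"
  defines "M \<equiv> lebesgue_on \<Omega>"
  defines "a \<equiv> \<lambda>\<phi> \<psi>. tform (words m) M (\<lambda>_. 1) (\<lambda>i. partials i \<phi>) (\<lambda>i. partials i \<psi>)"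
  assumes \<Omega>: "open \<Omega>" "bounded \<Omega>"
    and lin: "\<And>\<phi> \<psi> t. test_function \<Omega> \<phi> \<Longrightarrow> test_function \<Omega> \<psi> \<Longrightarrow> L (\<lambda>x. \<phi> x + t * \<psi> x) = L \<phi> + t * L \<psi>"
    and bdd: "\<And>\<phi>. test_function \<Omega> \<phi> \<Longrightarrow> \<bar>L \<phi>\<bar> \<le> C * tnrm (words m) M (\<lambda>i. partials i \<phi>)"
    and \<delta>: "0 < \<delta>"
  obtains \<phi> where "test_function \<Omega> \<phi>" "\<And>\<psi>. test_function \<Omega> \<psi> \<Longrightarrow> \<bar>L \<psi> - a \<phi> \<psi>\<bar> \<le> \<delta> * tnrm (words m) M (\<lambda>i. partials i \<psi>)"
proof -
  let ?n = "\<lambda>\<phi>. tnrm (words m) M (\<lambda>i. partials i \<phi>)"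
  let ?T = "{\<phi>. test_function \<Omega> \<phi>}"
  define Q where "Q \<phi> = a \<phi> \<phi> / 2 - L \<phi>" for \<phi>
  have ts: "tsqint (words m) M (\<lambda>i. partials i \<phi>)" if "test_function \<Omega> \<phi>" for \<phi>
    using sqint_test[OF that \<Omega>(2,1)] by (auto simp: tsqint_def M_def)
  have one: "bdd_coeff M 1 (\<lambda>_. 1)" by (auto simp: bdd_coeff_def)
  have an: "a \<phi> \<phi> = (?n \<phi>)\<^sup>2" for \<phi>
    unfolding tnrm_sq by (simp add: a_def tform_def power2_eq_square)
  have lower: "Q \<phi> \<ge> - C\<^sup>2 / 2" if "test_function \<Omega> \<phi>" for \<phi>
  proof -
    have "0 \<le> (?n \<phi> - C)\<^sup>2 / 2" by simp
    also have "\<dots> = (?n \<phi>)\<^sup>2 / 2 - C * ?n \<phi> + C\<^sup>2 / 2" by (simp add: power2_diff field_simps)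
    also have "\<dots> \<le> Q \<phi> + C\<^sup>2 / 2" using bdd[OF that] by (simp add: Q_def an)
    finally show ?thesis by simp
  qed
  have bb: "bdd_below (Q ` ?T)" by (rule bdd_belowI2[of _ "- C\<^sup>2 / 2"]) (use lower in auto)
  have ne: "Q ` ?T \<noteq> {}" using test_zero by auto
  have "Inf (Q ` ?T) < Inf (Q ` ?T) + \<delta>\<^sup>2 / 2" using \<delta> by simp
  then obtain \<phi> where \<phi>: "test_function \<Omega> \<phi>" "Q \<phi> < Inf (Q ` ?T) + \<delta>\<^sup>2 / 2"
    using cInf_lessD[OF ne, of "Inf (Q ` ?T) + \<delta>\<^sup>2 / 2"] by auto
  have near: "Q \<phi> - \<delta>\<^sup>2 / 2 \<le> Q \<xi>" if "test_function \<Omega> \<xi>" for \<xi> :: "plane \<Rightarrow> real"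
  proof -
    have "Inf (Q ` ?T) \<le> Q \<xi>" by (rule cInf_lower[OF _ bb]) (use that in auto)
    then show ?thesis using \<phi>(2) by linarith
  qed
  show ?thesis
  proof (rule that[OF \<phi>(1)])
    fix \<psi> assume \<psi>: "test_function \<Omega> \<psi>"
    let ?d = "a \<phi> \<psi> - L \<psi>" and ?N = "?n \<psi>"
    have quad: "0 \<le> t * ?d + t\<^sup>2 * ?N\<^sup>2 / 2 + \<delta>\<^sup>2 / 2" for t
    proof -
      let ?\<xi> = "\<lambda>x. \<phi> x + t * \<psi> x"
      have \<xi>: "test_function \<Omega> ?\<xi>" by (intro test_add test_cmult \<phi> \<psi>)
      have p: "(\<lambda>i. partials i ?\<xi>) = (\<lambda>i x. partials i \<phi> x + t * partials i \<psi> x)"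
        using partials_add[OF test_smooth[OF \<phi>(1)] smooth_cmult[OF test_smooth[OF \<psi>]], of _ t]
          partials_cmult[OF test_smooth[OF \<psi>], of _ t] by auto
      note t1 = ts[OF \<phi>(1)] and t2 = ts[OF \<psi>]
      note t3 = tsqint_cmult[OF t2, of t]
      have "a ?\<xi> ?\<xi> = a \<phi> \<phi> + 2 * t * a \<phi> \<psi> + t\<^sup>2 * a \<psi> \<psi>"
        unfolding a_def p
        by (simp add: tform_add_left[OF one tsqint_add[OF t1 t3] t1 t3] tform_add_right[OF one t1 t1 t3]
            tform_add_right[OF one t3 t1 t3] tform_cmult_right)
          (simp add: tform_commute[of _ _ _ "\<lambda>i x. t * partials i \<psi> x"] tform_cmult_right power2_eq_square algebra_simps)
      then have "Q ?\<xi> = Q \<phi> + t * ?d + t\<^sup>2 * ?N\<^sup>2 / 2"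
        by (simp add: Q_def lin[OF \<phi>(1) \<psi>] an field_simps)
      then show ?thesis using near[OF \<xi>] by simp
    qed
    have "\<bar>?d\<bar> \<le> \<delta> * ?N"
      using \<delta> by (intro quadratic_nonneg_bound[OF quad]) auto
    then show "\<bar>L \<psi> - a \<phi> \<psi>\<bar> \<le> \<delta> * ?N" by (simp add: abs_minus_commute)
  qed
qed

text \<open>Point evaluations are almost represented by fixed test functions, so \<open>\<psi>\<^sub>n\<close> tends to zero pointwise;
  it is also uniformly bounded, and dominated convergence gives the case of no derivatives. The step to a further derivative
  is interpolation between the previous order and the next one, which is at most \<open>m\<close>.\<close>

lemma compactness_test:
  fixes \<Omega> :: "plane set" and m :: nat and \<psi> :: "nat \<Rightarrow> plane \<Rightarrow> real"
  defines "M \<equiv> lebesgue_on \<Omega>"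
  assumes \<Omega>: "open \<Omega>" "bounded \<Omega>" and m: "2 \<le> m"
    and \<psi>: "\<And>n. test_function \<Omega> (\<psi> n)" "\<And>n. tnrm (words m) M (\<lambda>i. partials i (\<psi> n)) \<le> B"
    and weak: "\<And>\<phi>. test_function \<Omega> \<phi> \<Longrightarrow>
      (\<lambda>n. tform (words m) M (\<lambda>_. 1) (\<lambda>i. partials i \<phi>) (\<lambda>i. partials i (\<psi> n))) \<longlonglongrightarrow> 0"
    and b: "length b < m"
  shows "(\<lambda>n. nrm M (partials b (\<psi> n))) \<longlonglongrightarrow> 0"
proof -
  let ?n = "\<lambda>\<phi>. tnrm (words m) M (\<lambda>i. partials i \<phi>)"
  obtain C where C: "0 \<le> C" "\<And>\<psi> (b :: word2). test_function \<Omega> \<psi> \<Longrightarrow> length b \<le> m \<Longrightarrow> nrm M (partials b \<psi>) \<le> C * ?n \<psi>"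
    using Poincare_words[OF \<Omega>, of m] unfolding M_def by metis
  interpret finite_measure M unfolding M_def by (rule finite_measure_open_bounded[OF \<Omega>(2,1)])
  have B: "0 \<le> B" using \<psi>(2)[of 0] tnrm_nonneg order_trans by blast
  have qM: "(\<lambda>z. indicator (quadrant x) z :: real) \<in> borel_measurable M" for x
  proof -
    have "quadrant x \<in> sets borel" by (rule borel_closed[OF closed_quadrant])
    then have "quadrant x \<in> sets lebesgue" by simp
    then have "(\<lambda>z. indicator (quadrant x) z :: real) \<in> borel_measurable lebesgue"
      by (rule borel_measurable_indicator)
    then show ?thesis unfolding M_def by (rule measurable_restrict_space1)
  qed
  define l where "l x \<phi> = (LINT z|M. indicator (quadrant x) z * partials [2, 1] \<phi> z)" for x \<phi>
  have lb: "\<bar>l x \<phi>\<bar> \<le> (sqrt (measure M (space M)) * C) * ?n \<phi>" if \<phi>: "test_function \<Omega> \<phi>" for x \<phi>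
  proof -
    have s: "sqint M (partials [2, 1] \<phi>)" unfolding M_def by (rule sqint_test[OF \<phi> \<Omega>(2,1)])
    have i: "sqint M (indicator (quadrant x))" "nrm M (indicator (quadrant x)) \<le> 1 * sqrt (measure M (space M))"
      by (rule nrm_le_of_bounded(1)[OF finite_measure_axioms qM, of _ 1], simp add: indicator_def)
        (rule nrm_le_of_bounded(2)[OF finite_measure_axioms qM], simp_all add: indicator_def)
    have "\<bar>l x \<phi>\<bar> \<le> nrm M (indicator (quadrant x)) * nrm M (partials [2, 1] \<phi>)"
      unfolding l_def by (rule Cauchy_Schwarz_sqint[OF i(1) s])
    also have "\<dots> \<le> sqrt (measure M (space M)) * (C * ?n \<phi>)"
      using i(2) C(2)[OF \<phi>, of "[2, 1]"] m by (intro mult_mono) (auto simp del: partials.simps)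
    finally show ?thesis by (simp add: mult.assoc)
  qed
  have rep: "\<psi> n x = l x (\<psi> n)" for n x
    unfolding l_def M_def by (rule test_function_representation[OF \<Omega>(1) \<psi>(1)])
  have pointwise: "(\<lambda>n. \<psi> n x) \<longlonglongrightarrow> 0" for x
  proof (rule LIMSEQ_I)
    fix r :: real assume r: "0 < r"
    define \<delta> where "\<delta> = r / (2 * (B + 1))"
    have \<delta>: "0 < \<delta>" using r B by (simp add: \<delta>_def)
    have \<delta>B: "\<delta> * B \<le> r / 2" using r B by (simp add: \<delta>_def field_simps)
    have lin: "l x (\<lambda>z. \<phi> z + t * \<xi> z) = l x \<phi> + t * l x \<xi>" if t: "test_function \<Omega> \<phi>" "test_function \<Omega> \<xi>" for \<phi> \<xi> t
    proof -
      have p: "partials [2, 1] (\<lambda>z. \<phi> z + t * \<xi> z) = (\<lambda>z. partials [2, 1] \<phi> z + t * partials [2, 1] \<xi> z)"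
        by (simp only: partials_add[OF test_smooth[OF t(1)] smooth_cmult[OF test_smooth[OF t(2)]]]
            partials_cmult[OF test_smooth[OF t(2)]])
      have "integrable M (\<lambda>z. indicator (quadrant x) z * partials [2, 1] w z)" if "test_function \<Omega> w" for w
      proof -
        have s: "sqint M (partials [2, 1] w)" unfolding M_def by (rule sqint_test[OF that \<Omega>(2,1)])
        have "sqint M (indicator (quadrant x))"
          by (rule nrm_le_of_bounded(1)[OF finite_measure_axioms qM, of _ 1]) (simp add: indicator_def)
        from sqint_mult[OF this s] show ?thesis .
      qed
      note i = this[OF t(1)] this[OF t(2)]
      have "l x (\<lambda>z. \<phi> z + t * \<xi> z) = (LINT z|M. indicator (quadrant x) z * partials [2, 1] \<phi> z
        + t * (indicator (quadrant x) z * partials [2, 1] \<xi> z))"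
        unfolding l_def p by (simp only: distrib_left mult.left_commute)
      also have "\<dots> = l x \<phi> + t * l x \<xi>"
        unfolding l_def using i by (simp del: partials.simps)
      finally show ?thesis .
    qed
    obtain \<phi> where \<phi>: "test_function \<Omega> \<phi>" "\<And>\<xi>. test_function \<Omega> \<xi> \<Longrightarrow>
        \<bar>l x \<xi> - tform (words m) M (\<lambda>_. 1) (\<lambda>i. partials i \<phi>) (\<lambda>i. partials i \<xi>)\<bar> \<le> \<delta> * ?n \<xi>"
      using approximate_Riesz[OF \<Omega>, of "l x" "sqrt (measure M (space M)) * C" m \<delta>, folded M_def, OF lin lb \<delta>]
      by blast
    have "\<forall>\<^sub>F n in sequentially. \<bar>tform (words m) M (\<lambda>_. 1) (\<lambda>i. partials i \<phi>) (\<lambda>i. partials i (\<psi> n))\<bar> < r / 2"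
      using tendstoD[OF weak[OF \<phi>(1)], of "r / 2"] r by (simp add: dist_real_def)
    then have "\<forall>\<^sub>F n in sequentially. norm (\<psi> n x - 0) < r"
    proof eventually_elim
      case (elim n)
      have "\<delta> * ?n (\<psi> n) \<le> \<delta> * B" using \<delta> \<psi>(2) by (intro mult_left_mono) auto
      then have "\<bar>l x (\<psi> n)\<bar> < r"
        using elim \<phi>(2)[OF \<psi>(1), of n] \<delta>B by linarith
      then show ?case using rep[of n x] by simp
    qed
    then show "\<exists>no. \<forall>n\<ge>no. norm (\<psi> n x - 0) < r" by (simp add: eventually_sequentially)
  qed
  let ?D = "sqrt (measure M (space M)) * C * B"
  have bound: "\<bar>\<psi> n x\<bar> \<le> ?D" for n x
  proof -
    have "\<bar>\<psi> n x\<bar> \<le> (sqrt (measure M (space M)) * C) * ?n (\<psi> n)"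
      by (rule ord_eq_le_trans[OF arg_cong[where f = abs, OF rep] lb[OF \<psi>(1)]])
    also have "\<dots> \<le> ?D" using C(1) \<psi>(2) by (intro mult_left_mono) auto
    finally show ?thesis .
  qed
  have zero: "(\<lambda>n. nrm M (\<psi> n)) \<longlonglongrightarrow> 0"
  proof -
    have "(\<lambda>n. LINT x|M. (\<psi> n x)\<^sup>2) \<longlonglongrightarrow> (LINT x|M. 0)"
    proof (rule integral_dominated_convergence[where w = "\<lambda>_. ?D\<^sup>2"])
      show "(\<lambda>x. (\<psi> n x)\<^sup>2) \<in> borel_measurable M" for n
        using sqint_test[OF \<psi>(1)[of n] \<Omega>(2,1), of "[]"] by (auto simp: sqint_def M_def)
      show "AE x in M. (\<lambda>n. (\<psi> n x)\<^sup>2) \<longlonglongrightarrow> 0"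
      proof (intro AE_I2)
        show "(\<lambda>n. (\<psi> n x)\<^sup>2) \<longlonglongrightarrow> 0" for x
          using tendsto_power[OF pointwise[of x], of 2] by simp
      qed
      show "AE x in M. norm ((\<psi> n x)\<^sup>2) \<le> ?D\<^sup>2" for n
      proof (intro AE_I2)
        fix x
        have "\<bar>\<psi> n x\<bar>\<^sup>2 \<le> ?D\<^sup>2" by (rule power_mono[OF bound]) simp
        then show "norm ((\<psi> n x)\<^sup>2) \<le> ?D\<^sup>2" by simp
      qed
    qed auto
    then have "(\<lambda>n. sqrt (LINT x|M. (\<psi> n x)\<^sup>2)) \<longlonglongrightarrow> sqrt 0"
      by (intro tendsto_real_sqrt) simp
    then show ?thesis by (simp add: nrm_def)
  qed
  show ?thesis using b
  proof (induction b)
    case (Cons k b)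
    have up: "nrm M (partials (k # k # b) (\<psi> n)) \<le> C * B" for n
    proof -
      have "nrm M (partials (k # k # b) (\<psi> n)) \<le> C * ?n (\<psi> n)"
        using Cons.prems by (intro C(2) \<psi>(1)) auto
      also have "\<dots> \<le> C * B" using C(1) \<psi>(2) by (intro mult_left_mono) auto
      finally show ?thesis .
    qed
    have "(\<lambda>n. (nrm M (partials (k # b) (\<psi> n)))\<^sup>2) \<longlonglongrightarrow> 0"
    proof (rule Lim_null_comparison)
      show "\<forall>\<^sub>F n in sequentially. norm ((nrm M (partials (k # b) (\<psi> n)))\<^sup>2) \<le> nrm M (partials b (\<psi> n)) * (C * B)"
      proof (intro always_eventually allI)
        fix n
        have "(nrm M (partials (k # b) (\<psi> n)))\<^sup>2 \<le> nrm M (partials b (\<psi> n)) * nrm M (partials (k # k # b) (\<psi> n))"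
          using interpolation_test[OF \<Omega> test_partials[OF \<psi>(1)[of n], of b], of k] by (simp add: M_def)
        also have "\<dots> \<le> nrm M (partials b (\<psi> n)) * (C * B)" by (intro mult_left_mono up) simp
        finally show "norm ((nrm M (partials (k # b) (\<psi> n)))\<^sup>2) \<le> nrm M (partials b (\<psi> n)) * (C * B)" by simp
      qed
      show "(\<lambda>n. nrm M (partials b (\<psi> n)) * (C * B)) \<longlonglongrightarrow> 0"
        using Cons by (intro tendsto_mult_left_zero) auto
    qed
    then have "(\<lambda>n. sqrt ((nrm M (partials (k # b) (\<psi> n)))\<^sup>2)) \<longlonglongrightarrow> sqrt 0" by (rule tendsto_real_sqrt)
    then show ?case by simp
  qed (use zero in simp)
qed

section \<open>Products with a smooth factor\<close>

definition words_lt :: "nat \<Rightarrow> word2 set" where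
  "words_lt n = {b. length b < n}"

lemma finite_words_lt [simp]: "finite (words_lt n)"
  by (rule finite_subset[OF _ finite_lists_length_le[of "UNIV :: 2 set" n]]) (auto simp: words_lt_def)

text \<open>Only the highest derivative of \<open>\<phi>\<close> is isolated from the Leibniz rule. The induction splits off the innermost
  derivative, since it then applies to a product of the same kind with \<open>\<eta>\<close> or \<open>\<phi>\<close> replaced by its derivative.\<close>

lemma Leibniz_commutator:
  assumes "smooth \<eta>" "bounded \<Omega>"
  shows "\<exists>C\<ge>0. \<forall>\<phi>. smooth \<phi> \<longrightarrow> (\<forall>x\<in>\<Omega>. \<bar>partials i (\<lambda>x. \<eta> x * \<phi> x) x - \<eta> x * partials i \<phi> x\<bar>
     \<le> C * (\<Sum>b\<in>words_lt (length i). \<bar>partials b \<phi> x\<bar>))"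
  using assms(1)
proof (induction i arbitrary: \<eta> rule: rev_induct)
  case Nil
  then show ?case by auto
next
  case (snoc k i)
  let ?S = "\<lambda>n \<phi> x. \<Sum>b\<in>words_lt n. \<bar>partials b \<phi> x\<bar>"
  have \<eta>': "smooth (partial k \<eta>)" by (rule smooth_partial[OF snoc.prems])
  obtain C1 where C1: "C1 \<ge> 0" "\<And>\<phi> x. smooth \<phi> \<Longrightarrow> x \<in> \<Omega> \<Longrightarrow>
      \<bar>partials i (\<lambda>x. partial k \<eta> x * \<phi> x) x - partial k \<eta> x * partials i \<phi> x\<bar> \<le> C1 * ?S (length i) \<phi> x"
    using snoc.IH[OF \<eta>'] by blast
  obtain C2 where C2: "C2 \<ge> 0" "\<And>\<phi> x. smooth \<phi> \<Longrightarrow> x \<in> \<Omega> \<Longrightarrow>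
      \<bar>partials i (\<lambda>x. \<eta> x * \<phi> x) x - \<eta> x * partials i \<phi> x\<bar> \<le> C2 * ?S (length i) \<phi> x"
    using snoc.IH[OF snoc.prems] by blast
  obtain B where B: "0 \<le> B" "\<And>x. x \<in> \<Omega> \<Longrightarrow> \<bar>partial k \<eta> x\<bar> \<le> B"
    using smooth_bounded[OF \<eta>' assms(2)] by blast
  have "\<bar>partials (i @ [k]) (\<lambda>x. \<eta> x * \<phi> x) x - \<eta> x * partials (i @ [k]) \<phi> x\<bar>
      \<le> (B + C1 + C2) * ?S (length (i @ [k])) \<phi> x" if \<phi>: "smooth \<phi>" and x: "x \<in> \<Omega>" for \<phi> x
  proof -
    have \<phi>': "smooth (partial k \<phi>)" by (rule smooth_partial[OF \<phi>])
    have "partial k (\<lambda>x. \<eta> x * \<phi> x) = (\<lambda>x. partial k \<eta> x * \<phi> x + \<eta> x * partial k \<phi> x)"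
      by (intro ext partial_mult smooth_differentiable snoc.prems \<phi>)
    then have e: "partials (i @ [k]) (\<lambda>x. \<eta> x * \<phi> x) x - \<eta> x * partials (i @ [k]) \<phi> x
       = partials i (\<lambda>x. partial k \<eta> x * \<phi> x) x
         + (partials i (\<lambda>x. \<eta> x * partial k \<phi> x) x - \<eta> x * partials i (partial k \<phi>) x)"
      by (simp add: partials_append partials_add[OF smooth_mult[OF \<eta>' \<phi>] smooth_mult[OF snoc.prems \<phi>']])
    have S1: "\<bar>partials i \<phi> x\<bar> \<le> ?S (length (i @ [k])) \<phi> x"
      by (rule member_le_sum[of i _ "\<lambda>b. \<bar>partials b \<phi> x\<bar>"]) (auto simp: words_lt_def finite_words_lt[unfolded words_lt_def])
    have S2: "?S (length i) \<phi> x \<le> ?S (length (i @ [k])) \<phi> x"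
      by (rule sum_mono2) (auto simp: words_lt_def finite_words_lt[unfolded words_lt_def])
    have "?S (length i) (partial k \<phi>) x = (\<Sum>b\<in>(\<lambda>b. b @ [k]) ` words_lt (length i). \<bar>partials b \<phi> x\<bar>)"
      by (subst sum.reindex) (auto simp: inj_on_def partials_append)
    also have "\<dots> \<le> ?S (length (i @ [k])) \<phi> x"
      by (rule sum_mono2) (auto simp: words_lt_def finite_words_lt[unfolded words_lt_def])
    finally have S3: "?S (length i) (partial k \<phi>) x \<le> ?S (length (i @ [k])) \<phi> x" .
    have "\<bar>partials i (\<lambda>x. partial k \<eta> x * \<phi> x) x\<bar> \<le> \<bar>partial k \<eta> x\<bar> * \<bar>partials i \<phi> x\<bar> + C1 * ?S (length i) \<phi> x"
      using C1(2)[OF \<phi> x] unfolding abs_mult[symmetric] by linarith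
    also have "\<dots> \<le> B * ?S (length (i @ [k])) \<phi> x + C1 * ?S (length (i @ [k])) \<phi> x"
      using B x C1 S1 S2 by (intro add_mono mult_mono) auto
    finally have 1: "\<bar>partials i (\<lambda>x. partial k \<eta> x * \<phi> x) x\<bar> \<le> (B + C1) * ?S (length (i @ [k])) \<phi> x"
      by (simp add: distrib_right)
    have "\<bar>partials i (\<lambda>x. \<eta> x * partial k \<phi> x) x - \<eta> x * partials i (partial k \<phi>) x\<bar> \<le> C2 * ?S (length i) (partial k \<phi>) x"
      by (rule C2(2)[OF \<phi>' x])
    also have "\<dots> \<le> C2 * ?S (length (i @ [k])) \<phi> x" using S3 C2(1) by (rule mult_left_mono)
    finally show ?thesis unfolding e using 1 by (simp add: distrib_right)
  qed
  then show ?case using B(1) C1(1) C2(1) by (intro exI[of _ "B + C1 + C2"]) auto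
qed

lemma Leibniz_commutator_nrm:
  assumes \<Omega>: "open \<Omega>" "bounded \<Omega>" and \<eta>: "smooth \<eta>"
  obtains C where "0 \<le> C" "\<And>\<phi> i. test_function \<Omega> \<phi> \<Longrightarrow> i \<in> words m \<Longrightarrow>
    nrm (lebesgue_on \<Omega>) (\<lambda>x. partials i (\<lambda>x. \<eta> x * \<phi> x) x - \<eta> x * partials i \<phi> x)
      \<le> C * (\<Sum>b\<in>words_lt m. nrm (lebesgue_on \<Omega>) (partials b \<phi>))"
proof -
  let ?M = "lebesgue_on \<Omega>"
  let ?P = "\<lambda>i C. \<forall>\<phi>. smooth \<phi> \<longrightarrow> (\<forall>x\<in>\<Omega>. \<bar>partials i (\<lambda>x. \<eta> x * \<phi> x) x - \<eta> x * partials i \<phi> x\<bar>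
     \<le> C * (\<Sum>b\<in>words_lt (length i). \<bar>partials b \<phi> x\<bar>))"
  have "\<forall>i. \<exists>C. 0 \<le> C \<and> ?P i C"
    using Leibniz_commutator[OF \<eta> \<Omega>(2)] by (intro allI)
  from choice[OF this] obtain c where c': "\<forall>i. 0 \<le> c i \<and> ?P i (c i)" ..
  have c: "c i \<ge> 0" "\<And>\<phi> x. smooth \<phi> \<Longrightarrow> x \<in> \<Omega> \<Longrightarrow> \<bar>partials i (\<lambda>x. \<eta> x * \<phi> x) x - \<eta> x * partials i \<phi> x\<bar>
     \<le> c i * (\<Sum>b\<in>words_lt (length i). \<bar>partials b \<phi> x\<bar>)" for i
    using c'[rule_format, of i] by blast+
  define C where "C = (\<Sum>i\<in>words m. c i)"
  have C: "c i \<le> C" if "i \<in> words m" for i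
    unfolding C_def using that c(1) by (intro member_le_sum) auto
  show ?thesis
  proof (rule that[of C])
    show "0 \<le> C" unfolding C_def using c(1) by (simp add: sum_nonneg)
    fix \<phi> i assume \<phi>: "test_function \<Omega> \<phi>" and i: "i \<in> words m"
    let ?S = "\<lambda>x. \<Sum>b\<in>words_lt m. \<bar>partials b \<phi> x\<bar>"
    have sp: "sqint ?M (partials b \<phi>)" for b by (rule sqint_test[OF \<phi> \<Omega>(2,1)])
    have S: "sqint ?M ?S" "nrm ?M ?S \<le> (\<Sum>b\<in>words_lt m. nrm ?M (\<lambda>x. \<bar>partials b \<phi> x\<bar>))"
      using sqint_sum_nrm[of "words_lt m" ?M "\<lambda>b x. \<bar>partials b \<phi> x\<bar>"] sqint_abs(1)[OF sp] by auto
    have "smooth (\<lambda>x. partials i (\<lambda>x. \<eta> x * \<phi> x) x - \<eta> x * partials i \<phi> x)"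
      by (intro smooth_diff smooth_mult smooth_partials \<eta> test_smooth[OF \<phi>])
    then have m: "(\<lambda>x. partials i (\<lambda>x. \<eta> x * \<phi> x) x - \<eta> x * partials i \<phi> x) \<in> borel_measurable ?M"
      by (intro cont_borel_lebesgue_on smooth_continuous)
    have "nrm ?M (\<lambda>x. partials i (\<lambda>x. \<eta> x * \<phi> x) x - \<eta> x * partials i \<phi> x) \<le> nrm ?M (\<lambda>x. C * ?S x)"
    proof (rule nrm_mono(2)[OF sqint_cmult[OF S(1)] m])
      fix x assume "x \<in> space ?M"
      then have x: "x \<in> \<Omega>" by simp
      have "\<bar>partials i (\<lambda>x. \<eta> x * \<phi> x) x - \<eta> x * partials i \<phi> x\<bar> \<le> c i * ?S x"
        using c(2)[OF test_smooth[OF \<phi>] x, of i] i by (simp add: words_def)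
      also have "\<dots> \<le> C * ?S x" using C[OF i] by (intro mult_right_mono sum_nonneg) auto
      also have "\<dots> \<le> \<bar>C * ?S x\<bar>" by simp
      finally show "\<bar>partials i (\<lambda>x. \<eta> x * \<phi> x) x - \<eta> x * partials i \<phi> x\<bar> \<le> \<bar>C * ?S x\<bar>" .
    qed
    also have "\<dots> = C * nrm ?M ?S" using \<open>0 \<le> C\<close> by (simp add: nrm_cmult)
    also have "\<dots> \<le> C * (\<Sum>b\<in>words_lt m. nrm ?M (partials b \<phi>))"
      using S(2) \<open>0 \<le> C\<close> by (intro mult_left_mono) (simp_all add: sqint_abs(2))
    finally show "nrm ?M (\<lambda>x. partials i (\<lambda>x. \<eta> x * \<phi> x) x - \<eta> x * partials i \<phi> x)
      \<le> C * (\<Sum>b\<in>words_lt m. nrm ?M (partials b \<phi>))" .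
  qed
qed

text \<open>The four flat functions of the two coordinates vanish together exactly on the closed square with half side \<open>\<rho>\<close>
  around \<open>y\<close>. A point at distance \<open>4 \<rho>\<close> from \<open>y\<close> has a coordinate that differs from that of \<open>y\<close> by at least \<open>2 \<rho>\<close>.\<close>

lemma smooth_cutoff:
  fixes y :: plane
  assumes "0 < \<rho>"
  obtains \<eta> c where "smooth \<eta>" "0 < c" "\<And>x. 0 \<le> \<eta> x" "\<And>x. \<eta> x \<le> 4"
    "\<And>x. dist x y < \<rho> \<Longrightarrow> \<eta> x = 0" "\<And>x. 4 * \<rho> \<le> dist x y \<Longrightarrow> c \<le> \<eta> x"
proof -
  define g where "g k x = flat 0 1 (1 * x $ k + (- y $ k - \<rho>)) + flat 0 1 (- 1 * x $ k + (y $ k - \<rho>))" for k and x :: plane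
  have gs: "smooth (g k)" for k
    unfolding g_def[abs_def] by (intro smooth_add smooth_flat) auto
  have f: "0 \<le> flat 0 1 t" "flat 0 1 t \<le> 1" for t by (rule flat_0_bounds; simp)+
  have g0: "0 \<le> g k x" "g k x \<le> 2" for k x
    unfolding g_def using f[of "1 * x $ k + (- y $ k - \<rho>)"] f[of "- 1 * x $ k + (y $ k - \<rho>)"] by auto
  have gz: "g k x = 0" if "dist x y < \<rho>" for k x
  proof -
    have "\<bar>x $ k - y $ k\<bar> < \<rho>"
      using component_le_norm_cart[of "x - y" k] that by (simp add: dist_norm)
    then show ?thesis by (auto simp: g_def flat_def)
  qed
  have fl: "exp (- (1 / \<rho>)) \<le> flat 0 1 t" if "\<rho> \<le> t" for t
    using that assms by (auto simp: flat_def frac_le)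
  have gl: "exp (- (1 / \<rho>)) \<le> g k x" if "2 * \<rho> \<le> \<bar>x $ k - y $ k\<bar>" for k x
  proof (cases "x $ k \<ge> y $ k")
    case True
    then show ?thesis
      using that fl[of "1 * x $ k + (- y $ k - \<rho>)"] f(1)[of "- 1 * x $ k + (y $ k - \<rho>)"] by (simp add: g_def)
  next
    case False
    then show ?thesis
      using that fl[of "- 1 * x $ k + (y $ k - \<rho>)"] f(1)[of "1 * x $ k + (- y $ k - \<rho>)"] by (simp add: g_def)
  qed
  show ?thesis
  proof (rule that[of "\<lambda>x. g 1 x + g 2 x" "exp (- (1 / \<rho>))"])
    show "smooth (\<lambda>x. g 1 x + g 2 x)" by (intro smooth_add gs)
    show "0 \<le> g 1 x + g 2 x" "g 1 x + g 2 x \<le> 4" for x using g0[of 1 x] g0[of 2 x] by auto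
    show "dist x y < \<rho> \<Longrightarrow> g 1 x + g 2 x = 0" for x using gz by simp
    fix x assume "4 * \<rho> \<le> dist x y"
    moreover have "dist x y \<le> \<bar>x $ 1 - y $ 1\<bar> + \<bar>x $ 2 - y $ 2\<bar>"
      using norm_le_l1_cart[of "x - y"] by (simp add: dist_norm UNIV_2)
    ultimately have "2 * \<rho> \<le> \<bar>x $ 1 - y $ 1\<bar> \<or> 2 * \<rho> \<le> \<bar>x $ 2 - y $ 2\<bar>" by linarith
    then show "exp (- (1 / \<rho>)) \<le> g 1 x + g 2 x"
    proof
      assume "2 * \<rho> \<le> \<bar>x $ 1 - y $ 1\<bar>"
      from gl[OF this] g0(1)[of 2 x] show ?thesis by linarith
    next
      assume "2 * \<rho> \<le> \<bar>x $ 2 - y $ 2\<bar>"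
      from gl[OF this] g0(1)[of 1 x] show ?thesis by linarith
    qed
  qed simp
qed

section \<open>Approximation of functions with zero boundary values\<close>

text \<open>Convergence in the Sobolev norm controls each weak derivative separately.\<close>

lemma Hm_norm_ge:
  assumes "length b \<le> m"
  shows "nrm (lebesgue_on \<Omega>) (weak_partial \<Omega> b w) \<le> Hm_norm m \<Omega> w"
proof -
  have "(nrm (lebesgue_on \<Omega>) (weak_partial \<Omega> b w))\<^sup>2
      \<le> (\<Sum>i\<in>words (length b). LINT x|lebesgue_on \<Omega>. (weak_partial \<Omega> i w x)\<^sup>2)"
    unfolding nrm_sq by (rule member_le_sum[of b]) (auto simp: words_def finite_words[unfolded words_def])
  also have "\<dots> \<le> (\<Sum>k\<le>m. \<Sum>i\<in>words k. LINT x|lebesgue_on \<Omega>. (weak_partial \<Omega> i w x)\<^sup>2)"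
    by (rule member_le_sum[of "length b"]) (use assms in \<open>auto intro!: sum_nonneg\<close>)
  finally show ?thesis unfolding Hm_norm_def by (simp add: real_le_rsqrt)
qed

lemma Hm0_Hm: "w \<in> Hm0 m \<Omega> \<Longrightarrow> w \<in> Hm m \<Omega>"
  by (simp add: Hm0_def)

lemma Hm0_approx:
  assumes \<Omega>: "open \<Omega>" "bounded \<Omega>" and w: "w \<in> Hm0 m \<Omega>" and e: "0 < e"
  obtains \<psi> where "test_function \<Omega> \<psi>"
    "\<And>b. length b \<le> m \<Longrightarrow> nrm (lebesgue_on \<Omega>) (\<lambda>x. weak_partial \<Omega> b w x - partials b \<psi> x) < e"
proof -
  obtain \<phi> where \<phi>: "\<And>n. test_function \<Omega> (\<phi> n)" "(\<lambda>n. Hm_norm m \<Omega> (\<lambda>x. w x - \<phi> n x)) \<longlonglongrightarrow> 0"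
    using w by (auto simp: Hm0_def)
  obtain n where n: "Hm_norm m \<Omega> (\<lambda>x. w x - \<phi> n x) < e"
    using order_tendstoD(2)[OF \<phi>(2) e] by (auto simp: eventually_sequentially)
  show ?thesis
  proof (rule that[OF \<phi>(1)[of n]])
    fix b :: word2 assume b: "length b \<le> m"
    note s = test_smooth[OF \<phi>(1)[of n]]
    note H = Hm0_Hm[OF w] Hm_smooth[OF \<Omega> s, of m]
    have "AE x in lebesgue_on \<Omega>. weak_partial \<Omega> b (\<lambda>x. w x - \<phi> n x) x = weak_partial \<Omega> b w x - partials b (\<phi> n) x"
      using weak_partial_diff_AE(2)[OF \<Omega> H b] weak_partial_smooth_AE[OF \<Omega> s, of b] by eventually_elim simp
    moreover have "weak_partial \<Omega> b (\<lambda>x. w x - \<phi> n x) \<in> borel_measurable (lebesgue_on \<Omega>)"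
      using Hm_weak_partial(2)[OF weak_partial_diff_AE(1)[OF \<Omega> H b] b] by (simp add: sqint_def)
    moreover have "(\<lambda>x. weak_partial \<Omega> b w x - partials b (\<phi> n) x) \<in> borel_measurable (lebesgue_on \<Omega>)"
      using sqint_diff[OF Hm_weak_partial(2)[OF H(1) b] sqint_test[OF \<phi>(1)[of n] \<Omega>(2,1), of b]] by (simp add: sqint_def)
    ultimately have "nrm (lebesgue_on \<Omega>) (\<lambda>x. weak_partial \<Omega> b w x - partials b (\<phi> n) x)
       = nrm (lebesgue_on \<Omega>) (weak_partial \<Omega> b (\<lambda>x. w x - \<phi> n x))"
      by (intro nrm_cong_AE[symmetric])
    then show "nrm (lebesgue_on \<Omega>) (\<lambda>x. weak_partial \<Omega> b w x - partials b (\<phi> n) x) < e"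
      using Hm_norm_ge[OF b, of \<Omega> "\<lambda>x. w x - \<phi> n x"] n by simp
  qed
qed

lemma test_in_Hm0:
  assumes "open \<Omega>" "bounded \<Omega>" "test_function \<Omega> \<phi>"
  shows "\<phi> \<in> Hm0 m \<Omega>"
proof -
  have "nrm (lebesgue_on \<Omega>) (weak_partial \<Omega> i (\<lambda>x. 0)) = 0" for i
  proof -
    have "nrm (lebesgue_on \<Omega>) (weak_partial \<Omega> i (\<lambda>x. 0)) = nrm (lebesgue_on \<Omega>) (partials i (\<lambda>x. 0))"
      using weak_partial_smooth_AE[OF assms(1,2) smooth_const[of 0]] Hm_weak_partial(2)[OF Hm_smooth[OF assms(1,2) smooth_const[of 0]] order_refl]
      by (intro nrm_cong_AE) (auto simp: sqint_def)
    then show ?thesis by (simp add: nrm_def)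
  qed
  then have "(LINT x|lebesgue_on \<Omega>. (weak_partial \<Omega> i (\<lambda>x. 0) x)\<^sup>2) = 0" for i
    using nrm_sq[of "lebesgue_on \<Omega>" "weak_partial \<Omega> i (\<lambda>x. 0)"] by simp
  then have "Hm_norm m \<Omega> (\<lambda>x. \<phi> x - \<phi> x) = 0" by (simp add: Hm_norm_def)
  then show ?thesis
    using Hm_smooth[OF assms(1,2) test_smooth[OF assms(3)]] assms(3)
    by (auto simp: Hm0_def intro!: exI[of _ "\<lambda>_. \<phi>"])
qed

section \<open>The corrector\<close>

definition restr :: "'a set \<Rightarrow> ('i \<Rightarrow> 'a \<Rightarrow> real) \<Rightarrow> 'i \<Rightarrow> 'a \<Rightarrow> real" where
  "restr A X = (\<lambda>i x. indicator A x * X i x)"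

text \<open>This form makes measurability, and the change of the coefficient on a set, a matter of linearity.\<close>

lemma two_phase_alt: "two_phase \<kappa> A x = 1 - (1 - \<kappa>) * indicator A x"
  by (simp add: two_phase_def)

locale bounded_domain =
  fixes \<Omega> :: "plane set" and m :: nat
  assumes open_domain: "open \<Omega>" and bounded_domain: "bounded \<Omega>"
begin

abbreviation "M \<equiv> lebesgue_on \<Omega>"
abbreviation "W \<equiv> words m"
abbreviation "D u \<equiv> (\<lambda>i. weak_partial \<Omega> i u)"
abbreviation "P \<phi> \<equiv> (\<lambda>i. partials i \<phi>)"

lemma domain_lebesgue: "\<Omega> \<in> sets lebesgue"
  using open_domain by auto

lemma tsqint_D: "w \<in> Hm m \<Omega> \<Longrightarrow> tsqint W M (D w)"
  using Hm_weak_partial(2)[of w m \<Omega>] by (auto simp: tsqint_def words_def)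

lemma tsqint_P: "test_function \<Omega> \<phi> \<Longrightarrow> tsqint W M (P \<phi>)"
  using sqint_test[OF _ bounded_domain open_domain] by (auto simp: tsqint_def)

lemma indicator_measurable_M:
  "A \<in> sets lebesgue \<Longrightarrow> (indicator A :: plane \<Rightarrow> real) \<in> borel_measurable M"
  by (rule measurable_restrict_space1[OF borel_measurable_indicator])

lemma bdd_coeff_indicator: "A \<in> sets lebesgue \<Longrightarrow> bdd_coeff M 1 (indicator A)"
  using indicator_measurable_M by (auto simp: bdd_coeff_def indicator_def)

lemma bdd_coeff_one: "bdd_coeff M 1 (\<lambda>_. 1)"
  by (simp add: bdd_coeff_def)

lemma bdd_coeff_two_phase: "A \<in> sets lebesgue \<Longrightarrow> 0 < \<kappa> \<Longrightarrow> \<kappa> < 1 \<Longrightarrow> bdd_coeff M 1 (two_phase \<kappa> A)"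
proof -
  assume "A \<in> sets lebesgue" "0 < \<kappa>" "\<kappa> < 1"
  moreover from this have "two_phase \<kappa> A \<in> borel_measurable M"
    unfolding two_phase_alt[abs_def]
    by (intro borel_measurable_diff borel_measurable_times borel_measurable_const indicator_measurable_M)
  ultimately show ?thesis by (auto simp: bdd_coeff_def two_phase_def)
qed

lemma tform_one_split:
  assumes "A \<in> sets lebesgue" "0 < \<kappa>" "\<kappa> < 1" "tsqint W M X" "tsqint W M Y"
  shows "tform W M (\<lambda>_. 1) X Y = tform W M (two_phase \<kappa> A) X Y + (1 - \<kappa>) * tform W M (indicator A) X Y"
proof -
  have c: "bdd_coeff M (1 - \<kappa>) (\<lambda>x. (1 - \<kappa>) * indicator A x)"
    unfolding bdd_coeff_def using assms(2,3)
    by (intro conjI borel_measurable_times borel_measurable_const indicator_measurable_M assms(1))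
      (auto simp: indicator_def)
  have e: "(\<lambda>_. 1) = (\<lambda>x. two_phase \<kappa> A x + (1 - \<kappa>) * indicator A x)"
    by (auto simp: two_phase_alt)
  show ?thesis
    by (subst e, subst tform_add_coeff[OF bdd_coeff_two_phase[OF assms(1-3)] c assms(4,5)])
      (simp add: tform_cmult_coeff)
qed

lemma tsqint_restr:
  assumes "A \<in> sets lebesgue" "tsqint W M X"
  shows "tsqint W M (restr A X)"
  unfolding tsqint_def restr_def
proof
  fix i assume "i \<in> W"
  then have "sqint M (X i)" using assms(2) by (simp add: tsqint_def)
  then show "sqint M (\<lambda>x. indicator A x * X i x)"
    by (rule sqint_bounded_mult[OF _ indicator_measurable_M[OF assms(1)], of _ 1]) (simp add: indicator_def)
qed

lemma tform_indicator: "tform W M (indicator A) X Y = tform W M (\<lambda>_. 1) (restr A X) Y"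
  by (simp add: tform_def restr_def mult.assoc)

lemma tform_indicator_bound:
  assumes "A \<in> sets lebesgue" "tsqint W M X" "tsqint W M Y"
  shows "\<bar>tform W M (indicator A) X Y\<bar> \<le> tnrm W M (restr A X) * tnrm W M Y"
  using tform_bound[OF bdd_coeff_one tsqint_restr[OF assms(1,2)] assms(3)] by (simp add: tform_indicator)

lemma restr_bounded:
  assumes A: "A \<in> sets lebesgue" "A \<subseteq> \<Omega>" and X: "tsqint W M X"
    and B: "\<And>i x. i \<in> W \<Longrightarrow> x \<in> A \<Longrightarrow> \<bar>X i x\<bar> \<le> B" "0 \<le> B"
  shows "tnrm W M (restr A X) \<le> real (card W) * B * sqrt (measure lebesgue A)"
proof -
  have "tnrm W M (restr A X) \<le> (\<Sum>i\<in>W. nrm M (restr A X i))" by (rule tnrm_le_sum)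
  also have "\<dots> \<le> (\<Sum>i\<in>W. B * sqrt (measure lebesgue A))"
    unfolding restr_def using X B
    by (intro sum_mono nrm_on_small_set(2)[OF open_domain bounded_domain A]) (auto simp: tsqint_def sqint_def)
  finally show ?thesis by simp
qed

lemma tsqint_const: "tsqint W M (\<lambda>i _. T i)"
  using sqint_const[OF bounded_domain open_domain] by (simp add: tsqint_def)

lemma Hm0_approx_tnrm:
  assumes w: "w \<in> Hm0 m \<Omega>" and e: "0 < e"
  obtains \<psi> where "test_function \<Omega> \<psi>" "tnrm W M (\<lambda>i x. D w i x - P \<psi> i x) < e"
    "\<And>b. length b \<le> m \<Longrightarrow> nrm M (\<lambda>x. weak_partial \<Omega> b w x - partials b \<psi> x) < e"
proof -
  let ?e = "e / (real (card W) + 1)"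
  have e': "0 < ?e" "?e \<le> e" using e by (auto simp: field_simps)
  obtain \<psi> where \<psi>: "test_function \<Omega> \<psi>"
    "\<And>b. length b \<le> m \<Longrightarrow> nrm M (\<lambda>x. weak_partial \<Omega> b w x - partials b \<psi> x) < ?e"
    using Hm0_approx[OF open_domain bounded_domain w e'(1)] by blast
  have "tnrm W M (\<lambda>i x. D w i x - P \<psi> i x) \<le> (\<Sum>i\<in>W. nrm M (\<lambda>x. D w i x - P \<psi> i x))"
    by (rule tnrm_le_sum)
  also have "\<dots> \<le> (\<Sum>i\<in>W. ?e)"
    by (rule sum_mono, rule less_imp_le, rule \<psi>(2)) (simp add: words_def)
  also have "\<dots> < e" using e by (simp add: field_simps)
  finally show ?thesis using \<psi> e'(2) by (intro that[of \<psi>]) (auto intro: less_le_trans)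
qed

lemma tform_D_P:
  assumes "bdd_coeff M B w" "tsqint W M X" "test_function \<Omega> \<phi>"
  shows "tform W M w X (D \<phi>) = tform W M w X (P \<phi>)"
proof (rule tform_cong_AE)
  have H: "\<phi> \<in> Hm m \<Omega>" by (rule Hm_smooth[OF open_domain bounded_domain test_smooth[OF assms(3)]])
  show "AE x in M. D \<phi> i x = P \<phi> i x" for i
    by (rule weak_partial_smooth_AE[OF open_domain bounded_domain test_smooth[OF assms(3)]])
  show "tsqint W M (D \<phi>)" by (rule tsqint_D[OF H])
  show "tsqint W M (P \<phi>)" by (rule tsqint_P[OF assms(3)])
qed (use assms in \<open>auto simp: bdd_coeff_def\<close>)

text \<open>For a test function the derivatives have integral zero; density extends this to all functions with
  zero boundary values.\<close>

lemma integral_const_grad_zero: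
  assumes "w \<in> Hm0 m \<Omega>" "0 < m"
  shows "tform W M (\<lambda>_. 1) (\<lambda>i _. T i) (D w) = 0"
proof (rule ccontr)
  let ?T = "\<lambda>(i::word2) (_::plane). T i"
  assume "tform W M (\<lambda>_. 1) ?T (D w) \<noteq> 0"
  then have a: "0 < \<bar>tform W M (\<lambda>_. 1) ?T (D w)\<bar>" (is "0 < ?a") by simp
  let ?e = "?a / (tnrm W M ?T + 1)"
  have e: "0 < ?e" using a by (intro divide_pos_pos) (auto intro: add_nonneg_pos)
  obtain \<psi> where \<psi>: "test_function \<Omega> \<psi>" "tnrm W M (\<lambda>i x. D w i x - P \<psi> i x) < ?e"
    using Hm0_approx_tnrm[OF assms(1) e] by blast
  note tD = tsqint_D[OF Hm0_Hm[OF assms(1)]] and tP = tsqint_P[OF \<psi>(1)]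
  have "tform W M (\<lambda>_. 1) ?T (P \<psi>) = 0"
    unfolding tform_def
  proof (rule sum.neutral, rule ballI)
    fix i assume "i \<in> W"
    then have "i \<noteq> []" using assms(2) by (auto simp: words_def)
    then show "(LINT x|M. 1 * (T i * partials i \<psi> x)) = 0"
      using integral_test_partials_zero[OF open_domain \<psi>(1)] by simp
  qed
  then have "?a = \<bar>tform W M (\<lambda>_. 1) ?T (\<lambda>i x. D w i x - P \<psi> i x)\<bar>"
    using tform_diff_right[OF bdd_coeff_one tsqint_const tD tP] by simp
  also have "\<dots> \<le> 1 * (tnrm W M ?T * tnrm W M (\<lambda>i x. D w i x - P \<psi> i x))"
    by (rule tform_bound[OF bdd_coeff_one tsqint_const tsqint_diff[OF tD tP]])
  also have "\<dots> \<le> tnrm W M ?T * ?e"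
    unfolding mult_1 by (rule mult_left_mono[OF less_imp_le[OF \<psi>(2)]]) simp
  also have "\<dots> < ?a"
  proof -
    have "tnrm W M ?T * ?a < ?a * (tnrm W M ?T + 1)" using a by (simp add: algebra_simps)
    moreover have "0 < tnrm W M ?T + 1" by (rule add_nonneg_pos) auto
    ultimately show ?thesis by (simp add: pos_divide_less_eq)
  qed
  finally show False by simp
qed

text \<open>Coercivity against a right-hand side supported in \<open>A\<close>, whose norm is at most a constant times \<open>|A|\<^sup>1\<^sup>/\<^sup>2\<close>.\<close>

lemma corrector_energy:
  assumes \<kappa>: "0 < \<kappa>" "\<kappa> < 1" and A: "A \<in> sets lebesgue" "A \<subseteq> \<Omega>" and s: "s \<in> Hm0 m \<Omega>"
    and eq: "tform W M (two_phase \<kappa> A) (D s) (D s) = (1 - \<kappa>) * tform W M (indicator A) (\<lambda>i _. T i) (D s)"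
    and B: "\<And>i. i \<in> W \<Longrightarrow> \<bar>T i\<bar> \<le> B" "0 \<le> B"
  shows "tnrm W M (D s) \<le> real (card W) * B / \<kappa> * sqrt (measure lebesgue A)"
proof -
  let ?n = "tnrm W M (D s)" and ?c = "real (card W) * B * sqrt (measure lebesgue A)"
  note tD = tsqint_D[OF Hm0_Hm[OF s]]
  have "\<kappa> * ?n\<^sup>2 \<le> tform W M (two_phase \<kappa> A) (D s) (D s)"
    by (rule tform_lower[OF bdd_coeff_two_phase[OF A(1) \<kappa>] _ tD]) (use \<kappa> in \<open>auto simp: two_phase_def\<close>)
  also have "\<dots> \<le> \<bar>tform W M (indicator A) (\<lambda>i _. T i) (D s)\<bar>" (is "_ \<le> \<bar>?x\<bar>")
  proof -
    have "(1 - \<kappa>) * ?x \<le> (1 - \<kappa>) * \<bar>?x\<bar>" using \<kappa> by (intro mult_left_mono) auto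
    also have "\<dots> \<le> \<bar>?x\<bar>" using \<kappa> by (intro mult_left_le_one_le) auto
    finally show ?thesis by (simp only: eq)
  qed
  also have "\<dots> \<le> tnrm W M (restr A (\<lambda>i _. T i)) * ?n"
    by (rule tform_indicator_bound[OF A(1) tsqint_const tD])
  also have "\<dots> \<le> ?c * ?n"
    by (intro mult_right_mono restr_bounded[OF A tsqint_const] B) auto
  finally have "?n * (\<kappa> * ?n) \<le> ?n * ?c" by (simp add: power2_eq_square mult_ac)
  moreover have "0 \<le> ?c" using B by simp
  ultimately have "\<kappa> * ?n \<le> ?c"
    using tnrm_nonneg[of W M "D s"] \<kappa> by (cases "?n = 0") auto
  then show ?thesis using \<kappa> by (simp add: field_simps)
qed

text \<open>The corrector is normalised by \<open>|A n|\<^sup>1\<^sup>/\<^sup>2\<close> and replaced by nearby test functions. Against a fixed test function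
  \<open>\<phi>\<close> its equation only sees \<open>D \<phi>\<close> on \<open>A n\<close>, which is of size \<open>|A n|\<^sup>1\<^sup>/\<^sup>2\<close>; so the approximations tend weakly to zero and
  \<open>compactness_test\<close> applies. For the second claim the equation is tested with the product of the approximation and a cut-off
  that vanishes near \<open>y\<close>, hence on \<open>A n\<close> for large \<open>n\<close>: the right-hand side disappears and the commutator contains only lower derivatives.\<close>

lemma corrector_vanishes:
  fixes s :: "nat \<Rightarrow> plane \<Rightarrow> real" and A :: "nat \<Rightarrow> plane set" and T :: tensor
  defines "\<mu> \<equiv> \<lambda>n. measure lebesgue (A n)"
  assumes m: "2 \<le> m" and \<kappa>: "0 < \<kappa>" "\<kappa> < 1"
    and A: "\<And>n. A n \<in> sets lebesgue" "\<And>n. A n \<subseteq> \<Omega>" "\<And>n. 0 < \<mu> n" "\<mu> \<longlonglongrightarrow> 0"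
    and small: "\<And>\<rho>. 0 < \<rho> \<Longrightarrow> \<forall>\<^sub>F n in sequentially. A n \<subseteq> ball y \<rho>"
    and s: "\<And>n. s n \<in> Hm0 m \<Omega>"
    and eq: "\<And>n \<phi>. \<phi> \<in> Hm0 m \<Omega> \<Longrightarrow> tform W M (two_phase \<kappa> (A n)) (D (s n)) (D \<phi>)
       = (1 - \<kappa>) * tform W M (indicator (A n)) (\<lambda>i _. T i) (D \<phi>)"
  shows "(\<lambda>n. nrm M (s n) / sqrt (\<mu> n)) \<longlonglongrightarrow> 0"
    and "\<And>K \<rho>. K \<in> sets lebesgue \<Longrightarrow> 0 < \<rho> \<Longrightarrow> (\<And>x. x \<in> K \<Longrightarrow> 4 * \<rho> \<le> dist x y) \<Longrightarrow>
       (\<lambda>n. tnrm W M (restr K (D (s n))) / sqrt (\<mu> n)) \<longlonglongrightarrow> 0"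
proof -
  define B where "B = (\<Sum>i\<in>W. \<bar>T i\<bar>)"
  have B: "\<bar>T i\<bar> \<le> B" if "i \<in> W" for i
    unfolding B_def using that by (intro member_le_sum) auto
  have B0: "0 \<le> B" by (simp add: B_def sum_nonneg)
  define C where "C = real (card W) * B / \<kappa>"
  have C: "0 \<le> C" using B0 \<kappa> by (simp add: C_def)
  have sH: "s n \<in> Hm m \<Omega>" for n by (rule Hm0_Hm[OF s])
  note tD = tsqint_D[OF sH]
  have en: "tnrm W M (D (s n)) \<le> C * sqrt (\<mu> n)" for n
    unfolding C_def \<mu>_def by (rule corrector_energy[OF \<kappa> A(1,2) s eq[OF s] B B0])
  have r: "0 < sqrt (\<mu> n)" for n using A(3) by simp
  define S where "S n = (\<lambda>b x. inverse (sqrt (\<mu> n)) * weak_partial \<Omega> b (s n) x)" for n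
  have tS: "tsqint W M (S n)" for n unfolding S_def by (rule tsqint_cmult[OF tD])
  have nS: "tnrm W M (S n) \<le> C" for n
    unfolding S_def tnrm_cmult using en[of n] r[of n] by (simp add: field_simps)
  have "\<exists>\<psi>. test_function \<Omega> \<psi> \<and> tnrm W M (\<lambda>i x. S n i x - P \<psi> i x) \<le> inverse (real (Suc n)) \<and>
     (\<forall>b. length b \<le> m \<longrightarrow> nrm M (\<lambda>x. S n b x - partials b \<psi> x) \<le> inverse (real (Suc n)))" for n
  proof -
    let ?q = "sqrt (\<mu> n)"
    have q: "0 < ?q * inverse (real (Suc n))" using r[of n] by simp
    obtain \<psi> where \<psi>: "test_function \<Omega> \<psi>" "tnrm W M (\<lambda>i x. D (s n) i x - P \<psi> i x) < ?q * inverse (real (Suc n))"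
      "\<And>b. length b \<le> m \<Longrightarrow> nrm M (\<lambda>x. weak_partial \<Omega> b (s n) x - partials b \<psi> x) < ?q * inverse (real (Suc n))"
      using Hm0_approx_tnrm[OF s[of n] q] by blast
    let ?\<psi> = "\<lambda>x. inverse ?q * \<psi> x"
    have p: "partials b ?\<psi> = (\<lambda>x. inverse ?q * partials b \<psi> x)" for b
      by (rule partials_cmult[OF test_smooth[OF \<psi>(1)]])
    have 1: "(\<lambda>x. S n b x - partials b ?\<psi> x) = (\<lambda>x. inverse ?q * (weak_partial \<Omega> b (s n) x - partials b \<psi> x))" for b
      by (simp add: S_def p right_diff_distrib)
    have "tnrm W M (\<lambda>i x. S n i x - P ?\<psi> i x) = inverse ?q * tnrm W M (\<lambda>i x. D (s n) i x - P \<psi> i x)"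
      unfolding 1 using r[of n] by (simp add: tnrm_cmult)
    also have "\<dots> \<le> inverse (real (Suc n))" using \<psi>(2) r[of n] by (simp add: field_simps)
    finally have 2: "tnrm W M (\<lambda>i x. S n i x - P ?\<psi> i x) \<le> inverse (real (Suc n))" .
    have 3: "nrm M (\<lambda>x. S n b x - partials b ?\<psi> x) \<le> inverse (real (Suc n))" if "length b \<le> m" for b
      unfolding 1 nrm_cmult using \<psi>(3)[OF that] r[of n] by (simp add: field_simps)
    show ?thesis using test_cmult[OF \<psi>(1), of "inverse ?q"] 2 3 by blast
  qed
  then have "\<forall>n. \<exists>\<psi>. test_function \<Omega> \<psi> \<and> tnrm W M (\<lambda>i x. S n i x - P \<psi> i x) \<le> inverse (real (Suc n)) \<and>
     (\<forall>b. length b \<le> m \<longrightarrow> nrm M (\<lambda>x. S n b x - partials b \<psi> x) \<le> inverse (real (Suc n)))" by blast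
  from choice[OF this] obtain \<psi> where \<psi>': "\<forall>n. test_function \<Omega> (\<psi> n) \<and> tnrm W M (\<lambda>i x. S n i x - P (\<psi> n) i x) \<le> inverse (real (Suc n)) \<and>
     (\<forall>b. length b \<le> m \<longrightarrow> nrm M (\<lambda>x. S n b x - partials b (\<psi> n) x) \<le> inverse (real (Suc n)))" ..
  have \<psi>: "test_function \<Omega> (\<psi> n)" "tnrm W M (\<lambda>i x. S n i x - P (\<psi> n) i x) \<le> inverse (real (Suc n))"
    and \<psi>b: "\<And>b. length b \<le> m \<Longrightarrow> nrm M (\<lambda>x. S n b x - partials b (\<psi> n) x) \<le> inverse (real (Suc n))" for n
    using \<psi>'[rule_format, of n] by blast+
  note tP = tsqint_P[OF \<psi>(1)]
  note tdiff = tsqint_diff[OF tS tP]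
  have diff0: "(\<lambda>n. tnrm W M (\<lambda>i x. S n i x - P (\<psi> n) i x)) \<longlonglongrightarrow> 0"
    by (rule tendsto_sandwich[OF _ _ tendsto_const LIMSEQ_inverse_real_of_nat])
      (use \<psi>(2) in \<open>auto intro!: always_eventually\<close>)
  have n\<psi>: "tnrm W M (P (\<psi> n)) \<le> C + 1" for n
  proof -
    have "tnrm W M (\<lambda>i x. S n i x - (S n i x - P (\<psi> n) i x)) \<le> tnrm W M (S n) + tnrm W M (\<lambda>i x. S n i x - P (\<psi> n) i x)"
      by (rule tnrm_triangle_diff[OF tS tdiff])
    also have "\<dots> \<le> C + 1"
      using nS[of n] \<psi>(2)[of n] inverse_le_1_iff[of "real (Suc n)"] by (intro add_mono) auto
    finally show ?thesis by simp
  qed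
  have weak: "(\<lambda>n. tform W M (\<lambda>_. 1) (P \<phi>) (P (\<psi> n))) \<longlonglongrightarrow> 0" if \<phi>: "test_function \<Omega> \<phi>" for \<phi>
  proof -
    note t\<phi> = tsqint_P[OF \<phi>]
    have "\<forall>i. \<exists>c. 0 \<le> c \<and> (\<forall>x. \<bar>partials i \<phi> x\<bar> \<le> c)" using test_bounded[OF \<phi>] by metis
    from choice[OF this] obtain c where c: "\<forall>i. 0 \<le> c i \<and> (\<forall>x. \<bar>partials i \<phi> x\<bar> \<le> c i)" ..
    define b where "b = (\<Sum>i\<in>W. c i)"
    have b: "0 \<le> b" "\<And>i x. i \<in> W \<Longrightarrow> \<bar>partials i \<phi> x\<bar> \<le> b"
    proof -
      show "0 \<le> b" using c by (auto simp: b_def intro: sum_nonneg)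
      fix i x assume "i \<in> W"
      then have "c i \<le> b" unfolding b_def using c by (intro member_le_sum) auto
      then show "\<bar>partials i \<phi> x\<bar> \<le> b" using c order_trans by blast
    qed
    let ?b = "real (card W) * b"
    have res: "tnrm W M (restr (A n) (P \<phi>)) \<le> ?b * sqrt (\<mu> n)" for n
      unfolding \<mu>_def by (rule restr_bounded[OF A(1,2) t\<phi> b(2,1)])
    \<comment> \<open>both the source and the corrector enter through the norm of \<open>D \<phi>\<close> on \<open>A n\<close>\<close>
    have small_S: "\<bar>tform W M (\<lambda>_. 1) (P \<phi>) (S n)\<bar> \<le> (?b * (real (card W) * B + C)) * sqrt (\<mu> n)" for n
    proof -
      have "tform W M (\<lambda>_. 1) (D (s n)) (P \<phi>)
        = tform W M (two_phase \<kappa> (A n)) (D (s n)) (P \<phi>) + (1 - \<kappa>) * tform W M (indicator (A n)) (D (s n)) (P \<phi>)"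
        by (rule tform_one_split[OF A(1) \<kappa> tD t\<phi>])
      also have "tform W M (two_phase \<kappa> (A n)) (D (s n)) (P \<phi>) = (1 - \<kappa>) * tform W M (indicator (A n)) (\<lambda>i _. T i) (P \<phi>)"
        using eq[OF test_in_Hm0[OF open_domain bounded_domain \<phi>], of n]
        by (simp add: tform_D_P[OF bdd_coeff_two_phase[OF A(1) \<kappa>] tD \<phi>]
            tform_D_P[OF bdd_coeff_indicator[OF A(1)] tsqint_const \<phi>])
      finally have e: "tform W M (\<lambda>_. 1) (D (s n)) (P \<phi>)
        = (1 - \<kappa>) * (tform W M (indicator (A n)) (\<lambda>i _. T i) (P \<phi>) + tform W M (indicator (A n)) (D (s n)) (P \<phi>))"
        by (simp add: distrib_left)
      have 1: "\<bar>tform W M (indicator (A n)) X (P \<phi>)\<bar> \<le> tnrm W M (restr (A n) (P \<phi>)) * tnrm W M X" if "tsqint W M X" for X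
        using tform_indicator_bound[OF A(1)[of n] t\<phi> that] by (simp add: tform_commute)
      have 2: "\<bar>tform W M (indicator (A n)) (\<lambda>i _. T i) (P \<phi>)\<bar> \<le> (real (card W) * B * sqrt (\<mu> n)) * (?b * sqrt (\<mu> n))"
      proof -
        have "tform W M (indicator (A n)) (\<lambda>i _. T i) (P \<phi>) = tform W M (\<lambda>_. 1) (restr (A n) (\<lambda>i _. T i)) (restr (A n) (P \<phi>))"
          unfolding tform_def restr_def
          by (intro sum.cong refl Bochner_Integration.integral_cong) (auto simp: indicator_def)
        then have "\<bar>tform W M (indicator (A n)) (\<lambda>i _. T i) (P \<phi>)\<bar>
           \<le> 1 * (tnrm W M (restr (A n) (\<lambda>i _. T i)) * tnrm W M (restr (A n) (P \<phi>)))"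
          using tform_bound[OF bdd_coeff_one tsqint_restr[OF A(1) tsqint_const] tsqint_restr[OF A(1) t\<phi>], of n T n] by simp
        also have "\<dots> \<le> 1 * ((real (card W) * B * sqrt (\<mu> n)) * (?b * sqrt (\<mu> n)))"
          using res[of n] restr_bounded[OF A(1,2) tsqint_const B B0, of n] b(1) B0
          by (intro mult_left_mono mult_mono) (auto simp: \<mu>_def)
        finally show ?thesis by simp
      qed
      have 3: "\<bar>tform W M (indicator (A n)) (D (s n)) (P \<phi>)\<bar> \<le> (?b * sqrt (\<mu> n)) * (C * sqrt (\<mu> n))"
        by (rule order_trans[OF 1[OF tD] mult_mono[OF res en]]) (use b r[of n] in auto)
      have "\<bar>tform W M (\<lambda>_. 1) (D (s n)) (P \<phi>)\<bar>
          \<le> \<bar>tform W M (indicator (A n)) (\<lambda>i _. T i) (P \<phi>) + tform W M (indicator (A n)) (D (s n)) (P \<phi>)\<bar>"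
        unfolding e abs_mult using \<kappa> by (intro mult_left_le_one_le) auto
      also have "\<dots> \<le> (real (card W) * B * sqrt (\<mu> n)) * (?b * sqrt (\<mu> n)) + (?b * sqrt (\<mu> n)) * (C * sqrt (\<mu> n))"
        using 2 3 by linarith
      also have "\<dots> = (?b * (real (card W) * B + C)) * sqrt (\<mu> n) * sqrt (\<mu> n)"
        by (simp only: distrib_left distrib_right mult_ac)
      finally have "\<bar>tform W M (\<lambda>_. 1) (D (s n)) (P \<phi>)\<bar> \<le> (?b * (real (card W) * B + C)) * sqrt (\<mu> n) * sqrt (\<mu> n)" .
      moreover have "tform W M (\<lambda>_. 1) (P \<phi>) (S n) = inverse (sqrt (\<mu> n)) * tform W M (\<lambda>_. 1) (D (s n)) (P \<phi>)"
        unfolding S_def by (simp add: tform_cmult_right tform_commute)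
      ultimately show ?thesis using r[of n] by (simp add: abs_mult divide_le_eq divide_inverse_commute[symmetric])
    qed
    have "(\<lambda>n. sqrt (\<mu> n)) \<longlonglongrightarrow> sqrt 0" by (rule tendsto_real_sqrt[OF A(4)])
    then have "(\<lambda>n. (?b * (real (card W) * B + C)) * sqrt (\<mu> n)) \<longlonglongrightarrow> 0"
      using tendsto_mult_right_zero by fastforce
    then have l1: "(\<lambda>n. tform W M (\<lambda>_. 1) (P \<phi>) (S n)) \<longlonglongrightarrow> 0"
      by (rule Lim_null_comparison[rotated]) (use small_S in auto)
    have l2: "(\<lambda>n. tform W M (\<lambda>_. 1) (P \<phi>) (\<lambda>i x. S n i x - P (\<psi> n) i x)) \<longlonglongrightarrow> 0"
      by (rule tform_to_zero[OF bdd_coeff_one t\<phi> tdiff order_refl diff0])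
    have "tform W M (\<lambda>_. 1) (P \<phi>) (P (\<psi> n)) = tform W M (\<lambda>_. 1) (P \<phi>) (S n) - tform W M (\<lambda>_. 1) (P \<phi>) (\<lambda>i x. S n i x - P (\<psi> n) i x)" for n
      using tform_diff_right[OF bdd_coeff_one t\<phi> tS tP] by simp
    with tendsto_diff[OF l1 l2] show ?thesis by simp
  qed
  have low: "(\<lambda>n. nrm M (partials b (\<psi> n))) \<longlonglongrightarrow> 0" if "length b < m" for b
    by (rule compactness_test[OF open_domain bounded_domain m \<psi>(1) n\<psi> weak that])
  show "(\<lambda>n. nrm M (s n) / sqrt (\<mu> n)) \<longlonglongrightarrow> 0"
  proof (rule tendsto_sandwich[OF _ _ tendsto_const])
    have "nrm M (s n) / sqrt (\<mu> n) \<le> inverse (real (Suc n)) + nrm M (partials [] (\<psi> n))" for n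
    proof -
      have w: "sqint M (weak_partial \<Omega> [] (s n))" by (rule Hm_weak_partial(2)[OF sH]) simp
      have "nrm M (s n) = nrm M (weak_partial \<Omega> [] (s n))"
        using Hm_weak_partial_Nil[OF open_domain bounded_domain sH[of n]] Hm_sqint[OF sH[of n]] w
        by (intro nrm_cong_AE) (auto simp: sqint_def)
      then have "nrm M (s n) / sqrt (\<mu> n) = nrm M (S n [])"
        using r[of n] by (simp add: S_def nrm_cmult divide_inverse_commute)
      also have "\<dots> = nrm M (\<lambda>x. (S n [] x - partials [] (\<psi> n) x) + partials [] (\<psi> n) x)" by simp
      also have "\<dots> \<le> nrm M (\<lambda>x. S n [] x - partials [] (\<psi> n) x) + nrm M (partials [] (\<psi> n))"
        using w sqint_test[OF \<psi>(1)[of n] bounded_domain open_domain, of "[]"]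
        by (intro nrm_triangle sqint_diff) (auto simp: S_def sqint_cmult)
      also have "\<dots> \<le> inverse (real (Suc n)) + nrm M (partials [] (\<psi> n))"
        using \<psi>b[of "[]" n] by simp
      finally show ?thesis .
    qed
    then show "\<forall>\<^sub>F n in sequentially. nrm M (s n) / sqrt (\<mu> n) \<le> inverse (real (Suc n)) + nrm M (partials [] (\<psi> n))"
      by simp
    show "\<forall>\<^sub>F n in sequentially. 0 \<le> nrm M (s n) / sqrt (\<mu> n)"
      using r by (intro always_eventually allI divide_nonneg_nonneg) (auto intro: less_imp_le)
    show "(\<lambda>n. inverse (real (Suc n)) + nrm M (partials [] (\<psi> n))) \<longlonglongrightarrow> 0"
      using tendsto_add[OF LIMSEQ_inverse_real_of_nat low[of "[]"]] m by simp
  qed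
  fix K \<rho> assume K: "K \<in> sets lebesgue" and \<rho>: "0 < \<rho>" and far: "\<And>x. x \<in> K \<Longrightarrow> 4 * \<rho> \<le> dist x y"
  obtain \<eta> c where \<eta>: "smooth \<eta>" "0 < c" "\<And>x. 0 \<le> \<eta> x" "\<And>x. \<eta> x \<le> 4"
    "\<And>x. dist x y < \<rho> \<Longrightarrow> \<eta> x = 0" "\<And>x. 4 * \<rho> \<le> dist x y \<Longrightarrow> c \<le> \<eta> x"
    using smooth_cutoff[OF \<rho>, of y] by metis
  have m\<eta>: "\<eta> \<in> borel_measurable M" by (intro cont_borel_lebesgue_on smooth_continuous \<eta>(1))
  obtain C' where C': "0 \<le> C'" "\<And>\<phi> i. test_function \<Omega> \<phi> \<Longrightarrow> i \<in> W \<Longrightarrow>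
    nrm M (\<lambda>x. partials i (\<lambda>x. \<eta> x * \<phi> x) x - \<eta> x * partials i \<phi> x)
      \<le> C' * (\<Sum>b\<in>words_lt m. nrm M (partials b \<phi>))"
    using Leibniz_commutator_nrm[OF open_domain bounded_domain \<eta>(1), of m] by blast
  define g where "g n x = two_phase \<kappa> (A n) x * \<eta> x" for n x
  have cg: "bdd_coeff M 4 (g n)" for n
  proof -
    have t: "two_phase \<kappa> (A n) \<in> borel_measurable M"
      using bdd_coeff_two_phase[OF A(1) \<kappa>] by (auto simp: bdd_coeff_def)
    have "\<bar>g n x\<bar> \<le> 1 * 4" for x
      unfolding g_def abs_mult using \<eta>(3,4) \<kappa> by (intro mult_mono) (auto simp: two_phase_def)
    then show ?thesis using t m\<eta> by (auto simp: bdd_coeff_def g_def[abs_def] intro: borel_measurable_times)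
  qed
  let ?com = "\<lambda>n i x. partials i (\<lambda>x. \<eta> x * \<psi> n x) x - \<eta> x * partials i (\<psi> n) x"
  have t\<eta>\<psi>: "test_function \<Omega> (\<lambda>x. \<eta> x * \<psi> n x)" for n by (rule test_mult[OF \<eta>(1) \<psi>(1)])
  have tcom0: "tsqint W M (\<lambda>i x. \<eta> x * partials i (\<psi> n) x)" for n
    using tP[of n] unfolding tsqint_def
    by (auto intro!: sqint_bounded_mult[where B = 4] m\<eta> simp: \<eta>(3,4))
  have tcom: "tsqint W M (?com n)" for n
    by (rule tsqint_diff[OF tsqint_P[OF t\<eta>\<psi>] tcom0])
  have com0: "(\<lambda>n. tnrm W M (?com n)) \<longlonglongrightarrow> 0"
  proof (rule tendsto_sandwich[OF _ _ tendsto_const])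
    have "tnrm W M (?com n) \<le> real (card W) * (C' * (\<Sum>b\<in>words_lt m. nrm M (partials b (\<psi> n))))" for n
    proof -
      have "tnrm W M (?com n) \<le> (\<Sum>i\<in>W. nrm M (?com n i))" by (rule tnrm_le_sum)
      also have "\<dots> \<le> (\<Sum>i\<in>W. C' * (\<Sum>b\<in>words_lt m. nrm M (partials b (\<psi> n))))"
        by (intro sum_mono C'(2) \<psi>(1))
      finally show ?thesis by simp
    qed
    then show "\<forall>\<^sub>F n in sequentially. tnrm W M (?com n) \<le> real (card W) * (C' * (\<Sum>b\<in>words_lt m. nrm M (partials b (\<psi> n))))"
      by simp
    have "(\<lambda>n. \<Sum>b\<in>words_lt m. nrm M (partials b (\<psi> n))) \<longlonglongrightarrow> (\<Sum>b\<in>words_lt m. 0)"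
      by (intro tendsto_sum low) (simp add: words_lt_def)
    then show "(\<lambda>n. real (card W) * (C' * (\<Sum>b\<in>words_lt m. nrm M (partials b (\<psi> n))))) \<longlonglongrightarrow> 0"
      by (intro tendsto_mult_right_zero) simp
  qed simp
  \<comment> \<open>the cut-off vanishes on the ball that contains \<open>A n\<close>, so the right-hand side of the equation drops out\<close>
  have eq0: "\<forall>\<^sub>F n in sequentially. tform W M (g n) (S n) (P (\<psi> n)) = - tform W M (two_phase \<kappa> (A n)) (S n) (?com n)"
    using small[OF \<rho>]
  proof eventually_elim
    case (elim n)
    have z: "partials i (\<lambda>x. \<eta> x * \<psi> n x) x = 0" if "x \<in> A n" for i x
    proof -
      have "partials i (\<lambda>x. \<eta> x * \<psi> n x) x = partials i (\<lambda>x. 0) x"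
        by (rule partials_cong_open[OF open_ball[of y \<rho>]]) (use elim that \<eta>(5) in \<open>auto simp: dist_commute\<close>)
      then show ?thesis by simp
    qed
    have z': "tform W M (indicator (A n)) (\<lambda>i _. T i) (P (\<lambda>x. \<eta> x * \<psi> n x)) = 0"
      unfolding tform_def
    proof (rule sum.neutral, rule ballI)
      fix i
      have "(\<lambda>x. indicator (A n) x * (T i * partials i (\<lambda>x. \<eta> x * \<psi> n x) x)) = (\<lambda>x. 0)"
        using z by (auto simp: indicator_def fun_eq_iff)
      then show "(LINT x|M. indicator (A n) x * (T i * partials i (\<lambda>x. \<eta> x * \<psi> n x) x)) = 0" by simp
    qed
    have "tform W M (two_phase \<kappa> (A n)) (D (s n)) (P (\<lambda>x. \<eta> x * \<psi> n x)) = 0"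
      using eq[OF test_in_Hm0[OF open_domain bounded_domain t\<eta>\<psi>], of n n] z'
      by (simp add: tform_D_P[OF bdd_coeff_two_phase[OF A(1) \<kappa>] tD t\<eta>\<psi>]
            tform_D_P[OF bdd_coeff_indicator[OF A(1)] tsqint_const t\<eta>\<psi>])
    then have zero: "tform W M (two_phase \<kappa> (A n)) (S n) (P (\<lambda>x. \<eta> x * \<psi> n x)) = 0"
      unfolding S_def by (subst tform_commute, subst tform_cmult_right, subst tform_commute) simp
    have peq: "P (\<lambda>x. \<eta> x * \<psi> n x) = (\<lambda>i x. ?com n i x + \<eta> x * partials i (\<psi> n) x)" by auto
    have "tform W M (two_phase \<kappa> (A n)) (S n) (\<lambda>i x. ?com n i x + \<eta> x * partials i (\<psi> n) x) = 0"
      by (rule trans[OF arg_cong[where f = "tform W M (two_phase \<kappa> (A n)) (S n)", OF peq[symmetric]] zero])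
    moreover have "tform W M (two_phase \<kappa> (A n)) (S n) (\<lambda>i x. ?com n i x + \<eta> x * partials i (\<psi> n) x)
      = tform W M (two_phase \<kappa> (A n)) (S n) (?com n) + tform W M (two_phase \<kappa> (A n)) (S n) (\<lambda>i x. \<eta> x * partials i (\<psi> n) x)"
      by (rule tform_add_right[OF bdd_coeff_two_phase[OF A(1) \<kappa>] tS tcom tcom0])
    moreover have "tform W M (two_phase \<kappa> (A n)) (S n) (\<lambda>i x. \<eta> x * partials i (\<psi> n) x) = tform W M (g n) (S n) (P (\<psi> n))"
      by (simp add: tform_def g_def mult_ac)
    ultimately show ?case by linarith
  qed
  have "(\<lambda>n. - tform W M (two_phase \<kappa> (A n)) (S n) (?com n)) \<longlonglongrightarrow> - 0"
    by (intro tendsto_minus tform_to_zero[OF bdd_coeff_two_phase[OF A(1) \<kappa>] tS tcom nS com0])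
  then have l1: "(\<lambda>n. tform W M (g n) (S n) (P (\<psi> n))) \<longlonglongrightarrow> 0"
    using tendsto_cong[OF eq0] by simp
  have l2: "(\<lambda>n. tform W M (g n) (S n) (\<lambda>i x. S n i x - P (\<psi> n) i x)) \<longlonglongrightarrow> 0"
    by (rule tform_to_zero[OF cg tS tdiff nS diff0])
  have "tform W M (g n) (S n) (S n) = tform W M (g n) (S n) (P (\<psi> n)) + tform W M (g n) (S n) (\<lambda>i x. S n i x - P (\<psi> n) i x)" for n
    using tform_diff_right[OF cg tS tS tP] by simp
  with tendsto_add[OF l1 l2] have l3: "(\<lambda>n. tform W M (g n) (S n) (S n)) \<longlonglongrightarrow> 0" by simp
  have lower: "\<kappa> * c * (tnrm W M (restr K (S n)))\<^sup>2 \<le> tform W M (g n) (S n) (S n)" for n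
    unfolding tnrm_sq tform_def sum_distrib_left
  proof (rule sum_mono)
    fix i assume i: "i \<in> W"
    then have q: "sqint M (S n i)" "sqint M (restr K (S n) i)"
      using tS[of n] tsqint_restr[OF K tS[of n]] by (auto simp: tsqint_def)
    have "(LINT x|M. \<kappa> * c * (restr K (S n) i x)\<^sup>2) \<le> (LINT x|M. g n x * (S n i x * S n i x))"
    proof (rule integral_mono)
      show "integrable M (\<lambda>x. \<kappa> * c * (restr K (S n) i x)\<^sup>2)" using q by (simp add: sqint_def)
      show "integrable M (\<lambda>x. g n x * (S n i x * S n i x))" by (rule bdd_coeff_integrable[OF cg q(1) q(1)])
      fix x
      show "\<kappa> * c * (restr K (S n) i x)\<^sup>2 \<le> g n x * (S n i x * S n i x)"
      proof (cases "x \<in> K")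
        case True
        have "\<kappa> * c \<le> g n x"
          unfolding g_def using far[OF True] \<eta>(2,6) \<kappa> by (intro mult_mono) (auto simp: two_phase_def)
        then show ?thesis using True by (auto simp: restr_def power2_eq_square intro: mult_right_mono)
      next
        case False
        have "0 \<le> g n x" unfolding g_def using \<eta>(3) \<kappa> by (auto simp: two_phase_def)
        then show ?thesis using False by (simp add: restr_def)
      qed
    qed
    then show "\<kappa> * c * (LINT x|M. (restr K (S n) i x)\<^sup>2) \<le> (LINT x|M. g n x * (S n i x * S n i x))" by simp
  qed
  have "(\<lambda>n. (tnrm W M (restr K (S n)))\<^sup>2) \<longlonglongrightarrow> 0"
  proof (rule tendsto_sandwich[OF _ _ tendsto_const])
    show "\<forall>\<^sub>F n in sequentially. (tnrm W M (restr K (S n)))\<^sup>2 \<le> tform W M (g n) (S n) (S n) * inverse (\<kappa> * c)"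
      using lower \<kappa> \<eta>(2) by (intro always_eventually allI) (simp add: field_simps)
    show "(\<lambda>n. tform W M (g n) (S n) (S n) * inverse (\<kappa> * c)) \<longlonglongrightarrow> 0"
      by (rule tendsto_mult_left_zero[OF l3])
  qed simp
  from tendsto_real_sqrt[OF this] have "(\<lambda>n. tnrm W M (restr K (S n))) \<longlonglongrightarrow> 0" by simp
  moreover have "tnrm W M (restr K (S n)) = tnrm W M (restr K (D (s n))) / sqrt (\<mu> n)" for n
  proof -
    have "restr K (S n) = (\<lambda>i x. inverse (sqrt (\<mu> n)) * restr K (D (s n)) i x)"
      by (simp add: restr_def S_def mult_ac)
    then show ?thesis using r[of n] by (simp add: tnrm_cmult divide_inverse_commute)
  qed
  ultimately show "(\<lambda>n. tnrm W M (restr K (D (s n))) / sqrt (\<mu> n)) \<longlonglongrightarrow> 0" by simp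
qed

end

section \<open>Homogeneous polynomials\<close>

text \<open>The homogeneous polynomial \<open>E(x, \<dots>, x)\<close> obtained by contracting every index of \<open>E\<close> with \<open>x\<close>.\<close>

primrec hpoly :: "nat \<Rightarrow> tensor \<Rightarrow> plane \<Rightarrow> real" where
  "hpoly 0 E = (\<lambda>x. E [])"
| "hpoly (Suc n) E = (\<lambda>x. x $ 1 * hpoly n (\<lambda>i. E (1 # i)) x + x $ 2 * hpoly n (\<lambda>i. E (2 # i)) x)"

lemma smooth_hpoly: "smooth (hpoly n E)"
  by (induction n arbitrary: E) (simp_all add: smooth_add smooth_mult)

lemma hpoly_add: "hpoly n (\<lambda>i. A i + B i) x = hpoly n A x + hpoly n B x"
  by (induction n arbitrary: A B) (simp_all add: algebra_simps)

lemma words_Suc: "words (Suc n) = (#) 1 ` words n \<union> (#) 2 ` words n"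
proof -
  have "k = 1 \<or> k = 2" for k :: 2 by (rule exhaust_2)
  then show ?thesis by (fastforce simp: words_def length_Suc_conv)
qed

lemma hpoly_sum: "(\<Sum>i\<in>words n. E i * prod_list (map (\<lambda>k. x $ k) i)) = hpoly n E x"
proof (induction n arbitrary: E)
  case 0
  then show ?case by (simp add: words_def)
next
  case (Suc n)
  have d: "(#) (1::2) ` words n \<inter> (#) 2 ` words n = {}" by auto
  have "(\<Sum>i\<in>words (Suc n). E i * prod_list (map (\<lambda>k. x $ k) i))
    = (\<Sum>i\<in>(#) 1 ` words n. E i * prod_list (map (\<lambda>k. x $ k) i)) + (\<Sum>i\<in>(#) 2 ` words n. E i * prod_list (map (\<lambda>k. x $ k) i))"
    unfolding words_Suc by (rule sum.union_disjoint) (use d in auto)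
  also have "\<dots> = (\<Sum>i\<in>words n. x $ 1 * (E (1 # i) * prod_list (map (\<lambda>k. x $ k) i)))
     + (\<Sum>i\<in>words n. x $ 2 * (E (2 # i) * prod_list (map (\<lambda>k. x $ k) i)))"
    by (simp add: sum.reindex mult_ac)
  also have "\<dots> = hpoly (Suc n) E x"
    unfolding sum_distrib_left[symmetric] Suc.IH by simp
  finally show ?case .
qed

lemma partial_hpoly_Suc:
  "partial k (hpoly (Suc n) E) = (\<lambda>x. hpoly n (\<lambda>i. E (k # i)) x
     + (x $ 1 * partial k (hpoly n (\<lambda>i. E (1 # i))) x + x $ 2 * partial k (hpoly n (\<lambda>i. E (2 # i))) x))"
proof
  fix x
  have d: "smooth (\<lambda>x. x $ l * hpoly n F x)" for l F by (intro smooth_mult smooth_coord smooth_hpoly)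
  have "partial k (hpoly (Suc n) E) x
     = partial k (\<lambda>x. x $ 1 * hpoly n (\<lambda>i. E (1 # i)) x) x + partial k (\<lambda>x. x $ 2 * hpoly n (\<lambda>i. E (2 # i)) x) x"
    unfolding hpoly.simps by (intro partial_add smooth_differentiable d)
  moreover have "partial k (\<lambda>x. x $ l * hpoly n F x) x = (if k = l then 1 else 0) * hpoly n F x + x $ l * partial k (hpoly n F) x" for l F
    using partial_mult[OF smooth_differentiable[OF smooth_coord[of l], of x] smooth_differentiable[OF smooth_hpoly[of n F], of x], of k]
    by (simp add: partial_coord)
  ultimately show "partial k (hpoly (Suc n) E) x = hpoly n (\<lambda>i. E (k # i)) x
     + (x $ 1 * partial k (hpoly n (\<lambda>i. E (1 # i))) x + x $ 2 * partial k (hpoly n (\<lambda>i. E (2 # i))) x)"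
    using exhaust_2[of k] by auto
qed

lemma partial_hpoly_ex: "\<exists>G. partial k (hpoly (Suc n) E) = hpoly n G"
proof (induction n arbitrary: E)
  case 0
  have "partial k (hpoly (Suc 0) E) = hpoly 0 (\<lambda>i. E (k # i))"
    unfolding partial_hpoly_Suc by simp
  then show ?case by blast
next
  case (Suc n)
  obtain G1 where G1: "partial k (hpoly (Suc n) (\<lambda>i. E (1 # i))) = hpoly n G1" using Suc.IH by blast
  obtain G2 where G2: "partial k (hpoly (Suc n) (\<lambda>i. E (2 # i))) = hpoly n G2" using Suc.IH by blast
  let ?G = "\<lambda>i. E (k # i) + (if hd i = 1 then G1 (tl i) else G2 (tl i))"
  have "partial k (hpoly (Suc (Suc n)) E) = hpoly (Suc n) ?G"
    unfolding partial_hpoly_Suc[of k "Suc n"] G1 G2 by (intro ext) (simp add: hpoly_add algebra_simps)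
  then show ?case by blast
qed

lemma partials_hpoly_const: "length j = n \<Longrightarrow> \<exists>c. partials j (hpoly n E) = (\<lambda>_. c)"
proof (induction n arbitrary: j E)
  case (Suc n)
  then obtain i k where j: "j = i @ [k]" "length i = n" by (metis length_Suc_conv_rev)
  obtain G where "partial k (hpoly (Suc n) E) = hpoly n G" using partial_hpoly_ex by blast
  then show ?case using Suc.IH[OF j(2), of G] by (simp add: j partials_append del: hpoly.simps)
qed auto

text \<open>For a symmetric tensor all slots contribute equally, which produces the factor.\<close>

lemma partial_hpoly_symmetric:
  assumes "\<And>i j. mset i = mset j \<Longrightarrow> E i = E j"
  shows "partial k (hpoly (Suc n) E) = (\<lambda>x. real (Suc n) * hpoly n (\<lambda>i. E (k # i)) x)"
  using assms
proof (induction n arbitrary: E)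
  case 0
  show ?case unfolding partial_hpoly_Suc by simp
next
  case (Suc n)
  have sym: "mset i = mset j \<Longrightarrow> E (l # i) = E (l # j)" for l i j by (rule Suc.prems) simp
  have swap: "E (l # k # i) = E (k # l # i)" for l i by (rule Suc.prems) simp
  have "partial k (hpoly (Suc n) (\<lambda>i. E (l # i))) = (\<lambda>x. real (Suc n) * hpoly n (\<lambda>i. E (l # k # i)) x)" for l
    by (rule Suc.IH) (rule sym)
  then show ?case
    unfolding partial_hpoly_Suc[of k "Suc n"] by (intro ext) (simp add: swap algebra_simps)
qed

lemma partials_hpoly_symmetric:
  assumes "\<And>i j. mset i = mset j \<Longrightarrow> E i = E j" "length j = n"
  shows "partials j (hpoly n E) = (\<lambda>_. fact n * E j)"
  using assms
proof (induction n arbitrary: j E)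
  case (Suc n)
  then obtain i k where j: "j = i @ [k]" "length i = n" by (metis length_Suc_conv_rev)
  have IH: "partials i (hpoly n (\<lambda>i. E (k # i))) = (\<lambda>_. fact n * E (k # i))"
    by (rule Suc.IH[OF _ j(2)]) (rule Suc.prems, simp)
  have 1: "partial k (hpoly (Suc n) E) = (\<lambda>x. real (Suc n) * hpoly n (\<lambda>i. E (k # i)) x)"
    by (rule partial_hpoly_symmetric) (rule Suc.prems(1))
  have "partials j (hpoly (Suc n) E) = (\<lambda>x. real (Suc n) * partials i (hpoly n (\<lambda>i. E (k # i))) x)"
    unfolding j partials_append partials.simps 1 by (rule partials_cmult[OF smooth_hpoly])
  also have "\<dots> = (\<lambda>_. fact (Suc n) * E j)"
    unfolding IH using Suc.prems(1)[of j "k # i"] j by (simp add: algebra_simps)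
  finally show ?case .
next
  case 0
  from 0(2) have "j = []" by simp
  then show ?case by simp
qed

lemma V_poly_hpoly: "V_poly i = (\<lambda>x. 1 / fact (length i) * hpoly (length i) (\<lambda>j. if j = i then 1 else 0) x)"
proof
  fix x :: plane
  have "(\<Sum>j\<in>words (length i). (if j = i then 1 else 0) * prod_list (map (\<lambda>k. x $ k) j))
      = (\<Sum>j\<in>words (length i). if j = i then prod_list (map (\<lambda>k. x $ k) i) else 0)"
    by (intro sum.cong) auto
  also have "\<dots> = prod_list (map (\<lambda>k. x $ k) i)" by (simp add: sum.delta words_def finite_words[unfolded words_def])
  finally show "V_poly i x = 1 / fact (length i) * hpoly (length i) (\<lambda>j. if j = i then 1 else 0) x"
    by (simp add: V_poly_def hpoly_sum)
qed

lemma smooth_V_poly: "smooth (V_poly i)"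
  unfolding V_poly_hpoly by (intro smooth_cmult smooth_hpoly)

text \<open>The \<open>m\<close>-th derivatives of a polynomial of degree \<open>m\<close> are constant, so they are read off at the origin.\<close>

definition V_grad :: "word2 \<Rightarrow> tensor" where
  "V_grad i j = partials j (V_poly i) 0"

lemma partials_V_poly:
  assumes "length j = length i" shows "partials j (V_poly i) = (\<lambda>_. V_grad i j)"
proof -
  obtain c where "partials j (hpoly (length i) (\<lambda>j. if j = i then 1 else 0)) = (\<lambda>_. c)"
    using partials_hpoly_const[OF assms] by blast
  then have "partials j (V_poly i) = (\<lambda>_. 1 / fact (length i) * c)"
    by (subst V_poly_hpoly) (simp only: partials_cmult[OF smooth_hpoly])
  then have "\<exists>c. partials j (V_poly i) = (\<lambda>_. c)" by blast
  then show ?thesis by (auto simp: V_grad_def)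
qed

lemma partials_sum:
  assumes "finite I" "\<And>i. i \<in> I \<Longrightarrow> smooth (f i)"
  shows "smooth (\<lambda>x. \<Sum>i\<in>I. f i x) \<and> partials j (\<lambda>x. \<Sum>i\<in>I. f i x) = (\<lambda>x. \<Sum>i\<in>I. partials j (f i) x)"
  using assms by (induction I rule: finite_induct) (simp_all add: smooth_add partials_add)

text \<open>\<open>\<Sum>\<^sub>i E\<^sub>i V\<^sup>i\<close> is the polynomial \<open>E(x, \<dots>, x) / m!\<close>, whose \<open>m\<close>-th derivative is the symmetric tensor \<open>E\<close>.\<close>

lemma V_grad_symmetric:
  assumes sym: "\<And>i j. mset i = mset j \<Longrightarrow> E i = E j" and j: "length j = m"
  shows "(\<Sum>i\<in>words m. E i * V_grad i j) = E j"
proof -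
  have "(\<lambda>x. \<Sum>i\<in>words m. E i * V_poly i x) = (\<lambda>x. 1 / fact m * hpoly m E x)"
    by (auto simp: hpoly_sum[symmetric] V_poly_def words_def sum_distrib_left mult_ac intro!: sum.cong)
  then have "partials j (\<lambda>x. \<Sum>i\<in>words m. E i * V_poly i x) = partials j (\<lambda>x. 1 / fact m * hpoly m E x)" by simp
  also have "\<dots> = (\<lambda>_. E j)"
  proof -
    have "partials j (hpoly m E) = (\<lambda>_. fact m * E j)"
      by (rule partials_hpoly_symmetric[OF _ j]) (rule sym)
    then have "partials j (\<lambda>x. 1 / fact m * hpoly m E x) = (\<lambda>_. 1 / fact m * (fact m * E j))"
      by (simp only: partials_cmult[OF smooth_hpoly])
    then show ?thesis by simp
  qed
  finally have *: "partials j (\<lambda>x. \<Sum>i\<in>words m. E i * V_poly i x) = (\<lambda>_. E j)" .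
  have "partials j (\<lambda>x. \<Sum>i\<in>words m. E i * V_poly i x) = (\<lambda>x. \<Sum>i\<in>words m. partials j (\<lambda>x. E i * V_poly i x) x)"
    using partials_sum[of "words m" "\<lambda>i x. E i * V_poly i x" j] by (simp add: smooth_cmult smooth_V_poly)
  also have "\<dots> = (\<lambda>x. \<Sum>i\<in>words m. E i * V_grad i j)"
    using j by (intro ext sum.cong refl) (simp add: partials_cmult[OF smooth_V_poly] partials_V_poly words_def)
  finally show ?thesis using fun_cong[OF *, of 0] by simp
qed

section \<open>Thin neighbourhoods of a segment\<close>

lemma Sigma_seg_nonempty: "0 \<le> \<epsilon> \<Longrightarrow> Sigma_seg y \<tau> \<epsilon> \<noteq> {}"
  by (auto simp: Sigma_seg_def intro: exI[of _ 0])

lemma mem_Omega_eps: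
  assumes "0 \<le> \<epsilon>"
  shows "x \<in> Omega_eps y \<tau> \<epsilon> \<longleftrightarrow> (\<exists>\<rho>. \<bar>\<rho>\<bar> \<le> \<epsilon> \<and> dist x (y + \<rho> *\<^sub>R \<tau>) < \<epsilon>\<^sup>2)"
proof -
  have "infdist x (Sigma_seg y \<tau> \<epsilon>) < \<epsilon>\<^sup>2 \<longleftrightarrow> (\<exists>a\<in>Sigma_seg y \<tau> \<epsilon>. dist x a < \<epsilon>\<^sup>2)"
    using Sigma_seg_nonempty[OF assms, of y \<tau>]
    by (simp add: infdist_notempty cINF_less_iff bdd_belowI2[of _ 0])
  also have "\<dots> \<longleftrightarrow> (\<exists>\<rho>. \<bar>\<rho>\<bar> \<le> \<epsilon> \<and> dist x (y + \<rho> *\<^sub>R \<tau>) < \<epsilon>\<^sup>2)"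
    by (auto simp: Sigma_seg_def abs_le_iff) (metis abs_le_iff minus_le_iff)
  finally show ?thesis by (simp add: Omega_eps_def)
qed

lemma open_Omega_eps: "open (Omega_eps y \<tau> \<epsilon>)"
  unfolding Omega_eps_def by (intro open_Collect_less continuous_intros)

text \<open>The set is the Minkowski sum of a segment and an open disc. Convexity makes its boundary a null set.\<close>

lemma convex_Omega_eps:
  assumes "0 \<le> \<epsilon>" shows "convex (Omega_eps y \<tau> \<epsilon>)"
proof -
  have s: "convex ((\<lambda>\<rho>. \<rho> *\<^sub>R \<tau>) ` {-\<epsilon>..\<epsilon>})"
    by (intro convex_linear_image) (auto intro: linearI simp: scaleR_add_left)
  have "Omega_eps y \<tau> \<epsilon> = (\<Union>a\<in>(\<lambda>\<rho>. \<rho> *\<^sub>R \<tau>) ` {-\<epsilon>..\<epsilon>}. \<Union>b\<in>ball y (\<epsilon>\<^sup>2). {a + b})"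
  proof (rule set_eqI)
    fix x
    have "(\<exists>\<rho>. \<bar>\<rho>\<bar> \<le> \<epsilon> \<and> dist x (y + \<rho> *\<^sub>R \<tau>) < \<epsilon>\<^sup>2) \<longleftrightarrow> (\<exists>\<rho>\<in>{-\<epsilon>..\<epsilon>}. \<exists>b\<in>ball y (\<epsilon>\<^sup>2). x = \<rho> *\<^sub>R \<tau> + b)"
    proof
      assume "\<exists>\<rho>. \<bar>\<rho>\<bar> \<le> \<epsilon> \<and> dist x (y + \<rho> *\<^sub>R \<tau>) < \<epsilon>\<^sup>2"
      then obtain \<rho> where "\<bar>\<rho>\<bar> \<le> \<epsilon>" "dist x (y + \<rho> *\<^sub>R \<tau>) < \<epsilon>\<^sup>2" by blast
      then show "\<exists>\<rho>\<in>{-\<epsilon>..\<epsilon>}. \<exists>b\<in>ball y (\<epsilon>\<^sup>2). x = \<rho> *\<^sub>R \<tau> + b"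
        by (intro bexI[of _ \<rho>] bexI[of _ "x - \<rho> *\<^sub>R \<tau>"]) (auto simp: dist_norm norm_minus_commute algebra_simps)
    next
      assume "\<exists>\<rho>\<in>{-\<epsilon>..\<epsilon>}. \<exists>b\<in>ball y (\<epsilon>\<^sup>2). x = \<rho> *\<^sub>R \<tau> + b"
      then obtain \<rho> b where "\<rho> \<in> {-\<epsilon>..\<epsilon>}" "b \<in> ball y (\<epsilon>\<^sup>2)" "x = \<rho> *\<^sub>R \<tau> + b" by blast
      then show "\<exists>\<rho>. \<bar>\<rho>\<bar> \<le> \<epsilon> \<and> dist x (y + \<rho> *\<^sub>R \<tau>) < \<epsilon>\<^sup>2"
        by (intro exI[of _ \<rho>]) (auto simp: dist_norm norm_minus_commute algebra_simps)
    qed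
    then show "x \<in> Omega_eps y \<tau> \<epsilon> \<longleftrightarrow> x \<in> (\<Union>a\<in>(\<lambda>\<rho>. \<rho> *\<^sub>R \<tau>) ` {-\<epsilon>..\<epsilon>}. \<Union>b\<in>ball y (\<epsilon>\<^sup>2). {a + b})"
      unfolding mem_Omega_eps[OF assms] by auto
  qed
  then show ?thesis using convex_sums[OF s convex_ball] by simp
qed

lemma Omega_eps_subset_ball:
  assumes "0 \<le> \<epsilon>" "norm \<tau> = 1" "\<epsilon> + \<epsilon>\<^sup>2 \<le> r"
  shows "Omega_eps y \<tau> \<epsilon> \<subseteq> ball y r"
proof
  fix x assume "x \<in> Omega_eps y \<tau> \<epsilon>"
  then obtain \<rho> where "\<bar>\<rho>\<bar> \<le> \<epsilon>" "dist x (y + \<rho> *\<^sub>R \<tau>) < \<epsilon>\<^sup>2"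
    using mem_Omega_eps[OF assms(1)] by blast
  moreover have "dist (y + \<rho> *\<^sub>R \<tau>) y = \<bar>\<rho>\<bar>" using assms by (simp add: dist_norm)
  ultimately show "x \<in> ball y r"
    using dist_triangle[of x y "y + \<rho> *\<^sub>R \<tau>"] assms(3) by (simp add: dist_commute)
qed

text \<open>Reduces the computation of areas to a segment along the first axis.\<close>

lemma Omega_eps_rotate:
  assumes "0 \<le> \<epsilon>" "orthogonal_transformation f" "f e = \<tau>"
  shows "Omega_eps y \<tau> \<epsilon> = (+) y ` f ` Omega_eps 0 e \<epsilon>"
proof -
  have lin: "linear f" and nf: "\<And>v. norm (f v) = norm v"
    using assms(2) by (auto simp: orthogonal_transformation)
  have iff: "y + f z \<in> Omega_eps y \<tau> \<epsilon> \<longleftrightarrow> z \<in> Omega_eps 0 e \<epsilon>" for z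
  proof -
    have "dist (y + f z) (y + \<rho> *\<^sub>R \<tau>) = dist z (0 + \<rho> *\<^sub>R e)" for \<rho>
    proof -
      have "dist (y + f z) (y + \<rho> *\<^sub>R \<tau>) = norm (f z - f (\<rho> *\<^sub>R e))"
        by (simp add: dist_norm linear_scale[OF lin] assms(3))
      also have "\<dots> = norm (z - \<rho> *\<^sub>R e)" by (simp add: nf flip: linear_diff[OF lin])
      finally show ?thesis by (simp add: dist_norm)
    qed
    then show ?thesis by (simp only: mem_Omega_eps[OF assms(1)])
  qed
  have "surj f" by (rule orthogonal_transformation_surj[OF assms(2)])
  then have ex: "\<exists>z. x = y + f z" for x by (metis add.commute diff_add_cancel surjD)
  show ?thesis
  proof (intro equalityI subsetI)
    fix x assume "x \<in> Omega_eps y \<tau> \<epsilon>"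
    moreover obtain z where "x = y + f z" using ex by blast
    ultimately show "x \<in> (+) y ` f ` Omega_eps 0 e \<epsilon>" using iff[of z] by blast
  next
    fix x assume "x \<in> (+) y ` f ` Omega_eps 0 e \<epsilon>"
    then show "x \<in> Omega_eps y \<tau> \<epsilon>" using iff by auto
  qed
qed

lemma Omega_eps_axis:
  assumes "0 < \<epsilon>"
  shows "box (vec2 (-\<epsilon>) (-(\<epsilon>\<^sup>2))) (vec2 \<epsilon> (\<epsilon>\<^sup>2)) \<subseteq> Omega_eps 0 (axis 1 1) \<epsilon>"
    and "Omega_eps 0 (axis 1 1) \<epsilon> \<subseteq> cbox (vec2 (-(\<epsilon> + \<epsilon>\<^sup>2)) (-(\<epsilon>\<^sup>2))) (vec2 (\<epsilon> + \<epsilon>\<^sup>2) (\<epsilon>\<^sup>2))"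
proof -
  have \<epsilon>: "0 \<le> \<epsilon>" using assms by simp
  show "box (vec2 (-\<epsilon>) (-(\<epsilon>\<^sup>2))) (vec2 \<epsilon> (\<epsilon>\<^sup>2)) \<subseteq> Omega_eps 0 (axis 1 1) \<epsilon>"
  proof
    fix x assume x: "x \<in> box (vec2 (-\<epsilon>) (-(\<epsilon>\<^sup>2))) (vec2 \<epsilon> (\<epsilon>\<^sup>2))"
    have "x - x $ 1 *\<^sub>R axis 1 1 = x $ 2 *\<^sub>R axis 2 1"
      by (simp add: vec_eq_iff forall_2 axis_def)
    then have "dist x (0 + x $ 1 *\<^sub>R axis 1 1) = \<bar>x $ 2\<bar>" by (simp add: dist_norm)
    moreover have "\<bar>x $ 2\<bar> < \<epsilon>\<^sup>2" "\<bar>x $ 1\<bar> \<le> \<epsilon>" using x by (auto simp: mem_box_cart forall_2)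
    ultimately show "x \<in> Omega_eps 0 (axis 1 1) \<epsilon>" unfolding mem_Omega_eps[OF \<epsilon>] by metis
  qed
  show "Omega_eps 0 (axis 1 1) \<epsilon> \<subseteq> cbox (vec2 (-(\<epsilon> + \<epsilon>\<^sup>2)) (-(\<epsilon>\<^sup>2))) (vec2 (\<epsilon> + \<epsilon>\<^sup>2) (\<epsilon>\<^sup>2))"
  proof
    fix x :: plane assume "x \<in> Omega_eps 0 (axis 1 1) \<epsilon>"
    then obtain \<rho> where \<rho>: "\<bar>\<rho>\<bar> \<le> \<epsilon>" "dist x (0 + \<rho> *\<^sub>R axis 1 1) < \<epsilon>\<^sup>2"
      unfolding mem_Omega_eps[OF \<epsilon>] by blast
    have "\<bar>(x - \<rho> *\<^sub>R axis 1 1) $ k\<bar> < \<epsilon>\<^sup>2" for k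
      using component_le_norm_cart[of "x - \<rho> *\<^sub>R axis 1 1" k] \<rho>(2) by (simp add: dist_norm)
    from this[of 1] this[of 2] have "\<bar>x $ 1 - \<rho>\<bar> < \<epsilon>\<^sup>2" "\<bar>x $ 2\<bar> < \<epsilon>\<^sup>2"
      by (simp_all add: axis_def)
    then show "x \<in> cbox (vec2 (-(\<epsilon> + \<epsilon>\<^sup>2)) (-(\<epsilon>\<^sup>2))) (vec2 (\<epsilon> + \<epsilon>\<^sup>2) (\<epsilon>\<^sup>2))"
      using \<rho>(1) by (auto simp: mem_box_cart forall_2)
  qed
qed

lemma measure_cbox_vec2: "a \<le> c \<Longrightarrow> b \<le> d \<Longrightarrow> measure lebesgue (cbox (vec2 a b) (vec2 c d)) = (c - a) * (d - b)"
  and measure_box_vec2: "a \<le> c \<Longrightarrow> b \<le> d \<Longrightarrow> measure lebesgue (box (vec2 a b) (vec2 c d)) = (c - a) * (d - b)"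
  by (auto simp: measure_lborel_cbox_eq measure_lborel_box_eq Basis_plane inner_axis axis_eq_axis)

text \<open>Up to a rotation the set lies between the rectangles with half sides \<open>\<epsilon>, \<epsilon>\<^sup>2\<close> and \<open>\<epsilon> + \<epsilon>\<^sup>2, \<epsilon>\<^sup>2\<close>.\<close>

lemma measure_Omega_eps:
  assumes \<epsilon>: "0 < \<epsilon>" and \<tau>: "norm \<tau> = 1"
  shows "4 * \<epsilon> ^ 3 \<le> measure lebesgue (Omega_eps y \<tau> \<epsilon>)"
    and "measure lebesgue (Omega_eps y \<tau> \<epsilon>) \<le> 4 * \<epsilon> ^ 3 + 4 * \<epsilon> ^ 4"
proof -
  let ?B = "Omega_eps 0 (axis 1 1 :: plane) \<epsilon>"
  have e0: "0 \<le> \<epsilon>" using \<epsilon> by simp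
  obtain f :: "plane \<Rightarrow> plane" where f: "orthogonal_transformation f" "f (axis 1 1) = \<tau>"
    using orthogonal_transformation_exists_1[of "axis 1 1" \<tau>] \<tau> by auto
  have bB: "bounded ?B" using Omega_eps_axis(2)[OF \<epsilon>] bounded_subset bounded_cbox by blast
  have lm: "?B \<in> lmeasurable" by (rule lmeasurable_open[OF bB open_Omega_eps])
  have "measure lebesgue (Omega_eps y \<tau> \<epsilon>) = measure lebesgue (f ` ?B)"
    unfolding Omega_eps_rotate[OF e0 f] by (rule measure_translation)
  also have "\<dots> = measure lebesgue ?B"
    by (rule measure_orthogonal_image[OF f(1) lm])
  finally have m: "measure lebesgue (Omega_eps y \<tau> \<epsilon>) = measure lebesgue ?B" .
  have inner: "measure lebesgue (box (vec2 (-\<epsilon>) (-(\<epsilon>\<^sup>2))) (vec2 \<epsilon> (\<epsilon>\<^sup>2))) \<le> measure lebesgue ?B"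
    by (rule measure_mono_fmeasurable[OF Omega_eps_axis(1)[OF \<epsilon>] _ lm]) simp
  show "4 * \<epsilon> ^ 3 \<le> measure lebesgue (Omega_eps y \<tau> \<epsilon>)"
  proof -
    have "measure lebesgue (box (vec2 (-\<epsilon>) (-(\<epsilon>\<^sup>2))) (vec2 \<epsilon> (\<epsilon>\<^sup>2))) = (\<epsilon> - - \<epsilon>) * (\<epsilon>\<^sup>2 - - (\<epsilon>\<^sup>2))"
      by (rule measure_box_vec2) (use \<epsilon> in auto)
    also have "\<dots> = 4 * \<epsilon> ^ 3" by (simp add: power2_eq_square power3_eq_cube)
    finally have "measure lebesgue (box (vec2 (-\<epsilon>) (-(\<epsilon>\<^sup>2))) (vec2 \<epsilon> (\<epsilon>\<^sup>2))) = 4 * \<epsilon> ^ 3" .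
    with inner show ?thesis unfolding m by linarith
  qed
  have "measure lebesgue ?B \<le> measure lebesgue (cbox (vec2 (-(\<epsilon> + \<epsilon>\<^sup>2)) (-(\<epsilon>\<^sup>2))) (vec2 (\<epsilon> + \<epsilon>\<^sup>2) (\<epsilon>\<^sup>2)))"
    using lm by (intro measure_mono_fmeasurable[OF Omega_eps_axis(2)[OF \<epsilon>]]) auto
  also have "\<dots> = (2 * (\<epsilon> + \<epsilon>\<^sup>2)) * (2 * \<epsilon>\<^sup>2)"
    using \<epsilon> by (subst measure_cbox_vec2) auto
  also have "\<dots> = 4 * \<epsilon> ^ 3 + 4 * \<epsilon> ^ 4"
    by (simp add: algebra_simps power2_eq_square power3_eq_cube power4_eq_xxxx)
  finally show "measure lebesgue (Omega_eps y \<tau> \<epsilon>) \<le> 4 * \<epsilon> ^ 3 + 4 * \<epsilon> ^ 4" by (simp add: m)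
qed

lemma AE_closure_Omega_eps:
  assumes "0 \<le> \<epsilon>"
  shows "AE x in lebesgue. x \<in> closure (Omega_eps y \<tau> \<epsilon>) \<longleftrightarrow> x \<in> Omega_eps y \<tau> \<epsilon>"
proof -
  have "negligible (frontier (Omega_eps y \<tau> \<epsilon>))"
    by (rule negligible_convex_frontier[OF convex_Omega_eps[OF assms]])
  then have "frontier (Omega_eps y \<tau> \<epsilon>) \<in> null_sets lebesgue" by (simp add: negligible_iff_null_sets)
  then have "AE x in lebesgue. x \<notin> frontier (Omega_eps y \<tau> \<epsilon>)" by (rule AE_not_in)
  then show ?thesis
  proof eventually_elim
    case (elim x)
    then show ?case
      using closure_subset[of "Omega_eps y \<tau> \<epsilon>"] interior_open[OF open_Omega_eps, of y \<tau> \<epsilon>]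
      by (auto simp: frontier_def)
  qed
qed

section \<open>The state equation\<close>

text \<open>A product of one factor of order \<open>\<mu>\<^sup>1\<^sup>/\<^sup>2\<close> and one of smaller order is \<open>o(\<mu>)\<close>.\<close>

lemma small_product_tendsto:
  fixes \<mu> a b c :: "nat \<Rightarrow> real"
  assumes "\<And>n. 0 < \<mu> n" "\<And>n. \<bar>c n\<bar> \<le> a n * b n" "\<And>n. a n \<le> C * sqrt (\<mu> n)" "\<And>n. 0 \<le> b n"
    "(\<lambda>n. b n / sqrt (\<mu> n)) \<longlonglongrightarrow> 0"
  shows "(\<lambda>n. c n / \<mu> n) \<longlonglongrightarrow> 0"
proof (rule Lim_null_comparison)
  show "\<forall>\<^sub>F n in sequentially. norm (c n / \<mu> n) \<le> C * (b n / sqrt (\<mu> n))"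
  proof (intro always_eventually allI)
    fix n
    have s: "sqrt (\<mu> n) * sqrt (\<mu> n) = \<mu> n" using assms(1)[of n] by simp
    have "\<bar>c n\<bar> \<le> (C * sqrt (\<mu> n)) * b n"
      using assms(2)[of n] mult_right_mono[OF assms(3) assms(4), of n n] by linarith
    then have "\<bar>c n\<bar> / \<mu> n \<le> (C * sqrt (\<mu> n)) * b n / \<mu> n"
      using assms(1)[of n] by (intro divide_right_mono) auto
    also have "\<dots> = C * (b n / sqrt (\<mu> n))"
      using assms(1)[of n] s by (simp add: field_simps)
    finally show "norm (c n / \<mu> n) \<le> C * (b n / sqrt (\<mu> n))"
      using assms(1)[of n] by simp
  qed
  show "(\<lambda>n. C * (b n / sqrt (\<mu> n))) \<longlonglongrightarrow> 0"
    by (rule tendsto_mult_right_zero[OF assms(5)])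
qed

context bounded_domain
begin

lemma tform_indicator_bound2:
  assumes "A \<in> sets lebesgue" "tsqint W M X" "tsqint W M Y"
  shows "\<bar>tform W M (indicator A) X Y\<bar> \<le> tnrm W M (restr A X) * tnrm W M (restr A Y)"
proof -
  have "tform W M (indicator A) X Y = tform W M (\<lambda>_. 1) (restr A X) (restr A Y)"
    unfolding tform_def restr_def
    by (intro sum.cong refl Bochner_Integration.integral_cong) (auto simp: indicator_def)
  then show ?thesis
    using tform_bound[OF bdd_coeff_one tsqint_restr[OF assms(1,2)] tsqint_restr[OF assms(1,3)]] by simp
qed

lemma tform_const_right: "tform W M w X (\<lambda>j _. T j) = (\<Sum>j\<in>W. T j * (LINT x|M. w x * X j x))"
  unfolding tform_def
proof (rule sum.cong[OF refl])
  fix j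
  show "(LINT x|M. w x * (X j x * T j)) = T j * (LINT x|M. w x * X j x)"
    by (subst integral_mult_right_zero[symmetric]) (simp add: mult_ac)
qed

lemma tdot_tform:
  assumes "bdd_coeff M B \<zeta>" "tsqint W M (D u)" "tsqint W M (D w)"
  shows "(LINT x|M. \<zeta> x * tdot m (wgrad \<Omega> u x) (wgrad \<Omega> w x)) = tform W M \<zeta> (D u) (D w)"
proof -
  have "(LINT x|M. \<zeta> x * tdot m (wgrad \<Omega> u x) (wgrad \<Omega> w x))
     = (LINT x|M. (\<Sum>i\<in>W. \<zeta> x * (D u i x * D w i x)))"
    by (simp add: tdot_def wgrad_def sum_distrib_left)
  also have "\<dots> = tform W M \<zeta> (D u) (D w)"
    unfolding tform_def using assms
    by (intro Bochner_Integration.integral_sum bdd_coeff_integrable[OF assms(1)]) (auto simp: tsqint_def)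
  finally show ?thesis .
qed

lemma weak_solution_tform:
  assumes "weak_solution m \<alpha> \<Omega> \<zeta> f w" "bdd_coeff M B \<zeta>" "\<phi> \<in> Hm0 m \<Omega>"
  shows "(LINT x|M. w x * \<phi> x) + \<alpha> * tform W M \<zeta> (D w) (D \<phi>) = (LINT x|M. f x * \<phi> x)"
proof -
  have "w \<in> Hm0 m \<Omega>" using assms(1) by (simp add: weak_solution_def)
  then show ?thesis
    using assms tdot_tform[OF assms(2) tsqint_D[OF Hm0_Hm] tsqint_D[OF Hm0_Hm[OF assms(3)]], of w]
    by (auto simp: weak_solution_def)
qed

text \<open>Testing the equation with its own solution removes the energy term.\<close>

lemma J_fun_weak_solution:
  assumes w: "weak_solution m \<alpha> \<Omega> \<zeta> f w" and \<zeta>: "bdd_coeff M B \<zeta>" and f: "sqint M f"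
  shows "J_fun m \<alpha> \<Omega> f w \<zeta> = 1 / 2 * (LINT x|M. (f x)\<^sup>2) - 1 / 2 * (LINT x|M. f x * w x)"
proof -
  have wH: "w \<in> Hm0 m \<Omega>" using w by (simp add: weak_solution_def)
  have sw: "sqint M w" by (rule Hm_sqint[OF Hm0_Hm[OF wH]])
  note i = sqint_integrable[OF sw] sqint_integrable[OF f] sqint_mult[OF f sw]
  have "(LINT x|M. (w x - f x)\<^sup>2) = (LINT x|M. (w x)\<^sup>2 + (f x)\<^sup>2 - 2 * (f x * w x))"
    by (intro Bochner_Integration.integral_cong) (auto simp: power2_diff)
  also have "\<dots> = (LINT x|M. (w x)\<^sup>2) + (LINT x|M. (f x)\<^sup>2) - 2 * (LINT x|M. f x * w x)"
    using i by simp
  finally have 1: "(LINT x|M. (w x - f x)\<^sup>2) = (LINT x|M. (w x)\<^sup>2) + (LINT x|M. (f x)\<^sup>2) - 2 * (LINT x|M. f x * w x)" .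
  have 2: "(LINT x|M. (w x)\<^sup>2) + \<alpha> * tform W M \<zeta> (D w) (D w) = (LINT x|M. f x * w x)"
    using weak_solution_tform[OF w \<zeta> wH] by (simp add: power2_eq_square)
  show ?thesis
    unfolding J_fun_def tdot_tform[OF \<zeta> tsqint_D[OF Hm0_Hm[OF wH]] tsqint_D[OF Hm0_Hm[OF wH]]] 1
    using 2 by (simp add: algebra_simps)
qed

text \<open>The coefficient of the perturbed state differs from that of the unperturbed state on the thin set,
  and from that of the corrector on \<open>K\<close>; the closure of the thin set adds a null set.\<close>

lemma tform_two_phase_union:
  assumes \<kappa>: "0 < \<kappa>" "\<kappa> < 1" and m: "A \<in> sets lebesgue" "B \<in> sets lebesgue" "C \<in> sets lebesgue"
    and C: "AE x in lebesgue. x \<in> C \<longleftrightarrow> x \<in> B" and dj: "A \<inter> B = {}" and t: "tsqint W M X" "tsqint W M Y"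
  shows "tform W M (two_phase \<kappa> (A \<union> C)) X Y = tform W M (two_phase \<kappa> A) X Y - (1 - \<kappa>) * tform W M (indicator B) X Y"
    and "tform W M (two_phase \<kappa> (A \<union> C)) X Y = tform W M (two_phase \<kappa> B) X Y - (1 - \<kappa>) * tform W M (indicator A) X Y"
proof -
  have "AE x in lebesgue. x \<in> \<Omega> \<longrightarrow> (x \<in> C \<longleftrightarrow> x \<in> B)" using C by eventually_elim simp
  then have C': "AE x in M. x \<in> C \<longleftrightarrow> x \<in> B"
    using domain_lebesgue by (simp add: AE_restrict_space_iff)
  have cm: "bdd_coeff M 1 (two_phase \<kappa> (A \<union> C))" by (rule bdd_coeff_two_phase[OF sets.Un[OF m(1,3)] \<kappa>])
  have cu: "bdd_coeff M 1 (two_phase \<kappa> (A \<union> B))" by (rule bdd_coeff_two_phase[OF sets.Un[OF m(1,2)] \<kappa>])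
  have eq: "tform W M (two_phase \<kappa> (A \<union> C)) X Y = tform W M (two_phase \<kappa> (A \<union> B)) X Y"
  proof (rule tform_cong_AE)
    show "AE x in M. two_phase \<kappa> (A \<union> C) x = two_phase \<kappa> (A \<union> B) x"
      using C' by eventually_elim (simp add: two_phase_def)
  qed (use cm cu t in \<open>auto simp: bdd_coeff_def\<close>)
  have split: "tform W M (two_phase \<kappa> (A' \<union> B')) X Y = tform W M (two_phase \<kappa> A') X Y - (1 - \<kappa>) * tform W M (indicator B') X Y"
    if "A' \<in> sets lebesgue" "B' \<in> sets lebesgue" "A' \<inter> B' = {}" for A' B'
  proof -
    have c: "bdd_coeff M (1 - \<kappa>) (\<lambda>x. (\<kappa> - 1) * indicator B' x)"
      unfolding bdd_coeff_def using \<kappa>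
      by (intro conjI borel_measurable_times borel_measurable_const indicator_measurable_M that)
        (auto simp: indicator_def)
    have e: "two_phase \<kappa> (A' \<union> B') = (\<lambda>x. two_phase \<kappa> A' x + (\<kappa> - 1) * indicator B' x)"
      using that(3) by (auto simp: two_phase_def fun_eq_iff indicator_def)
    show ?thesis
      unfolding e tform_add_coeff[OF bdd_coeff_two_phase[OF that(1) \<kappa>] c t] tform_cmult_coeff
      by (simp add: algebra_simps)
  qed
  show "tform W M (two_phase \<kappa> (A \<union> C)) X Y = tform W M (two_phase \<kappa> A) X Y - (1 - \<kappa>) * tform W M (indicator B) X Y"
    unfolding eq by (rule split[OF m(1,2) dj])
  show "tform W M (two_phase \<kappa> (A \<union> C)) X Y = tform W M (two_phase \<kappa> B) X Y - (1 - \<kappa>) * tform W M (indicator A) X Y"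
    unfolding eq using split[OF m(2,1)] dj by (simp add: Un_commute Int_commute)
qed

text \<open>Each state equation is tested with the solution of the other, which leaves the difference of the two
  coefficients.\<close>

lemma J_fun_difference:
  assumes \<kappa>: "0 < \<kappa>" "\<kappa> < 1" and m: "A \<in> sets lebesgue" "B \<in> sets lebesgue" "C \<in> sets lebesgue"
    and C: "AE x in lebesgue. x \<in> C \<longleftrightarrow> x \<in> B" and dj: "A \<inter> B = {}" and f: "sqint M f"
    and u: "weak_solution m \<alpha> \<Omega> (two_phase \<kappa> A) f u"
    and w: "weak_solution m \<alpha> \<Omega> (two_phase \<kappa> (A \<union> C)) f w"
  shows "J_fun m \<alpha> \<Omega> f w (two_phase \<kappa> (A \<union> C)) - J_fun m \<alpha> \<Omega> f u (two_phase \<kappa> A)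
    = \<alpha> * (\<kappa> - 1) / 2 * tform W M (indicator B) (D w) (D u)"
proof -
  have H: "u \<in> Hm0 m \<Omega>" "w \<in> Hm0 m \<Omega>" using u w by (auto simp: weak_solution_def)
  note t = tsqint_D[OF Hm0_Hm[OF H(1)]] tsqint_D[OF Hm0_Hm[OF H(2)]]
  note c1 = bdd_coeff_two_phase[OF m(1) \<kappa>] and c2 = bdd_coeff_two_phase[OF sets.Un[OF m(1,3)] \<kappa>]
  have e1: "(LINT x|M. u x * w x) + \<alpha> * tform W M (two_phase \<kappa> A) (D u) (D w) = (LINT x|M. f x * w x)"
    by (rule weak_solution_tform[OF u c1 H(2)])
  have e2: "(LINT x|M. w x * u x) + \<alpha> * tform W M (two_phase \<kappa> (A \<union> C)) (D w) (D u) = (LINT x|M. f x * u x)"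
    by (rule weak_solution_tform[OF w c2 H(1)])
  have e3: "tform W M (two_phase \<kappa> (A \<union> C)) (D w) (D u)
     = tform W M (two_phase \<kappa> A) (D u) (D w) - (1 - \<kappa>) * tform W M (indicator B) (D w) (D u)"
    using tform_two_phase_union(1)[OF \<kappa> m C dj t(2,1)] by (simp add: tform_commute[of W M "two_phase \<kappa> A"])
  have e4: "\<alpha> * tform W M (two_phase \<kappa> (A \<union> C)) (D w) (D u)
     = \<alpha> * tform W M (two_phase \<kappa> A) (D u) (D w) + \<alpha> * (\<kappa> - 1) * tform W M (indicator B) (D w) (D u)"
    unfolding e3 by (simp add: algebra_simps)
  have e5: "(LINT x|M. u x * w x) = (LINT x|M. w x * u x)" by (simp add: mult.commute)
  have "(LINT x|M. f x * u x) - (LINT x|M. f x * w x) = \<alpha> * (\<kappa> - 1) * tform W M (indicator B) (D w) (D u)"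
    using e1 e2 e4 e5 by linarith
  moreover have "\<alpha> * (\<kappa> - 1) / 2 * tform W M (indicator B) (D w) (D u)
     = (\<alpha> * (\<kappa> - 1) * tform W M (indicator B) (D w) (D u)) / 2" by simp
  ultimately show ?thesis
    unfolding J_fun_weak_solution[OF u c1 f] J_fun_weak_solution[OF w c2 f] by linarith
qed

text \<open>The difference of the two states solves the perturbed equation with a right-hand side carried by \<open>B\<close>. Testing with
  the difference itself gives both energy bounds.\<close>

lemma state_difference:
  assumes \<kappa>: "0 < \<kappa>" "\<kappa> < 1" and \<alpha>: "0 < \<alpha>" and m: "A \<in> sets lebesgue" "B \<in> sets lebesgue" "C \<in> sets lebesgue"
    and C: "AE x in lebesgue. x \<in> C \<longleftrightarrow> x \<in> B" and dj: "A \<inter> B = {}"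
    and u: "weak_solution m \<alpha> \<Omega> (two_phase \<kappa> A) f u"
    and w: "weak_solution m \<alpha> \<Omega> (two_phase \<kappa> (A \<union> C)) f w"
  defines "R \<equiv> \<lambda>i x. D w i x - D u i x"
  shows "\<And>\<phi>. \<phi> \<in> Hm0 m \<Omega> \<Longrightarrow> (LINT x|M. (w x - u x) * \<phi> x) + \<alpha> * tform W M (two_phase \<kappa> (A \<union> C)) R (D \<phi>)
      = \<alpha> * (1 - \<kappa>) * tform W M (indicator B) (D u) (D \<phi>)"
    and "tnrm W M R \<le> tnrm W M (restr B (D u)) / \<kappa>"
    and "(nrm M (\<lambda>x. w x - u x))\<^sup>2 \<le> \<alpha> * (tnrm W M (restr B (D u)))\<^sup>2 / \<kappa>"
proof -
  have H: "u \<in> Hm0 m \<Omega>" "w \<in> Hm0 m \<Omega>" using u w by (auto simp: weak_solution_def)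
  note t = tsqint_D[OF Hm0_Hm[OF H(1)]] tsqint_D[OF Hm0_Hm[OF H(2)]]
  note q = Hm_sqint[OF Hm0_Hm[OF H(1)]] Hm_sqint[OF Hm0_Hm[OF H(2)]]
  have tR: "tsqint W M R" unfolding R_def by (rule tsqint_diff[OF t(2,1)])
  note c1 = bdd_coeff_two_phase[OF m(1) \<kappa>] and c2 = bdd_coeff_two_phase[OF sets.Un[OF m(1,3)] \<kappa>]
  show eq: "(LINT x|M. (w x - u x) * \<phi> x) + \<alpha> * tform W M (two_phase \<kappa> (A \<union> C)) R (D \<phi>)
      = \<alpha> * (1 - \<kappa>) * tform W M (indicator B) (D u) (D \<phi>)" if \<phi>: "\<phi> \<in> Hm0 m \<Omega>" for \<phi>
  proof -
    note t\<phi> = tsqint_D[OF Hm0_Hm[OF \<phi>]] and q\<phi> = Hm_sqint[OF Hm0_Hm[OF \<phi>]]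
    have 1: "(LINT x|M. (w x - u x) * \<phi> x) = (LINT x|M. w x * \<phi> x) - (LINT x|M. u x * \<phi> x)"
      using sqint_mult[OF q(1) q\<phi>] sqint_mult[OF q(2) q\<phi>] by (simp add: left_diff_distrib)
    have 2: "tform W M (two_phase \<kappa> (A \<union> C)) R (D \<phi>)
       = tform W M (two_phase \<kappa> (A \<union> C)) (D w) (D \<phi>) - tform W M (two_phase \<kappa> (A \<union> C)) (D u) (D \<phi>)"
      unfolding R_def by (rule tform_diff_left[OF c2 t\<phi> t(2,1)])
    have "\<alpha> * tform W M (two_phase \<kappa> (A \<union> C)) R (D \<phi>)
       = \<alpha> * tform W M (two_phase \<kappa> (A \<union> C)) (D w) (D \<phi>) - \<alpha> * tform W M (two_phase \<kappa> A) (D u) (D \<phi>)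
         + \<alpha> * (1 - \<kappa>) * tform W M (indicator B) (D u) (D \<phi>)"
      unfolding 2 tform_two_phase_union(1)[OF \<kappa> m C dj t(1) t\<phi>] by (simp add: algebra_simps)
    then show ?thesis
      using 1 weak_solution_tform[OF u c1 \<phi>] weak_solution_tform[OF w c2 \<phi>] by linarith
  qed
  let ?N = "tnrm W M (restr B (D u))"
  have "(nrm M (\<lambda>x. w x - u x))\<^sup>2 + \<alpha> * tform W M (two_phase \<kappa> (A \<union> C)) R R = \<alpha> * (1 - \<kappa>) * tform W M (indicator B) (D u) R"
  proof -
    have 1: "(nrm M (\<lambda>x. w x - u x))\<^sup>2 = (LINT x|M. (w x - u x) * w x) - (LINT x|M. (w x - u x) * u x)"
    proof -
      have "(\<lambda>x. (w x - u x)\<^sup>2) = (\<lambda>x. (w x - u x) * w x - (w x - u x) * u x)"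
        by (auto simp: power2_eq_square algebra_simps)
      then show ?thesis
        unfolding nrm_sq using sqint_mult[OF sqint_diff[OF q(2,1)] q(2)] sqint_mult[OF sqint_diff[OF q(2,1)] q(1)] by simp
    qed
    have 2: "tform W M (two_phase \<kappa> (A \<union> C)) R R
       = tform W M (two_phase \<kappa> (A \<union> C)) R (D w) - tform W M (two_phase \<kappa> (A \<union> C)) R (D u)"
      by (subst (2) R_def) (rule tform_diff_right[OF c2 tR t(2,1)])
    have 3: "tform W M (indicator B) (D u) R = tform W M (indicator B) (D u) (D w) - tform W M (indicator B) (D u) (D u)"
      unfolding R_def by (rule tform_diff_right[OF bdd_coeff_indicator[OF m(2)] t(1) t(2,1)])
    show ?thesis using eq[OF H(1)] eq[OF H(2)] unfolding 1 2 3 by (simp add: algebra_simps)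
  qed
  also have "\<dots> \<le> \<alpha> * (?N * tnrm W M R)"
  proof -
    let ?x = "tform W M (indicator B) (D u) R"
    have "(1 - \<kappa>) * ?x \<le> (1 - \<kappa>) * \<bar>?x\<bar>" using \<kappa> by (intro mult_left_mono) auto
    also have "\<dots> \<le> \<bar>?x\<bar>" using \<kappa> by (intro mult_left_le_one_le) auto
    also have "\<dots> \<le> ?N * tnrm W M R" by (rule tform_indicator_bound[OF m(2) t(1) tR])
    finally have "\<alpha> * ((1 - \<kappa>) * ?x) \<le> \<alpha> * (?N * tnrm W M R)" using \<alpha> by (intro mult_left_mono) auto
    then show ?thesis by (simp add: mult.assoc)
  qed
  finally have E: "(nrm M (\<lambda>x. w x - u x))\<^sup>2 + \<alpha> * tform W M (two_phase \<kappa> (A \<union> C)) R R \<le> \<alpha> * (?N * tnrm W M R)" .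
  have L: "\<kappa> * (tnrm W M R)\<^sup>2 \<le> tform W M (two_phase \<kappa> (A \<union> C)) R R"
    by (rule tform_lower[OF c2 _ tR]) (use \<kappa> in \<open>auto simp: two_phase_def\<close>)
  have "\<alpha> * (\<kappa> * (tnrm W M R)\<^sup>2) \<le> \<alpha> * (?N * tnrm W M R)"
    using E mult_left_mono[OF L less_imp_le[OF \<alpha>]] zero_le_power2[of "nrm M (\<lambda>x. w x - u x)"] by linarith
  then have "tnrm W M R * (\<kappa> * tnrm W M R) \<le> tnrm W M R * ?N"
    using \<alpha> by (simp add: power2_eq_square mult_ac)
  then have "\<kappa> * tnrm W M R \<le> ?N"
    using tnrm_nonneg[of W M R] by (cases "tnrm W M R = 0") auto
  then show R: "tnrm W M R \<le> ?N / \<kappa>" using \<kappa> by (simp add: field_simps)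
  have "0 \<le> \<alpha> * tform W M (two_phase \<kappa> (A \<union> C)) R R"
    using L \<kappa> \<alpha> by (intro mult_nonneg_nonneg order_trans[OF _ L]) auto
  then have "(nrm M (\<lambda>x. w x - u x))\<^sup>2 \<le> \<alpha> * (?N * tnrm W M R)" using E by linarith
  also have "\<dots> \<le> \<alpha> * (?N * (?N / \<kappa>))" using \<alpha> R by (intro mult_left_mono) auto
  finally show "(nrm M (\<lambda>x. w x - u x))\<^sup>2 \<le> \<alpha> * ?N\<^sup>2 / \<kappa>" by (simp add: power2_eq_square)
qed

text \<open>Subtracting the polynomial leaves a right-hand side carried by \<open>A\<close>, because a constant tensor field is orthogonal
  to the derivatives of functions with zero boundary values.\<close>

lemma corrector_equation:
  assumes \<kappa>: "0 < \<kappa>" "\<kappa> < 1" and m: "0 < m" and A: "A \<in> sets lebesgue" and i: "i \<in> W"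
    and V: "weak_solution_V m \<Omega> (two_phase \<kappa> A) (V_poly i) V"
  defines "s \<equiv> \<lambda>x. V x - V_poly i x"
  shows "s \<in> Hm0 m \<Omega>"
    and "\<And>j. j \<in> W \<Longrightarrow> AE x in M. D V j x = D s j x + V_grad i j"
    and "\<And>\<phi>. \<phi> \<in> Hm0 m \<Omega> \<Longrightarrow> tform W M (two_phase \<kappa> A) (D s) (D \<phi>)
       = (1 - \<kappa>) * tform W M (indicator A) (\<lambda>j _. V_grad i j) (D \<phi>)"
proof -
  have VH: "V \<in> Hm m \<Omega>" and sH: "s \<in> Hm0 m \<Omega>" using V by (auto simp: weak_solution_V_def s_def)
  show "s \<in> Hm0 m \<Omega>" by (rule sH)
  note PH = Hm_smooth[OF open_domain bounded_domain smooth_V_poly[of i], of m]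
  show ae: "AE x in M. D V j x = D s j x + V_grad i j" if j: "j \<in> W" for j
  proof -
    have l: "length j \<le> m" "length j = length i" using i j by (auto simp: words_def)
    have "AE x in M. D s j x = D V j x - D (V_poly i) j x"
      unfolding s_def by (rule weak_partial_diff_AE(2)[OF open_domain bounded_domain VH PH l(1)])
    moreover have "AE x in M. D (V_poly i) j x = partials j (V_poly i) x"
      by (rule weak_partial_smooth_AE[OF open_domain bounded_domain smooth_V_poly])
    ultimately show ?thesis
      by eventually_elim (simp add: partials_V_poly[OF l(2)])
  qed
  fix \<phi> assume \<phi>: "\<phi> \<in> Hm0 m \<Omega>"
  let ?T = "\<lambda>j (_::plane). V_grad i j"
  note c = bdd_coeff_two_phase[OF A \<kappa>]
  note tV = tsqint_D[OF VH] and ts = tsqint_D[OF Hm0_Hm[OF sH]] and t\<phi> = tsqint_D[OF Hm0_Hm[OF \<phi>]]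
  have "0 = tform W M (two_phase \<kappa> A) (D V) (D \<phi>)"
    using V \<phi> tdot_tform[OF c tV t\<phi>] by (auto simp: weak_solution_V_def)
  also have "\<dots> = tform W M (two_phase \<kappa> A) (\<lambda>j x. D s j x + ?T j x) (D \<phi>)"
    by (rule tform_cong_AE) (use c tV ts t\<phi> tsqint_add[OF ts tsqint_const] ae in \<open>auto simp: bdd_coeff_def\<close>)
  also have "\<dots> = tform W M (two_phase \<kappa> A) (D s) (D \<phi>) + tform W M (two_phase \<kappa> A) ?T (D \<phi>)"
    by (rule tform_add_left[OF c t\<phi> ts tsqint_const])
  also have "tform W M (two_phase \<kappa> A) ?T (D \<phi>) = - ((1 - \<kappa>) * tform W M (indicator A) ?T (D \<phi>))"
    using tform_one_split[OF A \<kappa> tsqint_const t\<phi>, of "V_grad i"] integral_const_grad_zero[OF \<phi> m, of "V_grad i"] by simp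
  finally show "tform W M (two_phase \<kappa> A) (D s) (D \<phi>) = (1 - \<kappa>) * tform W M (indicator A) ?T (D \<phi>)" by simp
qed

text \<open>On a small ball around \<open>y\<close> the weak derivatives coincide with the classical ones, which are continuous at \<open>y\<close>.\<close>

lemma field_near_point:
  fixes A :: "nat \<Rightarrow> plane set" and y :: plane
  defines "\<mu> \<equiv> \<lambda>n. measure lebesgue (A n)"
  assumes u: "u \<in> Hm m \<Omega>" and U: "open U" "y \<in> U" "y \<in> \<Omega>" "C_k_on m u U"
    and A: "\<And>n. A n \<in> sets lebesgue" "\<And>n. A n \<subseteq> \<Omega>" "\<And>n. 0 < \<mu> n"
    and small: "\<And>\<rho>. 0 < \<rho> \<Longrightarrow> \<forall>\<^sub>F n in sequentially. A n \<subseteq> ball y \<rho>"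
  shows "(\<lambda>n. tnrm W M (restr (A n) (\<lambda>i x. D u i x - partials i u y)) / sqrt (\<mu> n)) \<longlonglongrightarrow> 0"
proof (rule LIMSEQ_I)
  fix e :: real assume e: "0 < e"
  define \<delta> where "\<delta> = e / (2 * (real (card W) + 1))"
  have \<delta>: "0 < \<delta>" "real (card W) * \<delta> < e"
    using e by (auto simp: \<delta>_def field_simps add_pos_nonneg intro: add_nonneg_pos)
  have "\<forall>i. \<exists>r. i \<in> W \<longrightarrow> 0 < r \<and> (\<forall>x\<in>U. dist x y < r \<longrightarrow> \<bar>partials i u x - partials i u y\<bar> < \<delta>)"
  proof (intro allI)
    fix i
    show "\<exists>r. i \<in> W \<longrightarrow> 0 < r \<and> (\<forall>x\<in>U. dist x y < r \<longrightarrow> \<bar>partials i u x - partials i u y\<bar> < \<delta>)"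
    proof (cases "i \<in> W")
      case True
      then have "continuous_on U (partials i u)" using U(4) by (auto simp: C_k_on_def words_def)
      then show ?thesis using U(2) \<delta>(1) unfolding continuous_on_iff dist_real_def by meson
    qed simp
  qed
  from choice[OF this] obtain r where r: "\<forall>i. i \<in> W \<longrightarrow> 0 < r i \<and> (\<forall>x\<in>U. dist x y < r i \<longrightarrow> \<bar>partials i u x - partials i u y\<bar> < \<delta>)" ..
  obtain r0 where r0: "0 < r0" "ball y r0 \<subseteq> U \<inter> \<Omega>"
    using openE[OF open_Int[OF U(1) open_domain], of y] U by auto
  define q where "q = Min (insert r0 (r ` W))"
  have q: "0 < q" "q \<le> r0" "\<And>i. i \<in> W \<Longrightarrow> q \<le> r i"
    using r r0(1) by (auto simp: q_def Min_gr_iff)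
  let ?B = "ball y q"
  have B: "?B \<subseteq> U" "?B \<subseteq> \<Omega>" using r0(2) q(2) by auto
  have near: "\<bar>partials i u x - partials i u y\<bar> \<le> \<delta>" if "i \<in> W" "x \<in> ?B" for i x
  proof -
    have "x \<in> U" "dist x y < r i" using that q(3)[OF that(1)] B by (auto simp: dist_commute)
    then show ?thesis using r that(1) by (auto intro: less_imp_le)
  qed
  have C: "C_k_on m u ?B"
    using U(4) B(1) unfolding C_k_on_def by (meson continuous_on_subset subsetD)
  define X where "X i x = (if x \<in> ?B then partials i u x - partials i u y else 0)" for i x
  have ae: "AE x in M. x \<in> ?B \<longrightarrow> D u i x - partials i u y = X i x" if i: "i \<in> W" for i
  proof -
    have l: "length i \<le> m" using i by (simp add: words_def)
    have bd: "\<bar>partials i u x\<bar> \<le> \<bar>partials i u y\<bar> + \<delta>" if "x \<in> ?B" for x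
      using near[OF i that] by linarith
    have "AE x in lebesgue_on ?B. D u i x = partials i u x"
      by (rule weak_partial_classical[OF open_domain bounded_domain open_ball B(2) Hm_weak_partial(1)[OF u l] C l bd])
    then have "AE x in lebesgue. x \<in> ?B \<longrightarrow> D u i x = partials i u x"
      by (simp add: AE_restrict_space_iff)
    then have "AE x in lebesgue. x \<in> \<Omega> \<longrightarrow> (x \<in> ?B \<longrightarrow> D u i x - partials i u y = X i x)"
      by eventually_elim (simp add: X_def)
    then show ?thesis using domain_lebesgue by (simp add: AE_restrict_space_iff)
  qed
  have Xt: "tsqint W M X"
    unfolding tsqint_def
  proof
    fix i assume i: "i \<in> W"
    have "continuous_on ?B (partials i u)" using C i by (auto simp: C_k_on_def words_def)
    then have "continuous_on ?B (\<lambda>x. partials i u x - partials i u y)" by (intro continuous_intros)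
    then have "(\<lambda>x. partials i u x - partials i u y) \<in> borel_measurable (lebesgue_on ?B)"
      by (rule continuous_imp_measurable_on_sets_lebesgue) auto
    then have "(\<lambda>x. if x \<in> ?B then partials i u x - partials i u y else 0) \<in> borel_measurable lebesgue"
      by (subst (asm) borel_measurable_if[symmetric]) auto
    then have m: "X i \<in> borel_measurable M"
      unfolding X_def[abs_def] by (rule measurable_restrict_space1)
    show "sqint M (X i)"
      by (rule nrm_le_of_bounded(1)[OF finite_measure_open_bounded[OF bounded_domain open_domain] m, of \<delta>])
        (use near[OF i] \<delta>(1) in \<open>auto simp: X_def\<close>)
  qed
  have Ut: "tsqint W M (\<lambda>i x. D u i x - partials i u y)"
    by (rule tsqint_diff[OF tsqint_D[OF u] tsqint_const])
  have "\<forall>\<^sub>F n in sequentially. norm (tnrm W M (restr (A n) (\<lambda>i x. D u i x - partials i u y)) / sqrt (\<mu> n) - 0) < e"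
    using small[OF q(1)]
  proof eventually_elim
    case (elim n)
    have "tnrm W M (restr (A n) (\<lambda>i x. D u i x - partials i u y)) = tnrm W M (restr (A n) X)"
      unfolding tnrm_def
    proof (rule L2_set_cong[OF refl], rule nrm_cong_AE)
      fix i assume i: "i \<in> W"
      show "AE x in M. restr (A n) (\<lambda>i x. D u i x - partials i u y) i x = restr (A n) X i x"
        using ae[OF i] by eventually_elim (use elim in \<open>auto simp: restr_def indicator_def\<close>)
    qed (use tsqint_restr[OF A(1) Xt, of n] tsqint_restr[OF A(1) Ut, of n] in \<open>auto simp: tsqint_def sqint_def\<close>)
    also have "\<dots> \<le> real (card W) * \<delta> * sqrt (\<mu> n)"
      unfolding \<mu>_def
      by (rule restr_bounded[OF A(1,2) Xt]) (use near \<delta>(1) in \<open>auto simp: X_def\<close>)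
    finally have "tnrm W M (restr (A n) (\<lambda>i x. D u i x - partials i u y)) / sqrt (\<mu> n) \<le> real (card W) * \<delta>"
      using A(3)[of n] by (simp add: field_simps)
    then show ?case
      using \<delta>(2) A(3)[of n] tnrm_nonneg[of W M] by (simp add: less_imp_le abs_of_nonneg)
  qed
  then show "\<exists>no. \<forall>n\<ge>no. norm (tnrm W M (restr (A n) (\<lambda>i x. D u i x - partials i u y)) / sqrt (\<mu> n) - 0) < e"
    by (simp add: eventually_sequentially)
qed

end

section \<open>The asymptotic expansion\<close>

context bounded_domain
begin

lemma integral_indicator_M:
  assumes "A \<in> sets lebesgue" "A \<subseteq> \<Omega>"
  shows "(LINT x|M. indicator A x) = measure lebesgue A"
proof -
  have "(LINT x|M. indicator A x :: real) = (LINT x|M. (indicator A x)\<^sup>2)"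
    by (intro Bochner_Integration.integral_cong) (auto simp: indicator_def)
  also have "\<dots> = (nrm M (indicator A))\<^sup>2" by (rule nrm_sq[symmetric])
  also have "\<dots> = measure lebesgue A"
    by (simp add: nrm_indicator(2)[OF open_domain bounded_domain assms])
  finally show ?thesis .
qed

text \<open>The equation of the state difference is tested with the corrector and that of the corrector with the state difference.
  Both contain the pairing of the two fields, but with coefficients that differ on \<open>K\<close>.\<close>

lemma corrector_reciprocity:
  assumes \<kappa>: "0 < \<kappa>" "\<kappa> < 1" and \<alpha>: "0 < \<alpha>" and ms: "K \<in> sets lebesgue" "A \<in> sets lebesgue" "C \<in> sets lebesgue"
    and C: "AE x in lebesgue. x \<in> C \<longleftrightarrow> x \<in> A" and dj: "K \<inter> A = {}"
    and u: "weak_solution m \<alpha> \<Omega> (two_phase \<kappa> K) f u"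
    and w: "weak_solution m \<alpha> \<Omega> (two_phase \<kappa> (K \<union> C)) f w"
    and s: "s \<in> Hm0 m \<Omega>"
    and eq: "\<And>\<phi>. \<phi> \<in> Hm0 m \<Omega> \<Longrightarrow> tform W M (two_phase \<kappa> A) (D s) (D \<phi>)
       = (1 - \<kappa>) * tform W M (indicator A) (\<lambda>j _. T j) (D \<phi>)"
  defines "R \<equiv> \<lambda>i x. D w i x - D u i x"
  shows "tform W M (indicator A) (D u) (D s) - tform W M (indicator A) (\<lambda>j _. T j) R
    = (LINT x|M. (w x - u x) * s x) / (\<alpha> * (1 - \<kappa>)) - tform W M (indicator K) R (D s)"
proof -
  have H: "u \<in> Hm0 m \<Omega>" "w \<in> Hm0 m \<Omega>" using u w by (auto simp: weak_solution_def)
  note t = tsqint_D[OF Hm0_Hm[OF H(1)]] tsqint_D[OF Hm0_Hm[OF H(2)]] and ts = tsqint_D[OF Hm0_Hm[OF s]]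
  have tR: "tsqint W M R" unfolding R_def by (rule tsqint_diff[OF t(2,1)])
  note c = bdd_coeff_two_phase[OF ms(2) \<kappa>]
  have 1: "(LINT x|M. (w x - u x) * s x) + \<alpha> * tform W M (two_phase \<kappa> (K \<union> C)) R (D s)
      = \<alpha> * (1 - \<kappa>) * tform W M (indicator A) (D u) (D s)"
    unfolding R_def by (rule state_difference(1)[OF \<kappa> \<alpha> ms C dj u w s])
  have 2: "tform W M (two_phase \<kappa> (K \<union> C)) R (D s) = tform W M (two_phase \<kappa> A) R (D s) - (1 - \<kappa>) * tform W M (indicator K) R (D s)"
    by (rule tform_two_phase_union(2)[OF \<kappa> ms C dj tR ts])
  have "tform W M (two_phase \<kappa> A) (D s) R = tform W M (two_phase \<kappa> A) (D s) (D w) - tform W M (two_phase \<kappa> A) (D s) (D u)"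
    unfolding R_def by (rule tform_diff_right[OF c ts t(2,1)])
  moreover have "tform W M (indicator A) (\<lambda>j _. T j) R
     = tform W M (indicator A) (\<lambda>j _. T j) (D w) - tform W M (indicator A) (\<lambda>j _. T j) (D u)"
    unfolding R_def by (rule tform_diff_right[OF bdd_coeff_indicator[OF ms(2)] tsqint_const t(2,1)])
  ultimately have 3: "tform W M (two_phase \<kappa> A) R (D s) = (1 - \<kappa>) * tform W M (indicator A) (\<lambda>j _. T j) R"
    unfolding eq[OF H(1)] eq[OF H(2)] by (subst tform_commute) (simp add: right_diff_distrib)
  have a: "\<alpha> * (1 - \<kappa>) \<noteq> 0" using \<alpha> \<kappa> by simp
  define X Y Z I where "X = tform W M (indicator A) (D u) (D s)" and "Y = tform W M (indicator A) (\<lambda>j _. T j) R"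
    and "Z = tform W M (indicator K) R (D s)" and "I = (LINT x|M. (w x - u x) * s x)"
  define q where "q = \<alpha> * (1 - \<kappa>)"
  have "I + \<alpha> * ((1 - \<kappa>) * Y - (1 - \<kappa>) * Z) = \<alpha> * (1 - \<kappa>) * X"
    using 1 unfolding 2 3 X_def Y_def Z_def I_def .
  then have "I + q * Y - q * Z = q * X" unfolding q_def by (simp add: algebra_simps)
  moreover have "q \<noteq> 0" using a by (simp add: q_def)
  ultimately have "X - Y = I / q - Z" by (simp add: field_simps)
  then show ?thesis unfolding X_def Y_def Z_def I_def q_def .
qed

text \<open>With \<open>R = D w - D u\<close> and the constant tensor \<open>E\<close>, the integrand is \<open>R \<cdot> E + E \<cdot> E\<close> up to terms containing \<open>D u - E\<close>,
  which are small on \<open>A n\<close>. Reciprocity converts \<open>R \<cdot> E\<close> into \<open>\<Sum>\<^sub>i E\<^sub>i E \<cdot> D s\<^sub>i\<close>, whose mean tends to \<open>Pol E \<cdot> E - E \<cdot> E\<close>.\<close>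

lemma polarization_limit:
  fixes A C :: "nat \<Rightarrow> plane set" and y :: plane and w :: "nat \<Rightarrow> plane \<Rightarrow> real" and Pol :: tensor2
    and V :: "nat \<Rightarrow> word2 \<Rightarrow> plane \<Rightarrow> real"
  defines "\<mu> \<equiv> \<lambda>n. measure lebesgue (A n)"
  assumes m: "2 \<le> m" and \<kappa>: "0 < \<kappa>" "\<kappa> < 1" and \<alpha>: "0 < \<alpha>"
    and K: "K \<in> sets lebesgue" "0 < \<rho>" "\<And>x. x \<in> K \<Longrightarrow> 4 * \<rho> \<le> dist x y"
    and A: "\<And>n. A n \<in> sets lebesgue" "\<And>n. A n \<subseteq> \<Omega>" "\<And>n. 0 < \<mu> n" "\<mu> \<longlonglongrightarrow> 0" "\<And>n. K \<inter> A n = {}"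
    and C: "\<And>n. C n \<in> sets lebesgue" "\<And>n. AE x in lebesgue. x \<in> C n \<longleftrightarrow> x \<in> A n"
    and small: "\<And>\<rho>. 0 < \<rho> \<Longrightarrow> \<forall>\<^sub>F n in sequentially. A n \<subseteq> ball y \<rho>"
    and u: "weak_solution m \<alpha> \<Omega> (two_phase \<kappa> K) f u"
    and U: "open U" "y \<in> U" "y \<in> \<Omega>" "C_k_on m u U"
    and w: "\<And>n. weak_solution m \<alpha> \<Omega> (two_phase \<kappa> (K \<union> C n)) f (w n)"
    and V: "\<And>n i. i \<in> W \<Longrightarrow> weak_solution_V m \<Omega> (two_phase \<kappa> (A n)) (V_poly i) (V n i)"
    and Pol: "\<And>i j. i \<in> W \<Longrightarrow> j \<in> W \<Longrightarrow>
       (\<lambda>n. (LINT x|lebesgue_on (A n). D (V n i) j x) / \<mu> n) \<longlonglongrightarrow> Pol i j"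
  shows "(\<lambda>n. tform W M (indicator (A n)) (D (w n)) (D u) / \<mu> n) \<longlonglongrightarrow> tquad m Pol (\<lambda>i. partials i u y)"
proof -
  define E where "E i = partials i u y" for i
  let ?E = "\<lambda>i (_::plane). E i"
  let ?P = "\<lambda>i x. D u i x - E i"
  let ?ind = "\<lambda>n. indicator (A n) :: plane \<Rightarrow> real"
  define R where "R n = (\<lambda>i x. D (w n) i x - D u i x)" for n
  define s where "s i n = (\<lambda>x. V n i x - V_poly i x)" for i n
  have m0: "0 < m" using m by simp
  have uH: "u \<in> Hm m \<Omega>" and wH: "\<And>n. w n \<in> Hm m \<Omega>"
    using u w by (auto simp: weak_solution_def intro: Hm0_Hm)
  note tu = tsqint_D[OF uH] and tw = tsqint_D[OF wH]
  have tP: "tsqint W M ?P" by (rule tsqint_diff[OF tu tsqint_const])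
  have tR: "tsqint W M (R n)" for n unfolding R_def by (rule tsqint_diff[OF tw tu])
  note ci = bdd_coeff_indicator[OF A(1)]
  have r: "0 < sqrt (\<mu> n)" for n using A(3) by simp
  have near: "(\<lambda>n. tnrm W M (restr (A n) ?P) / sqrt (\<mu> n)) \<longlonglongrightarrow> 0"
    unfolding \<mu>_def E_def by (rule field_near_point[OF uH U A(1,2) A(3)[unfolded \<mu>_def] small])
  obtain H where H: "\<And>n. tnrm W M (restr (A n) ?P) \<le> H * sqrt (\<mu> n)"
  proof -
    have "Bseq (\<lambda>n. tnrm W M (restr (A n) ?P) / sqrt (\<mu> n))"
      using near by (intro convergent_imp_Bseq convergentI)
    then obtain H where H: "\<forall>n. norm (tnrm W M (restr (A n) ?P) / sqrt (\<mu> n)) \<le> H" by (elim BseqE) blast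
    have "tnrm W M (restr (A n) ?P) \<le> H * sqrt (\<mu> n)" for n
    proof -
      have "tnrm W M (restr (A n) ?P) / sqrt (\<mu> n) \<le> H"
        using H[rule_format, of n] abs_ge_self[of "tnrm W M (restr (A n) ?P) / sqrt (\<mu> n)"]
        unfolding real_norm_def by linarith
      then show ?thesis using r[of n] by (simp add: pos_divide_le_eq)
    qed
    then show ?thesis using that by blast
  qed
  define b where "b = real (card W) * (\<Sum>i\<in>W. \<bar>E i\<bar>)"
  have Eb: "tnrm W M (restr (A n) ?E) \<le> b * sqrt (\<mu> n)" for n
    unfolding b_def \<mu>_def
    by (rule restr_bounded[OF A(1,2) tsqint_const]) (auto intro!: member_le_sum sum_nonneg)
  define c where "c = b + H"
  have ub: "tnrm W M (restr (A n) (D u)) \<le> c * sqrt (\<mu> n)" for n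
  proof -
    have "restr (A n) (D u) = (\<lambda>i x. restr (A n) ?E i x + restr (A n) ?P i x)"
      by (simp add: restr_def right_diff_distrib)
    then have "tnrm W M (restr (A n) (D u)) \<le> tnrm W M (restr (A n) ?E) + tnrm W M (restr (A n) ?P)"
      using tnrm_triangle[OF tsqint_restr[OF A(1) tsqint_const] tsqint_restr[OF A(1) tP], of n E n] by simp
    then show ?thesis using Eb[of n] H[of n] by (simp add: c_def distrib_right)
  qed
  have c0: "0 \<le> c"
    using order_trans[OF tnrm_nonneg ub[of 0]] r[of 0] by (simp add: zero_le_mult_iff)
  note sd = state_difference[OF \<kappa> \<alpha> K(1) A(1) C(1) C(2) A(5) u w]
  have Rb: "tnrm W M (R n) \<le> (c / \<kappa>) * sqrt (\<mu> n)" for n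
  proof -
    have "tnrm W M (R n) \<le> tnrm W M (restr (A n) (D u)) / \<kappa>" unfolding R_def by (rule sd(2))
    also have "\<dots> \<le> c * sqrt (\<mu> n) / \<kappa>" using ub[of n] \<kappa> by (intro divide_right_mono) auto
    finally show ?thesis by simp
  qed
  have rb: "nrm M (\<lambda>x. w n x - u x) \<le> (sqrt (\<alpha> / \<kappa>) * c) * sqrt (\<mu> n)" for n
  proof (rule power2_le_imp_le)
    have "(nrm M (\<lambda>x. w n x - u x))\<^sup>2 \<le> \<alpha> * (tnrm W M (restr (A n) (D u)))\<^sup>2 / \<kappa>" by (rule sd(3))
    also have "\<dots> \<le> \<alpha> * (c * sqrt (\<mu> n))\<^sup>2 / \<kappa>"
      using \<alpha> \<kappa> by (intro divide_right_mono mult_left_mono power_mono ub) auto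
    also have "\<dots> = ((sqrt (\<alpha> / \<kappa>) * c) * sqrt (\<mu> n))\<^sup>2"
      using \<alpha> \<kappa> by (simp add: power_mult_distrib)
    finally show "(nrm M (\<lambda>x. w n x - u x))\<^sup>2 \<le> ((sqrt (\<alpha> / \<kappa>) * c) * sqrt (\<mu> n))\<^sup>2" .
    show "0 \<le> (sqrt (\<alpha> / \<kappa>) * c) * sqrt (\<mu> n)" using \<alpha> \<kappa> c0 r[of n] by simp
  qed
  have corr: "s i n \<in> Hm0 m \<Omega>" "\<And>j. j \<in> W \<Longrightarrow> AE x in M. D (V n i) j x = D (s i n) j x + V_grad i j"
    "\<And>\<phi>. \<phi> \<in> Hm0 m \<Omega> \<Longrightarrow> tform W M (two_phase \<kappa> (A n)) (D (s i n)) (D \<phi>)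
       = (1 - \<kappa>) * tform W M (?ind n) (\<lambda>j _. V_grad i j) (D \<phi>)" if i: "i \<in> W" for i n
    unfolding s_def using corrector_equation[OF \<kappa> m0 A(1) i V[OF i]] by blast+
  have VH: "V n i \<in> Hm m \<Omega>" if "i \<in> W" for i n using V[OF that] by (simp add: weak_solution_V_def)
  have T_R: "(\<lambda>n. tform W M (?ind n) (R n) (\<lambda>j _. V_grad i j) / \<mu> n) \<longlonglongrightarrow> (\<Sum>j\<in>W. E j * (Pol i j - V_grad i j))" if i: "i \<in> W" for i
  proof -
    let ?T = "\<lambda>j (_::plane). V_grad i j"
    note sH = corr(1)[OF i]
    note ts = tsqint_D[OF Hm0_Hm[OF sH]]
    have sv: "(\<lambda>n. nrm M (s i n) / sqrt (\<mu> n)) \<longlonglongrightarrow> 0"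
      unfolding \<mu>_def
      by (rule corrector_vanishes(1)[OF m \<kappa> A(1,2) A(3,4)[unfolded \<mu>_def] small sH corr(3)[OF i]])
    have sK: "(\<lambda>n. tnrm W M (restr K (D (s i n))) / sqrt (\<mu> n)) \<longlonglongrightarrow> 0"
      unfolding \<mu>_def
      by (rule corrector_vanishes(2)[OF m \<kappa> A(1,2) A(3,4)[unfolded \<mu>_def] small sH corr(3)[OF i] K])
    define b' where "b' = real (card W) * (\<Sum>j\<in>W. \<bar>V_grad i j\<bar>) / \<kappa>"
    have sb: "tnrm W M (D (s i n)) \<le> b' * sqrt (\<mu> n)" for n
      unfolding b'_def \<mu>_def
      by (rule corrector_energy[OF \<kappa> A(1,2) sH corr(3)[OF i sH]]) (auto intro!: member_le_sum sum_nonneg)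
    have i1: "(\<lambda>n. (LINT x|M. (w n x - u x) * s i n x) / \<mu> n) \<longlonglongrightarrow> 0"
      by (rule small_product_tendsto[OF A(3) _ rb nrm_nonneg sv])
        (rule Cauchy_Schwarz_sqint[OF sqint_diff[OF Hm_sqint[OF wH] Hm_sqint[OF uH]] Hm_sqint[OF Hm0_Hm[OF sH]]])
    have i2: "(\<lambda>n. tform W M (indicator K) (R n) (D (s i n)) / \<mu> n) \<longlonglongrightarrow> 0"
    proof (rule small_product_tendsto[OF A(3) _ Rb tnrm_nonneg sK])
      show "\<bar>tform W M (indicator K) (R n) (D (s i n))\<bar> \<le> tnrm W M (R n) * tnrm W M (restr K (D (s i n)))" for n
        using tform_indicator_bound[OF K(1) ts tR, of n n] by (simp add: tform_commute mult.commute)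
    qed
    have i3: "(\<lambda>n. tform W M (?ind n) ?P (D (s i n)) / \<mu> n) \<longlonglongrightarrow> 0"
    proof (rule small_product_tendsto[OF A(3) _ sb tnrm_nonneg near])
      show "\<bar>tform W M (?ind n) ?P (D (s i n))\<bar> \<le> tnrm W M (D (s i n)) * tnrm W M (restr (A n) ?P)" for n
        using tform_indicator_bound[OF A(1)[of n] tP ts[of n]] by (simp add: mult.commute)
    qed
    have vint: "(LINT x|M. ?ind n x * D (s i n) j x) = (LINT x|lebesgue_on (A n). D (V n i) j x) - V_grad i j * \<mu> n"
      if j: "j \<in> W" for j n
    proof -
      have q: "sqint M (D (V n i) j)" "sqint M (D (s i n) j)"
        using tsqint_D[OF VH[OF i]] ts j by (auto simp: tsqint_def)
      note ii = nrm_indicator(1)[OF open_domain bounded_domain A(1,2), of n]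
      have "(LINT x|lebesgue_on (A n). D (V n i) j x) = (LINT x|lebesgue. ?ind n x *\<^sub>R D (V n i) j x)"
        by (rule integral_restrict_space) (use A(1) in simp)
      also have "\<dots> = (LINT x|lebesgue. indicator \<Omega> x *\<^sub>R (?ind n x * D (V n i) j x))"
        using A(2)[of n] by (intro Bochner_Integration.integral_cong) (auto simp: indicator_def)
      also have "\<dots> = (LINT x|M. ?ind n x * D (V n i) j x)"
        by (rule integral_restrict_space[symmetric]) (use domain_lebesgue in simp)
      also have "\<dots> = (LINT x|M. ?ind n x * D (s i n) j x + V_grad i j * ?ind n x)"
      proof (rule integral_cong_AE)
        show "AE x in M. ?ind n x * D (V n i) j x = ?ind n x * D (s i n) j x + V_grad i j * ?ind n x"
          using corr(2)[OF i j, of n] by eventually_elim (simp add: algebra_simps)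
      qed (use q ii in \<open>auto simp: sqint_def intro!: borel_measurable_add borel_measurable_times\<close>)
      also have "\<dots> = (LINT x|M. ?ind n x * D (s i n) j x) + V_grad i j * (LINT x|M. ?ind n x)"
        using sqint_mult[OF ii q(2)] sqint_integrable_on[OF bounded_domain open_domain ii] by simp
      also have "(LINT x|M. ?ind n x) = \<mu> n"
        unfolding \<mu>_def by (rule integral_indicator_M[OF A(1,2)])
      finally show ?thesis by simp
    qed
    have i4: "(\<lambda>n. tform W M (?ind n) ?E (D (s i n)) / \<mu> n) \<longlonglongrightarrow> (\<Sum>j\<in>W. E j * (Pol i j - V_grad i j))"
    proof -
      have "tform W M (?ind n) ?E (D (s i n)) / \<mu> n
         = (\<Sum>j\<in>W. E j * ((LINT x|lebesgue_on (A n). D (V n i) j x) / \<mu> n - V_grad i j))" for n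
      proof -
        have "tform W M (?ind n) ?E (D (s i n)) = (\<Sum>j\<in>W. E j * (LINT x|M. ?ind n x * D (s i n) j x))"
          by (subst tform_commute) (rule tform_const_right)
        also have "\<dots> / \<mu> n = (\<Sum>j\<in>W. E j * ((LINT x|lebesgue_on (A n). D (V n i) j x) / \<mu> n - V_grad i j))"
        proof -
          have "(p - q * \<mu> n) / \<mu> n = p / \<mu> n - q" for p q :: real
            using A(3)[of n] by (simp add: field_simps)
          then show ?thesis
            unfolding sum_divide_distrib by (intro sum.cong refl) (simp only: vint times_divide_eq_right[symmetric])
        qed
        finally show ?thesis .
      qed
      then show ?thesis
        using Pol[OF i] by (auto intro!: tendsto_sum tendsto_mult tendsto_diff)
    qed
    have i5: "(\<lambda>n. tform W M (?ind n) (D u) (D (s i n)) / \<mu> n) \<longlonglongrightarrow> (\<Sum>j\<in>W. E j * (Pol i j - V_grad i j))"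
    proof -
      have "tform W M (?ind n) ?P (D (s i n)) = tform W M (?ind n) (D u) (D (s i n)) - tform W M (?ind n) ?E (D (s i n))" for n
        by (rule tform_diff_left[OF ci ts tu tsqint_const])
      then have "tform W M (?ind n) (D u) (D (s i n)) / \<mu> n
        = tform W M (?ind n) ?P (D (s i n)) / \<mu> n + tform W M (?ind n) ?E (D (s i n)) / \<mu> n" for n
        by (simp add: diff_divide_distrib)
      then show ?thesis using tendsto_add[OF i3 i4] by simp
    qed
    have "tform W M (?ind n) (R n) ?T / \<mu> n
      = tform W M (?ind n) (D u) (D (s i n)) / \<mu> n
        - ((LINT x|M. (w n x - u x) * s i n x) / \<mu> n / (\<alpha> * (1 - \<kappa>)) - tform W M (indicator K) (R n) (D (s i n)) / \<mu> n)" for n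
    proof -
      have "tform W M (?ind n) (D u) (D (s i n)) - tform W M (?ind n) ?T (R n)
        = (LINT x|M. (w n x - u x) * s i n x) / (\<alpha> * (1 - \<kappa>)) - tform W M (indicator K) (R n) (D (s i n))"
        unfolding R_def
        by (rule corrector_reciprocity[OF \<kappa> \<alpha> K(1) A(1) C(1) C(2) A(5) u w sH corr(3)[OF i]])
      then have "tform W M (?ind n) (R n) ?T = tform W M (?ind n) (D u) (D (s i n))
        - ((LINT x|M. (w n x - u x) * s i n x) / (\<alpha> * (1 - \<kappa>)) - tform W M (indicator K) (R n) (D (s i n)))"
        unfolding tform_commute[of W M "?ind n" "R n"] by linarith
      then show ?thesis by (simp only: diff_divide_distrib divide_divide_eq_left mult.commute)
    qed
    moreover have "(\<lambda>n. tform W M (?ind n) (D u) (D (s i n)) / \<mu> n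
        - ((LINT x|M. (w n x - u x) * s i n x) / \<mu> n / (\<alpha> * (1 - \<kappa>)) - tform W M (indicator K) (R n) (D (s i n)) / \<mu> n))
       \<longlonglongrightarrow> (\<Sum>j\<in>W. E j * (Pol i j - V_grad i j)) - (0 / (\<alpha> * (1 - \<kappa>)) - 0)"
      by (intro tendsto_diff i5 tendsto_divide i1 i2 tendsto_const) (use \<alpha> \<kappa> in simp)
    ultimately show ?thesis by simp
  qed
  have EV: "(\<Sum>i\<in>W. E i * V_grad i j) = E j" if j: "j \<in> W" for j
  proof -
    \<comment> \<open>symmetry of mixed derivatives is available up to order \<open>m\<close> only; the value \<open>0\<close> at words of any other length keeps \<open>E'\<close> symmetric\<close>
    define E' where "E' i = (if length i = m then E i else 0)" for i
    have sym: "E' i = E' k" if "mset i = mset k" for i k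
      using partials_mset[OF U(1,4) that _ U(2)] mset_eq_length[OF that] by (auto simp: E'_def E_def)
    have "(\<Sum>i\<in>W. E' i * V_grad i j) = E' j"
      by (rule V_grad_symmetric[OF sym]) (use j in \<open>auto simp: words_def\<close>)
    moreover have "(\<Sum>i\<in>W. E i * V_grad i j) = (\<Sum>i\<in>W. E' i * V_grad i j)"
      by (intro sum.cong) (auto simp: E'_def words_def)
    moreover have "E' j = E j" using j by (simp add: E'_def words_def)
    ultimately show ?thesis by simp
  qed
  have RE: "(\<lambda>n. tform W M (?ind n) (R n) ?E / \<mu> n) \<longlonglongrightarrow> (\<Sum>i\<in>W. E i * (\<Sum>j\<in>W. E j * (Pol i j - V_grad i j)))"
  proof -
    have "tform W M (?ind n) (R n) ?E = (\<Sum>i\<in>W. E i * tform W M (?ind n) (R n) (\<lambda>j _. V_grad i j))" for n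
    proof -
      let ?r = "\<lambda>j. LINT x|M. ?ind n x * R n j x"
      have "tform W M (?ind n) (R n) ?E = (\<Sum>j\<in>W. (\<Sum>i\<in>W. E i * V_grad i j) * ?r j)"
        unfolding tform_const_right by (intro sum.cong refl) (simp add: EV)
      also have "\<dots> = (\<Sum>j\<in>W. \<Sum>i\<in>W. E i * (V_grad i j * ?r j))"
        by (simp add: sum_distrib_right mult.assoc)
      also have "\<dots> = (\<Sum>i\<in>W. \<Sum>j\<in>W. E i * (V_grad i j * ?r j))" by (rule sum.swap)
      also have "\<dots> = (\<Sum>i\<in>W. E i * tform W M (?ind n) (R n) (\<lambda>j _. V_grad i j))"
        unfolding tform_const_right by (simp add: sum_distrib_left)
      finally show ?thesis .
    qed
    then have eq: "tform W M (?ind n) (R n) ?E / \<mu> n = (\<Sum>i\<in>W. E i * (tform W M (?ind n) (R n) (\<lambda>j _. V_grad i j) / \<mu> n))" for n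
      by (simp add: sum_divide_distrib)
    show ?thesis unfolding eq by (intro tendsto_sum tendsto_mult tendsto_const T_R)
  qed
  have RP: "(\<lambda>n. tform W M (?ind n) (R n) ?P / \<mu> n) \<longlonglongrightarrow> 0"
  proof (rule small_product_tendsto[OF A(3) _ Rb tnrm_nonneg near])
    show "\<bar>tform W M (?ind n) (R n) ?P\<bar> \<le> tnrm W M (R n) * tnrm W M (restr (A n) ?P)" for n
      using tform_indicator_bound[OF A(1)[of n] tP tR[of n]] by (simp add: tform_commute mult.commute)
  qed
  have uP: "(\<lambda>n. tform W M (?ind n) (D u) ?P / \<mu> n) \<longlonglongrightarrow> 0"
    by (rule small_product_tendsto[OF A(3) tform_indicator_bound2[OF A(1) tu tP] ub tnrm_nonneg near])
  have EP: "(\<lambda>n. tform W M (?ind n) ?E ?P / \<mu> n) \<longlonglongrightarrow> 0"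
    by (rule small_product_tendsto[OF A(3) tform_indicator_bound2[OF A(1) tsqint_const tP] Eb tnrm_nonneg near])
  have EE: "tform W M (?ind n) ?E ?E / \<mu> n = (\<Sum>j\<in>W. E j * E j)" for n
  proof -
    have "(LINT x|M. ?ind n x * E j) = E j * \<mu> n" for j
      using integral_indicator_M[OF A(1,2), of n] by (simp add: \<mu>_def)
    then have "tform W M (?ind n) ?E ?E = (\<Sum>j\<in>W. E j * (E j * \<mu> n))"
      by (simp only: tform_const_right)
    then show ?thesis
      using A(3)[of n] by (simp add: sum_divide_distrib)
  qed
  have "tform W M (?ind n) (D (w n)) (D u) / \<mu> n
    = tform W M (?ind n) (R n) ?E / \<mu> n + tform W M (?ind n) (R n) ?P / \<mu> n + tform W M (?ind n) (D u) ?P / \<mu> n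
      + tform W M (?ind n) ?E ?P / \<mu> n + (\<Sum>j\<in>W. E j * E j)" for n
  proof -
    have 1: "tform W M (?ind n) (R n) (D u) = tform W M (?ind n) (D (w n)) (D u) - tform W M (?ind n) (D u) (D u)"
      unfolding R_def by (rule tform_diff_left[OF ci tu tw tu])
    have 2: "tform W M (?ind n) (R n) ?P = tform W M (?ind n) (R n) (D u) - tform W M (?ind n) (R n) ?E"
      by (rule tform_diff_right[OF ci tR tu tsqint_const])
    have 3: "tform W M (?ind n) (D u) ?P = tform W M (?ind n) (D u) (D u) - tform W M (?ind n) (D u) ?E"
      by (rule tform_diff_right[OF ci tu tu tsqint_const])
    have 4: "tform W M (?ind n) ?E ?P = tform W M (?ind n) ?E (D u) - tform W M (?ind n) ?E ?E"
      by (rule tform_diff_right[OF ci tsqint_const tu tsqint_const])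
    have 5: "tform W M (?ind n) ?E (D u) = tform W M (?ind n) (D u) ?E" by (rule tform_commute)
    have "tform W M (?ind n) (D (w n)) (D u) = tform W M (?ind n) (R n) ?E + tform W M (?ind n) (R n) ?P
        + tform W M (?ind n) (D u) ?P + tform W M (?ind n) ?E ?P + tform W M (?ind n) ?E ?E"
      using 1 2 3 4 5 by linarith
    then show ?thesis by (simp only: add_divide_distrib EE)
  qed
  moreover have "(\<lambda>n. tform W M (?ind n) (R n) ?E / \<mu> n + tform W M (?ind n) (R n) ?P / \<mu> n + tform W M (?ind n) (D u) ?P / \<mu> n
      + tform W M (?ind n) ?E ?P / \<mu> n + (\<Sum>j\<in>W. E j * E j))
    \<longlonglongrightarrow> (\<Sum>i\<in>W. E i * (\<Sum>j\<in>W. E j * (Pol i j - V_grad i j))) + 0 + 0 + 0 + (\<Sum>j\<in>W. E j * E j)"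
    by (intro tendsto_add RE RP uP EP tendsto_const)
  moreover have "(\<Sum>i\<in>W. E i * (\<Sum>j\<in>W. E j * (Pol i j - V_grad i j))) + (\<Sum>j\<in>W. E j * E j) = tquad m Pol E"
  proof -
    have "(\<Sum>i\<in>W. E i * (\<Sum>j\<in>W. E j * (Pol i j - V_grad i j)))
      = (\<Sum>i\<in>W. \<Sum>j\<in>W. E i * Pol i j * E j) - (\<Sum>i\<in>W. \<Sum>j\<in>W. E j * (E i * V_grad i j))"
      by (simp add: sum_distrib_left right_diff_distrib sum_subtractf mult_ac)
    also have "(\<Sum>i\<in>W. \<Sum>j\<in>W. E j * (E i * V_grad i j)) = (\<Sum>j\<in>W. \<Sum>i\<in>W. E j * (E i * V_grad i j))"
      by (rule sum.swap)
    also have "\<dots> = (\<Sum>j\<in>W. E j * E j)"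
      unfolding sum_distrib_left[symmetric] by (intro sum.cong refl) (simp add: EV)
    finally show ?thesis by (simp add: tquad_def)
  qed
  ultimately show ?thesis by (simp add: E_def[abs_def])
qed

end

theorem theorem5p1:
  fixes m :: nat and \<alpha> \<kappa> \<delta>0 :: real
    and \<Omega> K L0 U :: "plane set" and y \<tau> :: plane
    and f u :: "plane \<Rightarrow> real" and u_eps :: "real \<Rightarrow> plane \<Rightarrow> real"
    and E :: "real set" and M :: tensor2
  assumes m: "m \<ge> 2" and \<alpha>: "\<alpha> > 0" and \<kappa>: "0 < \<kappa>" "\<kappa> < 1 / 2"
    and \<Omega>: "open \<Omega>" "connected \<Omega>" "bounded \<Omega>" "lipschitz_boundary \<Omega>"
    and f: "f \<in> Linf \<Omega>"
    and K: "closed K" "K \<subseteq> \<Omega>" "hausdorff_measure 2 K > 0"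
    and L0: "open L0" "connected L0" "smooth_boundary L0" "L0 \<subseteq> \<Omega> - K"
    and \<delta>0: "\<delta>0 > 0" "setdist (closure L0) (frontier \<Omega> \<union> K) \<ge> \<delta>0"
    and y: "y \<in> L0" and \<tau>: "norm \<tau> = 1"
    and u: "weak_solution m \<alpha> \<Omega> (two_phase \<kappa> K) f u"
    and u_Cm: "open U" "y \<in> U" "C_k_on m u U"
    and E: "E \<subseteq> admissible_eps L0 y \<tau>" "0 islimpt E"
    and u_eps: "\<And>\<epsilon>. \<epsilon> \<in> E \<Longrightarrow>
      weak_solution m \<alpha> \<Omega> (two_phase \<kappa> (K \<union> closure (Omega_eps y \<tau> \<epsilon>))) f (u_eps \<epsilon>)"
    and M: "polarization_tensor m \<kappa> \<Omega> y \<tau> E M"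
  shows "(\<lambda>\<epsilon>. J_fun m \<alpha> \<Omega> f (u_eps \<epsilon>) (two_phase \<kappa> (K \<union> closure (Omega_eps y \<tau> \<epsilon>)))
              - (J_fun m \<alpha> \<Omega> f u (two_phase \<kappa> K)
                 + 2 * \<epsilon> ^ 3 * \<alpha> * (\<kappa> - 1) * tquad m M (\<lambda>i. partials i u y)))
         \<in> o[at 0 within E](\<lambda>\<epsilon>. \<epsilon> ^ 3)"
proof -
  interpret bounded_domain \<Omega> m
    by unfold_locales (use \<Omega> in auto)
  let ?L = "lebesgue_on \<Omega>" and ?W = "words m"
  let ?A = "Omega_eps y \<tau>" and ?tq = "tquad m M (\<lambda>i. partials i u y)"
  let ?D = "\<lambda>u i. weak_partial \<Omega> i u"
  have \<kappa>1: "\<kappa> < 1" using \<kappa> by simp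
  have Kl: "K \<in> sets lebesgue" using K(1) by (simp add: borel_closed)
  have sf: "sqint ?L f"
  proof -
    obtain B where B: "AE x in ?L. \<bar>f x\<bar> \<le> B" and fm: "f \<in> borel_measurable ?L"
      using f by (auto simp: Linf_def)
    interpret finite_measure ?L by (rule finite_measure_open_bounded[OF \<Omega>(3,1)])
    have "integrable ?L (\<lambda>x. (f x)\<^sup>2)"
    proof (rule integrable_const_bound[where B = "B\<^sup>2"])
      show "AE x in ?L. norm ((f x)\<^sup>2) \<le> B\<^sup>2"
        using B
      proof eventually_elim
        case (elim x)
        then have "\<bar>f x\<bar>\<^sup>2 \<le> B\<^sup>2" by (intro power_mono) auto
        then show ?case by simp
      qed
    qed (use fm in measurable)
    then show ?thesis using fm by (simp add: sqint_def)
  qed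
  \<comment> \<open>the cut-off radius is \<open>\<delta>0 / 4\<close>, because the cut-off is bounded below only at four times its radius\<close>
  have far: "4 * (\<delta>0 / 4) \<le> dist x y" if "x \<in> K" for x
  proof -
    have "setdist (closure L0) (frontier \<Omega> \<union> K) \<le> dist y x"
      by (rule setdist_le_dist) (use y that closure_subset in auto)
    then show ?thesis using \<delta>0(2) by (simp add: dist_commute)
  qed
  have y\<Omega>: "y \<in> \<Omega>" using y L0(4) by auto
  have adm: "0 < \<epsilon>" "\<epsilon> < 1" "?A \<epsilon> \<subseteq> \<Omega>" "K \<inter> ?A \<epsilon> = {}" if "\<epsilon> \<in> E" for \<epsilon>
    using E(1) that L0(4) by (auto simp: admissible_eps_def)
  obtain V where V: "\<And>\<epsilon> i. \<epsilon> \<in> E \<Longrightarrow> i \<in> ?W \<Longrightarrow> weak_solution_V m \<Omega> (two_phase \<kappa> (?A \<epsilon>)) (V_poly i) (V \<epsilon> i)"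
    and Vlim: "\<And>i j \<phi>. i \<in> ?W \<Longrightarrow> j \<in> ?W \<Longrightarrow> continuous_on (closure \<Omega>) \<phi> \<Longrightarrow>
        ((\<lambda>\<epsilon>. 1 / measure lebesgue (?A \<epsilon>) * (LINT x|lebesgue_on (?A \<epsilon>). weak_partial \<Omega> j (V \<epsilon> i) x * \<phi> x))
          \<longlongrightarrow> M i j * \<phi> y) (at 0 within E)"
    using M unfolding polarization_tensor_def by blast
  let ?v = "\<lambda>\<epsilon>. two_phase \<kappa> (K \<union> closure (?A \<epsilon>))"
  define q where "q \<epsilon> = tform ?W ?L (indicator (?A \<epsilon>)) (?D (u_eps \<epsilon>)) (?D u) / measure lebesgue (?A \<epsilon>)" for \<epsilon>
  define F where "F \<epsilon> = (J_fun m \<alpha> \<Omega> f (u_eps \<epsilon>) (?v \<epsilon>)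
              - (J_fun m \<alpha> \<Omega> f u (two_phase \<kappa> K) + 2 * \<epsilon> ^ 3 * \<alpha> * (\<kappa> - 1) * ?tq)) / \<epsilon> ^ 3" for \<epsilon>
  have Al: "?A \<epsilon> \<in> sets lebesgue" for \<epsilon> using open_Omega_eps by auto
  have Cl: "closure (?A \<epsilon>) \<in> sets lebesgue" for \<epsilon> by (simp add: borel_closed)
  have pos: "0 < measure lebesgue (?A \<epsilon>)" if "\<epsilon> \<in> E" for \<epsilon>
    using measure_Omega_eps(1)[OF adm(1)[OF that] \<tau>, of y] adm(1)[OF that]
    by (intro less_le_trans[OF _ measure_Omega_eps(1)[OF adm(1)[OF that] \<tau>]]) simp
  have F: "F \<epsilon> = \<alpha> * (\<kappa> - 1) / 2 * (measure lebesgue (?A \<epsilon>) / \<epsilon> ^ 3) * q \<epsilon> - 2 * \<alpha> * (\<kappa> - 1) * ?tq"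
    if e: "\<epsilon> \<in> E" for \<epsilon>
  proof -
    have "J_fun m \<alpha> \<Omega> f (u_eps \<epsilon>) (?v \<epsilon>) - J_fun m \<alpha> \<Omega> f u (two_phase \<kappa> K)
      = \<alpha> * (\<kappa> - 1) / 2 * tform ?W ?L (indicator (?A \<epsilon>)) (?D (u_eps \<epsilon>)) (?D u)"
      by (rule J_fun_difference[OF \<kappa>(1) \<kappa>1 Kl Al Cl AE_closure_Omega_eps adm(4)[OF e] sf u u_eps[OF e]])
        (use adm(1)[OF e] in simp)
    also have "tform ?W ?L (indicator (?A \<epsilon>)) (?D (u_eps \<epsilon>)) (?D u) = measure lebesgue (?A \<epsilon>) * q \<epsilon>"
      using pos[OF e] by (simp add: q_def)
    finally have J: "J_fun m \<alpha> \<Omega> f (u_eps \<epsilon>) (?v \<epsilon>) = J_fun m \<alpha> \<Omega> f u (two_phase \<kappa> K)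
      + \<alpha> * (\<kappa> - 1) / 2 * (measure lebesgue (?A \<epsilon>) * q \<epsilon>)" by linarith
    show ?thesis
      unfolding F_def J using adm(1)[OF e] by (simp add: field_simps)
  qed
  have "(F \<longlongrightarrow> 0) (at 0 within E)"
    unfolding tendsto_at_iff_sequentially
  proof (intro allI impI)
    fix X :: "nat \<Rightarrow> real" assume XE: "\<forall>n. X n \<in> E - {0}" and X0: "X \<longlonglongrightarrow> 0"
    have X: "X n \<in> E" for n using XE by auto
    note Xa = adm[OF X]
    let ?\<mu> = "\<lambda>n. measure lebesgue (?A (X n))"
    have Xw: "filterlim X (at 0 within E) sequentially"
      unfolding filterlim_at using X0 XE by auto
    have small: "\<forall>\<^sub>F n in sequentially. ?A (X n) \<subseteq> ball y \<rho>" if \<rho>: "0 < \<rho>" for \<rho>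
    proof -
      have "(\<lambda>n. X n + (X n)\<^sup>2) \<longlonglongrightarrow> 0 + 0\<^sup>2" by (intro tendsto_intros X0)
      then have "\<forall>\<^sub>F n in sequentially. X n + (X n)\<^sup>2 < \<rho>" using \<rho> by (intro order_tendstoD(2)) auto
      then show ?thesis
      proof eventually_elim
        case (elim n)
        then show ?case
          using Xa(1)[of n] by (intro Omega_eps_subset_ball[OF _ \<tau>]) auto
      qed
    qed
    have \<mu>0: "?\<mu> \<longlonglongrightarrow> 0"
    proof (rule tendsto_sandwich[OF _ _ tendsto_const])
      show "\<forall>\<^sub>F n in sequentially. ?\<mu> n \<le> 4 * X n ^ 3 + 4 * X n ^ 4"
        using measure_Omega_eps(2)[OF Xa(1) \<tau>] by simp
      have "(\<lambda>n. 4 * X n ^ 3 + 4 * X n ^ 4) \<longlonglongrightarrow> 4 * 0 ^ 3 + 4 * 0 ^ 4" by (intro tendsto_intros X0)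
      then show "(\<lambda>n. 4 * X n ^ 3 + 4 * X n ^ 4) \<longlonglongrightarrow> 0" by simp
    qed simp
    have area: "(\<lambda>n. ?\<mu> n / X n ^ 3) \<longlonglongrightarrow> 4"
    proof (rule tendsto_sandwich)
      show "\<forall>\<^sub>F n in sequentially. 4 \<le> ?\<mu> n / X n ^ 3"
        using measure_Omega_eps(1)[OF Xa(1) \<tau>] Xa(1) by (intro always_eventually allI) (simp add: pos_le_divide_eq)
      show "\<forall>\<^sub>F n in sequentially. ?\<mu> n / X n ^ 3 \<le> 4 + 4 * X n"
      proof (intro always_eventually allI)
        fix n
        have "(4 + 4 * X n) * X n ^ 3 = 4 * X n ^ 3 + 4 * X n ^ 4"
          by (simp add: algebra_simps power3_eq_cube power4_eq_xxxx)
        then show "?\<mu> n / X n ^ 3 \<le> 4 + 4 * X n"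
          using measure_Omega_eps(2)[OF Xa(1)[of n] \<tau>, of y] Xa(1)[of n] by (simp add: pos_divide_le_eq)
      qed
      have "(\<lambda>n. 4 + 4 * X n) \<longlonglongrightarrow> 4 + 4 * 0" by (intro tendsto_intros X0)
      then show "(\<lambda>n. 4 + 4 * X n) \<longlonglongrightarrow> 4" by simp
    qed simp
    have "(\<lambda>n. q (X n)) \<longlonglongrightarrow> ?tq"
      unfolding q_def
    proof (rule polarization_limit[OF m \<kappa>(1) \<kappa>1 \<alpha> Kl _ far Al Xa(3) pos[OF X] \<mu>0 Xa(4) Cl AE_closure_Omega_eps small u u_Cm(1,2) y\<Omega> u_Cm(3) u_eps[OF X] V[OF X]])
      show "0 < \<delta>0 / 4" using \<delta>0(1) by simp
      show "0 \<le> X n" for n using Xa(1)[of n] by simp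
      fix i j assume ij: "i \<in> ?W" "j \<in> ?W"
      have "((\<lambda>\<epsilon>. 1 / measure lebesgue (?A \<epsilon>) * (LINT x|lebesgue_on (?A \<epsilon>). weak_partial \<Omega> j (V \<epsilon> i) x * 1))
          \<longlongrightarrow> M i j * 1) (at 0 within E)"
        by (rule Vlim[OF ij continuous_on_const])
      from filterlim_compose[OF this Xw]
      show "(\<lambda>n. (LINT x|lebesgue_on (?A (X n)). weak_partial \<Omega> j (V (X n) i) x) / ?\<mu> n) \<longlonglongrightarrow> M i j"
        by simp
    qed
    then have "(\<lambda>n. \<alpha> * (\<kappa> - 1) / 2 * (?\<mu> n / X n ^ 3) * q (X n) - 2 * \<alpha> * (\<kappa> - 1) * ?tq)
        \<longlonglongrightarrow> \<alpha> * (\<kappa> - 1) / 2 * 4 * ?tq - 2 * \<alpha> * (\<kappa> - 1) * ?tq"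
      by (intro tendsto_intros area)
    then show "(F \<circ> X) \<longlonglongrightarrow> 0"
      using F[OF X] by (simp add: comp_def)
  qed
  then show ?thesis
    unfolding F_def by (intro smalloI_tendsto) (auto simp: eventually_at_filter)
qed

end
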